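(* Let $q\in(0,1)$ and let $\pi$ be an irreducible $*$-representation of the $*$-algebra $Pol(Mat_{2,2})_q$ by bounded operators on a separable Hilbert space $H$. Then $\pi$ is unitarily equivalent to one of the representations in the following 6 series (in each of them, $e_k$, $e_{m,k}$, $e_{m,l,k}$, $e_{s,m,l,k}$ denotes the standard orthonormal basis of the indicated $l_2$-space, all indices running over $\mathbb{Z}^+$). 1) One-dimensional representations $\xi_{\varphi_1,\varphi_2}$, $\varphi_1,\varphi_2\in[0,2\pi)$: $$\xi_{\varphi_1,\varphi_2}(z_1^1)=q^{-1}e^{i\varphi_1},\quad \xi_{\varphi_1,\varphi_2}(z_2^1)=\xi_{\varphi_1,\varphi_2}(z_1^2)=0,\quad \xi_{\varphi_1,\varphi_2}(z_2^2)=e^{i\varphi_2}.$$ 2) Infinite-dimensional representations $\pi_\varphi$ on $H=l_2(\mathbb{Z}^+)$, $\varphi\in[0,2\pi)$: $$\pi_\varphi(z_1^1)e_k=q^{-1}\sqrt{1-q^{2(k+1)}}\,e_{k+1},\quad \pi_\varphi(z_2^2)e_k=e^{i\varphi}e_k,\quad \pi_\varphi(z_2^1)=\pi_\varphi(z_1^2)=0.$$ 3) Infinite-dimensional representations $\rho_{\varphi_1,\varphi_2}$ on $H=l_2(\mathbb{Z}^+)$, $\varphi_1,\varphi_2\in[0,2\pi)$: $$\begin{array}{rcl} \rho_{\varphi_1,\varphi_2}(z_1^1)e_k&=&-e^{i(\varphi_1+\varphi_2)}q^{-1}\sqrt{1-q^{2k}}\,e_{k-1},\\ \rho_{\varphi_1,\varphi_2}(z_2^1)e_k&=&e^{i\varphi_1}q^k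 e_k,\\ \rho_{\varphi_1,\varphi_2}(z_1^2)e_k&=&e^{i\varphi_2}q^k e_k,\\ \rho_{\varphi_1,\varphi_2}(z_2^2)e_k&=&\sqrt{1-q^{2(k+1)}}\,e_{k+1}. \end{array}$$ 4a) Infinite-dimensional representations $\rho^1_\varphi$ on $H=l_2(\mathbb{Z}^+\times\mathbb{Z}^+)$, $\varphi\in[0,2\pi)$: $$\begin{array}{rcl} \rho^1_\varphi(z_1^1)e_{m,k}&=&-e^{i\varphi}q^{-1}\sqrt{1-q^{2(m+1)}}\sqrt{1-q^{2k}}\,e_{m+1,k-1},\\ \rho^1_\varphi(z_2^1)e_{m,k}&=&q^k\sqrt{1-q^{2(m+1)}}\,e_{m+1,k},\\ \rho^1_\varphi(z_1^2)e_{m,k}&=&e^{i\varphi}q^k e_{m,k},\\ \rho^1_\varphi(z_2^2)e_{m,k}&=&\sqrt{1-q^{2(k+1)}}\,e_{m,k+1}. \end{array}$$ 4b) Infinite-dimensional representations $\rho^2_\varphi$ on $H=l_2(\mathbb{Z}^+\times\mathbb{Z}^+)$, $\varphi\in[0,2\pi)$: $$\begin{array}{rcl} \rho^2_\varphi(z_1^1)e_{m,k}&=&-e^{i\varphi}q^{-1}\sqrt{1-q^{2(m+1)}}\sqrt{1-q^{2k}}\,e_{m+1,k-1},\\ \rho^2_\varphi(z_2^1)e_{m,k}&=&e^{i\varphi}q^k e_{m,k},\\ \rho^2_\varphi(z_1^2)e_{m,k}&=&q^k\sqrt{1-q^{2(m+1)}}\,e_{m+1,k},\\ \rho^2_\varphi(z_2^2)e_{m,k}&=&\sqrt{1-q^{2(k+1)}}\,e_{m,k+1}.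 \end{array}$$ 5) Infinite-dimensional representations $\hat\rho_\varphi$ on $H=l_2(\mathbb{Z}^+\times\mathbb{Z}^+\times\mathbb{Z}^+)$, $\varphi\in[0,2\pi)$: $$\begin{array}{rcl} \hat\rho_\varphi(z_1^1)e_{m,l,k}&=&e^{i\varphi}q^{m+l}e_{m,l,k}-q^{-1}\sqrt{(1-q^{2(l+1)})(1-q^{2(m+1)})(1-q^{2k})}\,e_{m+1,l+1,k-1},\\ \hat\rho_\varphi(z_2^1)e_{m,l,k}&=&q^k\sqrt{1-q^{2(m+1)}}\,e_{m+1,l,k},\\ \hat\rho_\varphi(z_1^2)e_{m,l,k}&=&q^k\sqrt{1-q^{2(l+1)}}\,e_{m,l+1,k},\\ \hat\rho_\varphi(z_2^2)e_{m,l,k}&=&\sqrt{1-q^{2(k+1)}}\,e_{m,l,k+1}. \end{array}$$ 6) The infinite-dimensional representation $\rho$ on $H=l_2(\mathbb{Z}^+\times\mathbb{Z}^+\times\mathbb{Z}^+\times\mathbb{Z}^+)$: $$\begin{array}{rcl} \rho(z_1^1)e_{s,m,l,k}&=&q^{m+l}\sqrt{1-q^{2(s+1)}}\,e_{s+1,m,l,k}-q^{-1}\sqrt{(1-q^{2(l+1)})(1-q^{2(m+1)})(1-q^{2k})}\,e_{s,m+1,l+1,k-1},\\ \rho(z_2^1)e_{s,m,l,k}&=&q^k\sqrt{1-q^{2(m+1)}}\,e_{s,m+1,l,k},\\ \rho(z_1^2)e_{s,m,l,k}&=&q^k\sqrt{1-q^{2(l+1)}}\,e_{s,m,l+1,k},\\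 \rho(z_2^2)e_{s,m,l,k}&=&\sqrt{1-q^{2(k+1)}}\,e_{s,m,l,k+1}. \end{array}$$
   Context: $\mathbb{Z}^+=\{0,1,2,\ldots\}$. Terms containing a basis vector with index $k-1=-1$ have coefficient $0$ and are understood to be zero. For $q\in(0,1)$, $Pol(Mat_{2,2})_q$ is the unital $*$-algebra over $\mathbb{C}$ given by generators $z_a^\alpha$, $a,\alpha\in\{1,2\}$ (lower index $a$, upper index $\alpha$; the upper index is not a power), and the following relations: (i) $$\begin{array}{ll} z_1^1z_2^1=qz_2^1z_1^1,& z_2^1z_1^2=z_1^2z_2^1,\\ z_1^1z_1^2=qz_1^2z_1^1,& z_2^1z_2^2=qz_2^2z_2^1,\\ z_1^1z_2^2-z_2^2z_1^1=(q-q^{-1})z_1^2z_2^1,& z_1^2z_2^2=qz_2^2z_1^2; \end{array}$$ (ii) $$\begin{array}{rcl} (z_1^1)^*z_1^1&=&q^2z_1^1(z_1^1)^*-(1-q^2)\bigl(z_2^1(z_2^1)^*+z_1^2(z_1^2)^*\bigr)+q^{-2}(1-q^2)^2z_2^2(z_2^2)^*+1-q^2,\\ (z_2^1)^*z_2^1&=&q^2z_2^1(z_2^1)^*-(1-q^2)z_2^2(z_2^2)^*+1-q^2,\\ (z_1^2)^*z_1^2&=&q^2z_1^2(z_1^2)^*-(1-q^2)z_2^2(z_2^2)^*+1-q^2,\\ (z_2^2)^*z_2^2&=&q^2z_2^2(z_2^2)^*+1-q^2; \end{array}$$ (iii) $$\begin{array}{ll} (z_1^1)^*z_2^1-qz_2^1(z_1^1)^*=(q-q^{-1})z_2^2(z_1^2)^*,&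 (z_2^2)^*z_2^1=qz_2^1(z_2^2)^*,\\ (z_1^1)^*z_1^2-qz_1^2(z_1^1)^*=(q-q^{-1})z_2^2(z_2^1)^*,& (z_2^2)^*z_1^2=qz_1^2(z_2^2)^*,\\ (z_1^1)^*z_2^2=z_2^2(z_1^1)^*,& (z_2^1)^*z_1^2=z_1^2(z_2^1)^*. \end{array}$$ A representation means a unital $*$-homomorphism into the bounded operators on a nonzero separable Hilbert space; it is irreducible if there is no nontrivial closed subspace invariant under all operators of the representation. A representation is determined by its values on the generators $z_a^\alpha$. *)

theory Defs
  imports "HOL-Analysis.Analysis" "HOL-Algebra.Module"
begin

section \<open>Complex Hilbert spaces\<close>

class scaleC =
  fixes scaleC :: "complex \<Rightarrow> 'a \<Rightarrow> 'a" (infixr \<open>*\<^sub>C\<close> 75)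

text \<open>The inner product is linear in the first argument. Completeness is part of \<^class>\<open>banach\<close>.\<close>

class chilbert_space = banach + scaleC +
  fixes cinner :: "'a \<Rightarrow> 'a \<Rightarrow> complex"
  assumes scaleC_add_right: "c *\<^sub>C (x + y) = c *\<^sub>C x + c *\<^sub>C y"
    and scaleC_add_left: "(c + d) *\<^sub>C x = c *\<^sub>C x + d *\<^sub>C x"
    and scaleC_scaleC: "c *\<^sub>C d *\<^sub>C x = (c * d) *\<^sub>C x"
    and scaleC_one: "1 *\<^sub>C x = x"
    and scaleR_scaleC: "r *\<^sub>R x = complex_of_real r *\<^sub>C x"
    and cinner_commute: "cinner x y = cnj (cinner y x)"
    and cinner_add_left: "cinner (x + y) z = cinner x z + cinner y z"
    and cinner_scaleC_left: "cinner (c *\<^sub>C x) y = c * cinner x y"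
    and cinner_self_nonneg: "0 \<le> Re (cinner x x)"
    and cinner_self_eq_0: "cinner x x = 0 \<longleftrightarrow> x = 0"
    and norm_eq_sqrt_cinner: "norm x = sqrt (Re (cinner x x))"

instantiation complex :: chilbert_space
begin

definition scaleC_complex :: "complex \<Rightarrow> complex \<Rightarrow> complex"
  where "scaleC_complex c x = c * x"

definition cinner_complex :: "complex \<Rightarrow> complex \<Rightarrow> complex"
  where "cinner_complex x y = x * cnj y"

instance
  by standard
    (auto simp: scaleC_complex_def cinner_complex_def algebra_simps scaleR_conv_of_real
      cmod_def power2_eq_square)

end

subsection \<open>The Hilbert space of square-summable families\<close>

typedef 'i ell2 = "{f :: 'i \<Rightarrow> complex. (\<lambda>i. (cmod (f i))\<^sup>2) summable_on UNIV}"
  morphisms coord Abs_ell2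
  by (rule exI[of _ "\<lambda>_. 0"]) simp

setup_lifting type_definition_ell2

lemma ell2_eqI: "(\<And>i. coord f i = coord g i) \<Longrightarrow> f = g"
  by (metis coord_inject ext)

lemma coord_summable: "(\<lambda>i. (cmod (coord f i))\<^sup>2) summable_on UNIV"
  using coord[of f] by simp

lemma L2_set_le_infsum:
  assumes "(\<lambda>i. (cmod (f i))\<^sup>2) summable_on UNIV" "finite F"
  shows "L2_set (\<lambda>i. cmod (f i)) F \<le> sqrt (\<Sum>\<^sub>\<infinity>i. (cmod (f i))\<^sup>2)"
  unfolding L2_set_def
  by (rule real_sqrt_le_mono, rule finite_sum_le_infsum) (use assms in auto)

lemma ell2_of_L2_set_bound:
  assumes "\<And>F. finite F \<Longrightarrow> L2_set (\<lambda>i. cmod (f i)) F \<le> B"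
  shows "(\<lambda>i. (cmod (f i))\<^sup>2) summable_on UNIV"
    and "sqrt (\<Sum>\<^sub>\<infinity>i. (cmod (f i))\<^sup>2) \<le> B"
proof -
  have B: "B \<ge> 0"
    using assms[of "{}"] by simp
  have le: "(\<Sum>i\<in>F. (cmod (f i))\<^sup>2) \<le> B\<^sup>2" if "finite F" for F
  proof -
    have "sqrt (\<Sum>i\<in>F. (cmod (f i))\<^sup>2) \<le> B"
      using assms[OF that] unfolding L2_set_def .
    then show ?thesis
      by (rule sqrt_le_D)
  qed
  show s: "(\<lambda>i. (cmod (f i))\<^sup>2) summable_on UNIV"
    by (rule nonneg_bdd_above_summable_on) (auto intro!: bdd_aboveI2[where M = "B\<^sup>2"] le)
  have "(\<Sum>\<^sub>\<infinity>i. (cmod (f i))\<^sup>2) \<le> B\<^sup>2"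
    by (rule infsum_le_finite_sums[OF s]) (use le in auto)
  then show "sqrt (\<Sum>\<^sub>\<infinity>i. (cmod (f i))\<^sup>2) \<le> B"
    using B real_le_lsqrt by blast
qed

lemma L2_set_add_le:
  assumes "(\<lambda>i. (cmod (f i))\<^sup>2) summable_on UNIV" "(\<lambda>i. (cmod (g i))\<^sup>2) summable_on UNIV"
    and "finite F"
  shows "L2_set (\<lambda>i. cmod (f i + g i)) F
    \<le> sqrt (\<Sum>\<^sub>\<infinity>i. (cmod (f i))\<^sup>2) + sqrt (\<Sum>\<^sub>\<infinity>i. (cmod (g i))\<^sup>2)"
proof -
  have "L2_set (\<lambda>i. cmod (f i + g i)) F \<le> L2_set (\<lambda>i. cmod (f i) + cmod (g i)) F"
    by (rule L2_set_mono) (auto intro: norm_triangle_ineq)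
  also have "\<dots> \<le> L2_set (\<lambda>i. cmod (f i)) F + L2_set (\<lambda>i. cmod (g i)) F"
    by (rule L2_set_triangle_ineq)
  finally show ?thesis
    using L2_set_le_infsum[OF assms(1,3)] L2_set_le_infsum[OF assms(2,3)] by linarith
qed

lemma ell2_scale:
  assumes "(\<lambda>i. (cmod (f i))\<^sup>2) summable_on UNIV"
  shows "(\<lambda>i. (cmod (c * f i))\<^sup>2) summable_on UNIV"
  using summable_on_cmult_right[OF assms, of "(cmod c)\<^sup>2"]
  by (simp add: norm_mult power_mult_distrib)

lemma ell2_add:
  assumes "(\<lambda>i. (cmod (f i))\<^sup>2) summable_on UNIV" "(\<lambda>i. (cmod (g i))\<^sup>2) summable_on UNIV"
  shows "(\<lambda>i. (cmod (f i + g i))\<^sup>2) summable_on UNIV"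
  by (rule ell2_of_L2_set_bound) (rule L2_set_add_le[OF assms])

lemma ell2_prod_summable:
  assumes "(\<lambda>i. (cmod (f i))\<^sup>2) summable_on UNIV" "(\<lambda>i. (cmod (g i))\<^sup>2) summable_on UNIV"
  shows "(\<lambda>i. f i * cnj (g i)) summable_on UNIV"
proof (rule abs_summable_summable, rule summable_on_comparison_test)
  show "(\<lambda>i. (cmod (f i))\<^sup>2 + (cmod (g i))\<^sup>2) summable_on UNIV"
    using assms by (rule summable_on_add)
  show "0 \<le> norm (f i * cnj (g i))" for i
    by simp
  show "norm (f i * cnj (g i)) \<le> (cmod (f i))\<^sup>2 + (cmod (g i))\<^sup>2" for i
  proof -
    have "2 * (cmod (f i) * cmod (g i)) \<le> (cmod (f i))\<^sup>2 + (cmod (g i))\<^sup>2"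
      using sum_squares_bound[of "cmod (f i)" "cmod (g i)"] by simp
    moreover have "0 \<le> cmod (f i) * cmod (g i)"
      by simp
    ultimately show ?thesis
      unfolding norm_mult complex_mod_cnj by linarith
  qed
qed

instantiation ell2 :: (type) "{real_vector, scaleC}"
begin

lift_definition zero_ell2 :: "'a ell2" is "\<lambda>_. 0"
  by simp

lift_definition uminus_ell2 :: "'a ell2 \<Rightarrow> 'a ell2" is "\<lambda>f i. - f i"
  by simp

lift_definition plus_ell2 :: "'a ell2 \<Rightarrow> 'a ell2 \<Rightarrow> 'a ell2" is "\<lambda>f g i. f i + g i"
  by (rule ell2_add)

lift_definition minus_ell2 :: "'a ell2 \<Rightarrow> 'a ell2 \<Rightarrow> 'a ell2" is "\<lambda>f g i. f i - g i"
proof -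
  fix f g :: "'a \<Rightarrow> complex"
  assume f: "(\<lambda>i. (cmod (f i))\<^sup>2) summable_on UNIV"
    and g: "(\<lambda>i. (cmod (g i))\<^sup>2) summable_on UNIV"
  show "(\<lambda>i. (cmod (f i - g i))\<^sup>2) summable_on UNIV"
    using ell2_add[OF f, of "\<lambda>i. - g i"] g by simp
qed

lift_definition scaleC_ell2 :: "complex \<Rightarrow> 'a ell2 \<Rightarrow> 'a ell2" is "\<lambda>c f i. c * f i"
  by (rule ell2_scale)

lift_definition scaleR_ell2 :: "real \<Rightarrow> 'a ell2 \<Rightarrow> 'a ell2" is "\<lambda>r f i. complex_of_real r * f i"
  by (rule ell2_scale)

instance
proof
  fix x y z :: "'a ell2" and a b :: real
  show "x + y + z = x + (y + z)" "x + y = y + x" "0 + x = x" "- x + x = 0" "x - y = x + - y"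
    by (transfer, simp add: algebra_simps)+
  show "a *\<^sub>R (x + y) = a *\<^sub>R x + a *\<^sub>R y" "(a + b) *\<^sub>R x = a *\<^sub>R x + b *\<^sub>R x"
    "a *\<^sub>R b *\<^sub>R x = (a * b) *\<^sub>R x" "1 *\<^sub>R x = x"
    by (transfer, simp add: algebra_simps)+
qed

end

instantiation ell2 :: (type) real_normed_vector
begin

lift_definition norm_ell2 :: "'a ell2 \<Rightarrow> real" is "\<lambda>f. sqrt (\<Sum>\<^sub>\<infinity>i. (cmod (f i))\<^sup>2)" .

definition sgn_ell2 :: "'a ell2 \<Rightarrow> 'a ell2"
  where "sgn_ell2 x = x /\<^sub>R norm x"

definition dist_ell2 :: "'a ell2 \<Rightarrow> 'a ell2 \<Rightarrow> real"
  where "dist_ell2 x y = norm (x - y)"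

definition uniformity_ell2 :: "('a ell2 \<times> 'a ell2) filter"
  where "uniformity_ell2 = (INF e\<in>{0<..}. principal {(x, y). dist x y < e})"

definition open_ell2 :: "'a ell2 set \<Rightarrow> bool"
  where "open_ell2 U \<longleftrightarrow> (\<forall>x\<in>U. \<forall>\<^sub>F (x', y) in uniformity. x' = x \<longrightarrow> y \<in> U)"

instance
proof
  fix x y :: "'a ell2" and a :: real
  show "dist x y = norm (x - y)"
    by (rule dist_ell2_def)
  show "sgn x = x /\<^sub>R norm x"
    by (rule sgn_ell2_def)
  show "uniformity = (INF e\<in>{0<..}. principal {(x :: 'a ell2, y). dist x y < e})"
    by (rule uniformity_ell2_def)
  show "open U \<longleftrightarrow> (\<forall>x\<in>U. \<forall>\<^sub>F (x', y) in uniformity. x' = x \<longrightarrow> y \<in> U)" for U :: "'a ell2 set"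
    by (rule open_ell2_def)
  show "norm x = 0 \<longleftrightarrow> x = 0"
  proof
    assume "norm x = 0"
    then have 0: "(\<Sum>\<^sub>\<infinity>i. (cmod (coord x i))\<^sup>2) \<le> 0"
      by (simp add: norm_ell2.rep_eq)
    have "(cmod (coord x i))\<^sup>2 = 0" for i
      by (rule nonneg_infsum_le_0D[OF 0 coord_summable]) auto
    then show "x = 0"
      by (intro ell2_eqI) (simp add: zero_ell2.rep_eq)
  qed (simp add: norm_ell2.rep_eq zero_ell2.rep_eq)
  show "norm (x + y) \<le> norm x + norm y"
    unfolding norm_ell2.rep_eq plus_ell2.rep_eq
    by (rule ell2_of_L2_set_bound) (rule L2_set_add_le[OF coord_summable coord_summable])
  show "norm (a *\<^sub>R x) = \<bar>a\<bar> * norm x"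
    unfolding norm_ell2.rep_eq scaleR_ell2.rep_eq
    by (simp add: norm_mult power_mult_distrib infsum_cmult_right' real_sqrt_mult)
qed

end

lemma L2_set_coord_le_norm: "finite F \<Longrightarrow> L2_set (\<lambda>i. cmod (coord x i)) F \<le> norm x"
  unfolding norm_ell2.rep_eq by (rule L2_set_le_infsum[OF coord_summable])

lemma cmod_coord_le_norm: "cmod (coord x i) \<le> norm x"
  using L2_set_coord_le_norm[of "{i}" x] by simp

instantiation ell2 :: (type) chilbert_space
begin

lift_definition cinner_ell2 :: "'a ell2 \<Rightarrow> 'a ell2 \<Rightarrow> complex"
  is "\<lambda>f g. \<Sum>\<^sub>\<infinity>i. f i * cnj (g i)" .

instance
proof
  fix x y z :: "'a ell2" and c d :: complex and r :: real
  show "c *\<^sub>C (x + y) = c *\<^sub>C x + c *\<^sub>C y" "(c + d) *\<^sub>C x = c *\<^sub>C x + d *\<^sub>C x"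
    "c *\<^sub>C d *\<^sub>C x = (c * d) *\<^sub>C x" "1 *\<^sub>C x = x" "r *\<^sub>R x = complex_of_real r *\<^sub>C x"
    by (transfer, simp add: algebra_simps)+
  show "cinner x y = cnj (cinner y x)"
    unfolding cinner_ell2.rep_eq by (subst infsum_cnj[symmetric]) (simp add: mult.commute)
  show "cinner (x + y) z = cinner x z + cinner y z"
    unfolding cinner_ell2.rep_eq plus_ell2.rep_eq distrib_right
    by (rule infsum_add) (rule ell2_prod_summable[OF coord_summable coord_summable])+
  show "cinner (c *\<^sub>C x) y = c * cinner x y"
    unfolding cinner_ell2.rep_eq scaleC_ell2.rep_eq mult.assoc by (rule infsum_cmult_right')
  have self: "cinner x x = complex_of_real ((norm x)\<^sup>2)"
  proof -
    have "cinner x x = (\<Sum>\<^sub>\<infinity>i. complex_of_real ((cmod (coord x i))\<^sup>2))"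
      unfolding cinner_ell2.rep_eq by (simp only: complex_norm_square)
    also have "\<dots> = complex_of_real (\<Sum>\<^sub>\<infinity>i. (cmod (coord x i))\<^sup>2)"
      by (rule infsumI, rule has_sum_of_real, rule has_sum_infsum, rule coord_summable)
    also have "(\<Sum>\<^sub>\<infinity>i. (cmod (coord x i))\<^sup>2) = (norm x)\<^sup>2"
      unfolding norm_ell2.rep_eq by (simp add: infsum_nonneg)
    finally show ?thesis .
  qed
  show "0 \<le> Re (cinner x x)" "cinner x x = 0 \<longleftrightarrow> x = 0" "norm x = sqrt (Re (cinner x x))"
    unfolding self by simp_all
next
  fix X :: "nat \<Rightarrow> 'a ell2"
  assume X: "Cauchy X"
  have "Cauchy (\<lambda>n. coord (X n) i)" for i
  proof (rule CauchyI)
    fix e :: real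
    assume "0 < e"
    then obtain N where "\<And>m n. m \<ge> N \<Longrightarrow> n \<ge> N \<Longrightarrow> norm (X m - X n) < e"
      using CauchyD[OF X] by blast
    moreover have "norm (coord (X m) i - coord (X n) i) \<le> norm (X m - X n)" for m n
      using cmod_coord_le_norm[of "X m - X n" i] by (simp add: minus_ell2.rep_eq)
    ultimately show "\<exists>N. \<forall>m\<ge>N. \<forall>n\<ge>N. norm (coord (X m) i - coord (X n) i) < e"
      by (meson le_less_trans)
  qed
  then have "\<forall>i. \<exists>l. (\<lambda>n. coord (X n) i) \<longlonglongrightarrow> l"
    using Cauchy_convergent convergent_def by blast
  then obtain f where f: "\<And>i. (\<lambda>n. coord (X n) i) \<longlonglongrightarrow> f i"
    by metis
  have bound: "L2_set (\<lambda>i. cmod (coord (X n) i - f i)) F \<le> e"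
    if N: "\<And>m n. m \<ge> N \<Longrightarrow> n \<ge> N \<Longrightarrow> norm (X m - X n) < e" and n: "n \<ge> N" and F: "finite F"
    for e N n and F :: "'a set"
  proof (rule LIMSEQ_le_const2)
    show "(\<lambda>m. L2_set (\<lambda>i. cmod (coord (X n) i - coord (X m) i)) F)
        \<longlonglongrightarrow> L2_set (\<lambda>i. cmod (coord (X n) i - f i)) F"
      unfolding L2_set_def by (intro tendsto_intros f)
    show "\<exists>M. \<forall>m\<ge>M. L2_set (\<lambda>i. cmod (coord (X n) i - coord (X m) i)) F \<le> e"
    proof (intro exI[of _ N] allI impI)
      fix m assume "m \<ge> N"
      then have "norm (X n - X m) < e"
        using N n by blast
      then show "L2_set (\<lambda>i. cmod (coord (X n) i - coord (X m) i)) F \<le> e"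
        using L2_set_coord_le_norm[OF F, of "X n - X m"] by (simp add: minus_ell2.rep_eq)
    qed
  qed
  obtain N1 where N1: "\<And>m n. m \<ge> N1 \<Longrightarrow> n \<ge> N1 \<Longrightarrow> norm (X m - X n) < 1"
    using CauchyD[OF X, of 1] by auto
  have "(\<lambda>i. (cmod (coord (X N1) i - f i))\<^sup>2) summable_on UNIV"
    by (rule ell2_of_L2_set_bound) (rule bound[OF N1 order_refl])
  then have "(\<lambda>i. (cmod (f i - coord (X N1) i))\<^sup>2) summable_on UNIV"
    by (simp add: norm_minus_commute)
  from ell2_add[OF this coord_summable[of "X N1"]]
  have fs: "(\<lambda>i. (cmod (f i))\<^sup>2) summable_on UNIV"
    by simp
  then have coord_f: "coord (Abs_ell2 f) = f"
    by (simp add: Abs_ell2_inverse)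
  have "X \<longlonglongrightarrow> Abs_ell2 f"
  proof (rule LIMSEQ_I)
    fix e :: real
    assume "0 < e"
    then obtain N where N: "\<And>m n. m \<ge> N \<Longrightarrow> n \<ge> N \<Longrightarrow> norm (X m - X n) < e / 2"
      using CauchyD[OF X, of "e / 2"] by auto
    have "norm (X n - Abs_ell2 f) \<le> e / 2" if "n \<ge> N" for n
      unfolding norm_ell2.rep_eq minus_ell2.rep_eq coord_f
      by (rule ell2_of_L2_set_bound) (rule bound[OF N that])
    then have "\<forall>n\<ge>N. norm (X n - Abs_ell2 f) < e"
      using \<open>0 < e\<close> by fastforce
    then show "\<exists>N. \<forall>n\<ge>N. norm (X n - Abs_ell2 f) < e" ..
  qed
  then show "convergent X"
    by (rule convergentI)
qed

end

text \<open>The standard orthonormal basis.\<close>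

lift_definition ket :: "'i \<Rightarrow> 'i ell2" is "\<lambda>i j. if j = i then 1 else 0"
proof -
  fix i :: 'i
  have "(\<lambda>j. (cmod (if j = i then 1 else 0))\<^sup>2) summable_on {i}"
    by simp
  then show "(\<lambda>j. (cmod (if j = i then 1 else 0))\<^sup>2) summable_on UNIV"
    by (rule summable_on_cong_neutral[THEN iffD1, rotated -1]) auto
qed


section \<open>Star algebras and their representations\<close>

record ('c, 'a) star_algebra = "('c, 'a) module" +
  invol :: "'a \<Rightarrow> 'a"

definition bounded_clinear :: "('h :: chilbert_space \<Rightarrow> 'k :: chilbert_space) \<Rightarrow> bool"
  where "bounded_clinear T \<longleftrightarrow>
    (\<forall>x y. T (x + y) = T x + T y) \<and> (\<forall>c x. T (c *\<^sub>C x) = c *\<^sub>C T x) \<and>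
    (\<exists>K. \<forall>x. norm (T x) \<le> K * norm x)"

text \<open>The last conjunct says that \<open>\<pi>\<close> maps the involution to the Hilbert space adjoint. No
  condition is imposed on \<open>\<pi>\<close> outside the carrier.\<close>

definition star_representation ::
    "(complex, 'a) star_algebra \<Rightarrow> ('a \<Rightarrow> 'h :: chilbert_space \<Rightarrow> 'h) \<Rightarrow> bool"
  where "star_representation A \<pi> \<longleftrightarrow>
    (\<exists>x :: 'h. x \<noteq> 0) \<and> separable_space (euclidean :: 'h topology) \<and>
    (\<forall>a\<in>carrier A. bounded_clinear (\<pi> a)) \<and>
    (\<forall>a\<in>carrier A. \<forall>b\<in>carrier A. \<forall>x. \<pi> (a \<oplus>\<^bsub>A\<^esub> b) x = \<pi> a x + \<pi> b x) \<and>
    (\<forall>c. \<forall>a\<in>carrier A. \<forall>x. \<pi> (c \<odot>\<^bsub>A\<^esub> a) x = c *\<^sub>C \<pi> a x) \<and>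
    (\<forall>a\<in>carrier A. \<forall>b\<in>carrier A. \<forall>x. \<pi> (a \<otimes>\<^bsub>A\<^esub> b) x = \<pi> a (\<pi> b x)) \<and>
    (\<forall>x. \<pi> \<one>\<^bsub>A\<^esub> x = x) \<and>
    (\<forall>a\<in>carrier A. \<forall>x y. cinner (\<pi> (invol A a) x) y = cinner x (\<pi> a y))"

definition closed_csubspace :: "'h :: chilbert_space set \<Rightarrow> bool"
  where "closed_csubspace S \<longleftrightarrow> closed S \<and> 0 \<in> S \<and>
    (\<forall>x\<in>S. \<forall>y\<in>S. x + y \<in> S) \<and> (\<forall>c. \<forall>x\<in>S. c *\<^sub>C x \<in> S)"

definition irreducible_representation ::
    "(complex, 'a) star_algebra \<Rightarrow> ('a \<Rightarrow> 'h :: chilbert_space \<Rightarrow> 'h) \<Rightarrow> bool"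
  where "irreducible_representation A \<pi> \<longleftrightarrow> star_representation A \<pi> \<and>
    (\<forall>S. closed_csubspace S \<and> (\<forall>a\<in>carrier A. \<pi> a ` S \<subseteq> S) \<longrightarrow> S = {0} \<or> S = UNIV)"

definition unitary_map :: "('h :: chilbert_space \<Rightarrow> 'k :: chilbert_space) \<Rightarrow> bool"
  where "unitary_map U \<longleftrightarrow> bounded_clinear U \<and> surj U \<and> (\<forall>x y. cinner (U x) (U y) = cinner x y)"

definition unitarily_equivalent ::
    "(complex, 'a) star_algebra \<Rightarrow> ('a \<Rightarrow> 'h :: chilbert_space \<Rightarrow> 'h)
      \<Rightarrow> ('a \<Rightarrow> 'k :: chilbert_space \<Rightarrow> 'k) \<Rightarrow> bool"
  where "unitarily_equivalent A \<pi> \<sigma> \<longleftrightarrow>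
    (\<exists>U. unitary_map U \<and> (\<forall>a\<in>carrier A. \<forall>x. U (\<pi> a x) = \<sigma> a (U x)))"


section \<open>The algebra of polynomials on quantum 2 by 2 matrices\<close>

text \<open>The unital star-algebra with given generators and relations is constructed as the algebra of
  formal star-algebra expressions in the generators, modulo the least congruence that contains
  the relations and the axioms of unital complex star-algebras.\<close>

text \<open>In \<open>Zab\<close> the first digit is the lower index of the generator, the second one the upper index.\<close>

datatype gen = Z11 | Z21 | Z12 | Z22

datatype expr =
  Gen gen | Zero | One | Add expr expr | Mult expr expr | Scale complex expr
  | Star expr (\<open>_\<^sup>\<star>\<close> [1000] 1000)

instantiation expr :: "{zero, one, plus, minus, times, scaleC}"
begin

definition zero_expr :: expr where "0 = Zero"
definition one_expr :: expr where "1 = One"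
definition plus_expr :: "expr \<Rightarrow> expr \<Rightarrow> expr" where "x + y = Add x y"
definition times_expr :: "expr \<Rightarrow> expr \<Rightarrow> expr" where "x * y = Mult x y"
definition scaleC_expr :: "complex \<Rightarrow> expr \<Rightarrow> expr" where "c *\<^sub>C x = Scale c x"
definition minus_expr :: "expr \<Rightarrow> expr \<Rightarrow> expr" where "x - y = x + (- 1) *\<^sub>C (y :: expr)"

instance ..

end

definition pol_relations :: "real \<Rightarrow> (expr \<times> expr) set"
  where "pol_relations r =
   (let q = complex_of_real r; z11 = Gen Z11; z21 = Gen Z21; z12 = Gen Z12; z22 = Gen Z22 in
    {(z11 * z21, q *\<^sub>C (z21 * z11)),
     (z21 * z12, z12 * z21),
     (z11 * z12, q *\<^sub>C (z12 * z11)),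
     (z21 * z22, q *\<^sub>C (z22 * z21)),
     (z11 * z22 - z22 * z11, (q - inverse q) *\<^sub>C (z12 * z21)),
     (z12 * z22, q *\<^sub>C (z22 * z12))} \<union>
    {(z11\<^sup>\<star> * z11,
        q\<^sup>2 *\<^sub>C (z11 * z11\<^sup>\<star>) - (1 - q\<^sup>2) *\<^sub>C (z21 * z21\<^sup>\<star> + z12 * z12\<^sup>\<star>)
        + (inverse (q\<^sup>2) * (1 - q\<^sup>2)\<^sup>2) *\<^sub>C (z22 * z22\<^sup>\<star>) + (1 - q\<^sup>2) *\<^sub>C 1),
     (z21\<^sup>\<star> * z21,
        q\<^sup>2 *\<^sub>C (z21 * z21\<^sup>\<star>) - (1 - q\<^sup>2) *\<^sub>C (z22 * z22\<^sup>\<star>) + (1 - q\<^sup>2) *\<^sub>C 1),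
     (z12\<^sup>\<star> * z12,
        q\<^sup>2 *\<^sub>C (z12 * z12\<^sup>\<star>) - (1 - q\<^sup>2) *\<^sub>C (z22 * z22\<^sup>\<star>) + (1 - q\<^sup>2) *\<^sub>C 1),
     (z22\<^sup>\<star> * z22, q\<^sup>2 *\<^sub>C (z22 * z22\<^sup>\<star>) + (1 - q\<^sup>2) *\<^sub>C 1)} \<union>
    {(z11\<^sup>\<star> * z21 - q *\<^sub>C (z21 * z11\<^sup>\<star>), (q - inverse q) *\<^sub>C (z22 * z12\<^sup>\<star>)),
     (z22\<^sup>\<star> * z21, q *\<^sub>C (z21 * z22\<^sup>\<star>)),
     (z11\<^sup>\<star> * z12 - q *\<^sub>C (z12 * z11\<^sup>\<star>), (q - inverse q) *\<^sub>C (z22 * z21\<^sup>\<star>)),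
     (z22\<^sup>\<star> * z12, q *\<^sub>C (z12 * z22\<^sup>\<star>)),
     (z11\<^sup>\<star> * z22, z22 * z11\<^sup>\<star>),
     (z21\<^sup>\<star> * z12, z12 * z21\<^sup>\<star>)})"

inductive pol_eq :: "real \<Rightarrow> expr \<Rightarrow> expr \<Rightarrow> bool" for q :: real
  where
    rel: "(x, y) \<in> pol_relations q \<Longrightarrow> pol_eq q x y"
  | refl: "pol_eq q x x"
  | sym: "pol_eq q x y \<Longrightarrow> pol_eq q y x"
  | trans: "pol_eq q x y \<Longrightarrow> pol_eq q y z \<Longrightarrow> pol_eq q x z"
  | add_cong: "pol_eq q x x' \<Longrightarrow> pol_eq q y y' \<Longrightarrow> pol_eq q (x + y) (x' + y')"
  | mult_cong: "pol_eq q x x' \<Longrightarrow> pol_eq q y y' \<Longrightarrow> pol_eq q (x * y) (x' * y')"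
  | scale_cong: "pol_eq q x x' \<Longrightarrow> pol_eq q (c *\<^sub>C x) (c *\<^sub>C x')"
  | star_cong: "pol_eq q x x' \<Longrightarrow> pol_eq q (x\<^sup>\<star>) (x'\<^sup>\<star>)"
  | add_assoc: "pol_eq q (x + y + z) (x + (y + z))"
  | add_commute: "pol_eq q (x + y) (y + x)"
  | add_zero: "pol_eq q (0 + x) x"
  | add_inverse: "pol_eq q ((- 1) *\<^sub>C x + x) 0"
  | scale_add_right: "pol_eq q (c *\<^sub>C (x + y)) (c *\<^sub>C x + c *\<^sub>C y)"
  | scale_add_left: "pol_eq q ((c + d) *\<^sub>C x) (c *\<^sub>C x + d *\<^sub>C x)"
  | scale_scale: "pol_eq q (c *\<^sub>C d *\<^sub>C x) ((c * d) *\<^sub>C x)"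
  | scale_one: "pol_eq q (1 *\<^sub>C x) x"
  | mult_assoc: "pol_eq q (x * y * z) (x * (y * z))"
  | mult_one_left: "pol_eq q (1 * x) x"
  | mult_one_right: "pol_eq q (x * 1) x"
  | distrib_right: "pol_eq q ((x + y) * z) (x * z + y * z)"
  | distrib_left: "pol_eq q (x * (y + z)) (x * y + x * z)"
  | scale_mult_left: "pol_eq q ((c *\<^sub>C x) * y) (c *\<^sub>C (x * y))"
  | scale_mult_right: "pol_eq q (x * (c *\<^sub>C y)) (c *\<^sub>C (x * y))"
  | star_star: "pol_eq q (x\<^sup>\<star>\<^sup>\<star>) x"
  | star_add: "pol_eq q ((x + y)\<^sup>\<star>) (x\<^sup>\<star> + y\<^sup>\<star>)"
  | star_scale: "pol_eq q ((c *\<^sub>C x)\<^sup>\<star>) (cnj c *\<^sub>C x\<^sup>\<star>)"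
  | star_mult: "pol_eq q ((x * y)\<^sup>\<star>) (y\<^sup>\<star> * x\<^sup>\<star>)"

definition pol_class :: "real \<Rightarrow> expr \<Rightarrow> expr set"
  where "pol_class q x = {y. pol_eq q x y}"

definition Pol :: "real \<Rightarrow> (complex, expr set) star_algebra"
  where "Pol q = \<lparr>
    carrier = range (pol_class q),
    mult = (\<lambda>X Y. \<Union>x\<in>X. \<Union>y\<in>Y. pol_class q (x * y)),
    one = pol_class q 1,
    zero = pol_class q 0,
    add = (\<lambda>X Y. \<Union>x\<in>X. \<Union>y\<in>Y. pol_class q (x + y)),
    smult = (\<lambda>c X. \<Union>x\<in>X. pol_class q (c *\<^sub>C x)),
    invol = (\<lambda>X. \<Union>x\<in>X. pol_class q (x\<^sup>\<star>))\<rparr>"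

lemma pol_class_eq_iff: "pol_class q x = pol_class q y \<longleftrightarrow> pol_eq q x y"
proof
  assume "pol_class q x = pol_class q y"
  then have "y \<in> pol_class q x"
    by (simp add: pol_class_def pol_eq.refl)
  then show "pol_eq q x y"
    by (simp add: pol_class_def)
next
  assume "pol_eq q x y"
  then show "pol_class q x = pol_class q y"
    unfolding pol_class_def by (blast intro: pol_eq.sym pol_eq.trans)
qed

lemma pol_class_self: "x \<in> pol_class q x"
  by (simp add: pol_class_def pol_eq.refl)

lemma Pol_carrier: "carrier (Pol q) = range (pol_class q)"
  and Pol_one: "\<one>\<^bsub>Pol q\<^esub> = pol_class q 1"
  and Pol_zero: "\<zero>\<^bsub>Pol q\<^esub> = pol_class q 0"
  by (simp_all add: Pol_def)

lemma UN_eq_const: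
  assumes "a \<in> A" "\<And>x. x \<in> A \<Longrightarrow> f x = c"
  shows "(\<Union>x\<in>A. f x) = c"
proof -
  have "(\<Union>x\<in>A. f x) = (\<Union>x\<in>A. c)"
    using assms(2) by (rule SUP_cong[OF HOL.refl])
  then show ?thesis
    using assms(1) by auto
qed

lemma Pol_mult: "pol_class q x \<otimes>\<^bsub>Pol q\<^esub> pol_class q y = pol_class q (x * y)"
proof -
  have "pol_class q (x' * y') = pol_class q (x * y)"
    if "x' \<in> pol_class q x" "y' \<in> pol_class q y" for x' y'
    unfolding pol_class_eq_iff
    by (rule pol_eq.sym, rule pol_eq.mult_cong) (use that in \<open>simp_all add: pol_class_def\<close>)
  then have "(\<Union>x'\<in>pol_class q x. \<Union>y'\<in>pol_class q y. pol_class q (x' * y')) = pol_class q (x * y)"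
    by (intro UN_eq_const[OF pol_class_self])
  then show ?thesis
    by (simp add: Pol_def)
qed

lemma Pol_add: "pol_class q x \<oplus>\<^bsub>Pol q\<^esub> pol_class q y = pol_class q (x + y)"
proof -
  have "pol_class q (x' + y') = pol_class q (x + y)"
    if "x' \<in> pol_class q x" "y' \<in> pol_class q y" for x' y'
    unfolding pol_class_eq_iff
    by (rule pol_eq.sym, rule pol_eq.add_cong) (use that in \<open>simp_all add: pol_class_def\<close>)
  then have "(\<Union>x'\<in>pol_class q x. \<Union>y'\<in>pol_class q y. pol_class q (x' + y')) = pol_class q (x + y)"
    by (intro UN_eq_const[OF pol_class_self])
  then show ?thesis
    by (simp add: Pol_def)
qed

lemma Pol_smult: "c \<odot>\<^bsub>Pol q\<^esub> pol_class q x = pol_class q (c *\<^sub>C x)"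
proof -
  have "pol_class q (c *\<^sub>C x') = pol_class q (c *\<^sub>C x)" if "x' \<in> pol_class q x" for x'
    unfolding pol_class_eq_iff
    by (rule pol_eq.sym, rule pol_eq.scale_cong) (use that in \<open>simp add: pol_class_def\<close>)
  then have "(\<Union>x'\<in>pol_class q x. pol_class q (c *\<^sub>C x')) = pol_class q (c *\<^sub>C x)"
    by (intro UN_eq_const[OF pol_class_self])
  then show ?thesis
    by (simp add: Pol_def)
qed

lemma Pol_invol: "invol (Pol q) (pol_class q x) = pol_class q (x\<^sup>\<star>)"
proof -
  have "pol_class q (x'\<^sup>\<star>) = pol_class q (x\<^sup>\<star>)" if "x' \<in> pol_class q x" for x'
    unfolding pol_class_eq_iff
    by (rule pol_eq.sym, rule pol_eq.star_cong) (use that in \<open>simp add: pol_class_def\<close>)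
  then have "(\<Union>x'\<in>pol_class q x. pol_class q (x'\<^sup>\<star>)) = pol_class q (x\<^sup>\<star>)"
    by (intro UN_eq_const[OF pol_class_self])
  then show ?thesis
    by (simp add: Pol_def)
qed

lemmas Pol_simps = Pol_carrier Pol_one Pol_zero Pol_mult Pol_add Pol_smult Pol_invol

lemma Pol_classE:
  assumes "X \<in> carrier (Pol q)"
  obtains x where "X = pol_class q x"
  using assms by (auto simp: Pol_carrier)

lemma ring_Pol: "ring (Pol q)"
proof -
  note simps = Pol_simps pol_class_eq_iff pol_eq.add_assoc pol_eq.add_commute pol_eq.add_zero
    pol_eq.add_inverse pol_eq.mult_assoc pol_eq.mult_one_left pol_eq.mult_one_right
    pol_eq.distrib_left pol_eq.distrib_right
  have "abelian_group (Pol q)"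
  proof (rule abelian_groupI)
    fix X assume "X \<in> carrier (Pol q)"
    then obtain x where "X = pol_class q x"
      by (rule Pol_classE)
    then show "\<exists>Y\<in>carrier (Pol q). Y \<oplus>\<^bsub>Pol q\<^esub> X = \<zero>\<^bsub>Pol q\<^esub>"
      by (intro bexI[of _ "pol_class q ((- 1) *\<^sub>C x)"]) (simp_all add: simps rangeI)
  qed ((elim Pol_classE)?, simp add: simps rangeI)+
  moreover have "Group.monoid (Pol q)"
    by (rule monoidI; (elim Pol_classE)?; simp add: simps rangeI)
  ultimately show ?thesis
    by (rule ringI; (elim Pol_classE)?; simp add: simps rangeI)
qed

definition pol_gen :: "real \<Rightarrow> gen \<Rightarrow> expr set"
  where "pol_gen q g = pol_class q (Gen g)"


section \<open>The six series of representations\<close>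

text \<open>Each predicate says that \<open>\<sigma>\<close> is the named representation. Bounded operators are determined by
  their values on the basis, and a representation is determined by its values on the generators.
  Where \<open>k - 1\<close> occurs the coefficient vanishes for \<open>k = 0\<close>, so that truncated subtraction is
  harmless. The one-dimensional representations act on the Hilbert space \<^typ>\<open>complex\<close>.\<close>

definition is_xi :: "real \<Rightarrow> real \<Rightarrow> real \<Rightarrow> (expr set \<Rightarrow> complex \<Rightarrow> complex) \<Rightarrow> bool"
  where "is_xi q \<phi>1 \<phi>2 \<sigma> \<longleftrightarrow> star_representation (Pol q) \<sigma> \<and>
    (\<forall>x. \<sigma> (pol_gen q Z11) x = (inverse (complex_of_real q) * cis \<phi>1) *\<^sub>C x) \<and>
    (\<forall>x. \<sigma> (pol_gen q Z21) x = 0) \<and>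
    (\<forall>x. \<sigma> (pol_gen q Z12) x = 0) \<and>
    (\<forall>x. \<sigma> (pol_gen q Z22) x = cis \<phi>2 *\<^sub>C x)"

definition is_pi :: "real \<Rightarrow> real \<Rightarrow> (expr set \<Rightarrow> nat ell2 \<Rightarrow> nat ell2) \<Rightarrow> bool"
  where "is_pi q \<phi> \<sigma> \<longleftrightarrow> star_representation (Pol q) \<sigma> \<and>
    (\<forall>k.
      \<sigma> (pol_gen q Z11) (ket k)
        = complex_of_real (inverse q * sqrt (1 - q ^ (2 * (k + 1)))) *\<^sub>C ket (k + 1) \<and>
      \<sigma> (pol_gen q Z22) (ket k) = cis \<phi> *\<^sub>C ket k) \<and>
    (\<forall>x. \<sigma> (pol_gen q Z21) x = 0) \<and>
    (\<forall>x. \<sigma> (pol_gen q Z12) x = 0)"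

definition is_rho_pair :: "real \<Rightarrow> real \<Rightarrow> real \<Rightarrow> (expr set \<Rightarrow> nat ell2 \<Rightarrow> nat ell2) \<Rightarrow> bool"
  where "is_rho_pair q \<phi>1 \<phi>2 \<sigma> \<longleftrightarrow> star_representation (Pol q) \<sigma> \<and>
    (\<forall>k.
      \<sigma> (pol_gen q Z11) (ket k)
        = (- cis (\<phi>1 + \<phi>2) * complex_of_real (inverse q * sqrt (1 - q ^ (2 * k)))) *\<^sub>C ket (k - 1) \<and>
      \<sigma> (pol_gen q Z21) (ket k) = (cis \<phi>1 * complex_of_real (q ^ k)) *\<^sub>C ket k \<and>
      \<sigma> (pol_gen q Z12) (ket k) = (cis \<phi>2 * complex_of_real (q ^ k)) *\<^sub>C ket k \<and>
      \<sigma> (pol_gen q Z22) (ket k) = complex_of_real (sqrt (1 - q ^ (2 * (k + 1)))) *\<^sub>C ket (k + 1))"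

definition is_rho1 :: "real \<Rightarrow> real \<Rightarrow> (expr set \<Rightarrow> (nat \<times> nat) ell2 \<Rightarrow> (nat \<times> nat) ell2) \<Rightarrow> bool"
  where "is_rho1 q \<phi> \<sigma> \<longleftrightarrow> star_representation (Pol q) \<sigma> \<and>
    (\<forall>m k.
      \<sigma> (pol_gen q Z11) (ket (m, k))
        = (- cis \<phi> * complex_of_real
            (inverse q * sqrt (1 - q ^ (2 * (m + 1))) * sqrt (1 - q ^ (2 * k)))) *\<^sub>C ket (m + 1, k - 1) \<and>
      \<sigma> (pol_gen q Z21) (ket (m, k))
        = complex_of_real (q ^ k * sqrt (1 - q ^ (2 * (m + 1)))) *\<^sub>C ket (m + 1, k) \<and>
      \<sigma> (pol_gen q Z12) (ket (m, k)) = (cis \<phi> * complex_of_real (q ^ k)) *\<^sub>C ket (m, k) \<and>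
      \<sigma> (pol_gen q Z22) (ket (m, k))
        = complex_of_real (sqrt (1 - q ^ (2 * (k + 1)))) *\<^sub>C ket (m, k + 1))"

definition is_rho2 :: "real \<Rightarrow> real \<Rightarrow> (expr set \<Rightarrow> (nat \<times> nat) ell2 \<Rightarrow> (nat \<times> nat) ell2) \<Rightarrow> bool"
  where "is_rho2 q \<phi> \<sigma> \<longleftrightarrow> star_representation (Pol q) \<sigma> \<and>
    (\<forall>m k.
      \<sigma> (pol_gen q Z11) (ket (m, k))
        = (- cis \<phi> * complex_of_real
            (inverse q * sqrt (1 - q ^ (2 * (m + 1))) * sqrt (1 - q ^ (2 * k)))) *\<^sub>C ket (m + 1, k - 1) \<and>
      \<sigma> (pol_gen q Z21) (ket (m, k)) = (cis \<phi> * complex_of_real (q ^ k)) *\<^sub>C ket (m, k) \<and>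
      \<sigma> (pol_gen q Z12) (ket (m, k))
        = complex_of_real (q ^ k * sqrt (1 - q ^ (2 * (m + 1)))) *\<^sub>C ket (m + 1, k) \<and>
      \<sigma> (pol_gen q Z22) (ket (m, k))
        = complex_of_real (sqrt (1 - q ^ (2 * (k + 1)))) *\<^sub>C ket (m, k + 1))"

definition is_rho_hat ::
    "real \<Rightarrow> real \<Rightarrow> (expr set \<Rightarrow> (nat \<times> nat \<times> nat) ell2 \<Rightarrow> (nat \<times> nat \<times> nat) ell2) \<Rightarrow> bool"
  where "is_rho_hat q \<phi> \<sigma> \<longleftrightarrow> star_representation (Pol q) \<sigma> \<and>
    (\<forall>m l k.
      \<sigma> (pol_gen q Z11) (ket (m, l, k))
        = (cis \<phi> * complex_of_real (q ^ (m + l))) *\<^sub>C ket (m, l, k)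
          - complex_of_real (inverse q * sqrt ((1 - q ^ (2 * (l + 1))) * (1 - q ^ (2 * (m + 1)))
              * (1 - q ^ (2 * k)))) *\<^sub>C ket (m + 1, l + 1, k - 1) \<and>
      \<sigma> (pol_gen q Z21) (ket (m, l, k))
        = complex_of_real (q ^ k * sqrt (1 - q ^ (2 * (m + 1)))) *\<^sub>C ket (m + 1, l, k) \<and>
      \<sigma> (pol_gen q Z12) (ket (m, l, k))
        = complex_of_real (q ^ k * sqrt (1 - q ^ (2 * (l + 1)))) *\<^sub>C ket (m, l + 1, k) \<and>
      \<sigma> (pol_gen q Z22) (ket (m, l, k))
        = complex_of_real (sqrt (1 - q ^ (2 * (k + 1)))) *\<^sub>C ket (m, l, k + 1))"

definition is_rho :: "real \<Rightarrow>
    (expr set \<Rightarrow> (nat \<times> nat \<times> nat \<times> nat) ell2 \<Rightarrow> (nat \<times> nat \<times> nat \<times> nat) ell2) \<Rightarrow> bool"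
  where "is_rho q \<sigma> \<longleftrightarrow> star_representation (Pol q) \<sigma> \<and>
    (\<forall>s m l k.
      \<sigma> (pol_gen q Z11) (ket (s, m, l, k))
        = complex_of_real (q ^ (m + l) * sqrt (1 - q ^ (2 * (s + 1)))) *\<^sub>C ket (s + 1, m, l, k)
          - complex_of_real (inverse q * sqrt ((1 - q ^ (2 * (l + 1))) * (1 - q ^ (2 * (m + 1)))
              * (1 - q ^ (2 * k)))) *\<^sub>C ket (s, m + 1, l + 1, k - 1) \<and>
      \<sigma> (pol_gen q Z21) (ket (s, m, l, k))
        = complex_of_real (q ^ k * sqrt (1 - q ^ (2 * (m + 1)))) *\<^sub>C ket (s, m + 1, l, k) \<and>
      \<sigma> (pol_gen q Z12) (ket (s, m, l, k))
        = complex_of_real (q ^ k * sqrt (1 - q ^ (2 * (l + 1)))) *\<^sub>C ket (s, m, l + 1, k) \<and>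
      \<sigma> (pol_gen q Z22) (ket (s, m, l, k))
        = complex_of_real (sqrt (1 - q ^ (2 * (k + 1)))) *\<^sub>C ket (s, m, l, k + 1))"

end

theory Submission
  imports Defs
begin

text \<open>Write \<open>A, B, C, D\<close> for the images of \<open>z\<^sub>1\<^sup>1, z\<^sub>2\<^sup>1, z\<^sub>1\<^sup>2, z\<^sub>2\<^sup>2\<close>. A bounded operator with
  \<open>T\<^sup>* T = q\<^sup>2 T T\<^sup>* + (1 - q\<^sup>2)\<close> on an invariant closed subspace either is unitary there or has a vacuum
  vector, that is, a nonzero vector killed by \<open>T\<^sup>*\<close>. On the whole space \<open>D\<close> satisfies this relation. If
  \<open>D\<close> is unitary then \<open>B = C = 0\<close>, \<open>D\<close> is central, and \<open>q A\<close> satisfies the relation. Otherwise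
  \<open>B\<close> and \<open>C\<close> satisfy it on the vacuum space \<open>K\<close> of \<open>D\<close>, and the compression \<open>F\<close> of \<open>A\<close> to \<open>K\<close> has
  \<open>F\<^sup>* F - q\<^sup>2 F F\<^sup>* = (1 - q\<^sup>2) (1 - B B\<^sup>*) (1 - C C\<^sup>*)\<close>, so that it vanishes as soon as \<open>B\<close> or \<open>C\<close>
  is unitary and satisfies the relation on the common vacuum space of \<open>B\<close> and \<open>C\<close>. Passing
  to vacuum spaces one operator at a time, each unitary that occurs commutes with the operators left and is a
  scalar by Schur's lemma; the creation operators applied to a vector of the last vacuum space give the
  orthonormal basis. The target representation is the transport of \<open>\<pi>\<close> along this basis, hence
  the six series need not be constructed independently.\<close>

section \<open>Complex Hilbert spaces\<close>

text \<open>Irreducibility cannot simply be handed down to a vacuum space: a subspace of it that is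
  invariant under the operators left is not invariant in the whole space. The predicate
  \<open>generates\<close> is the form of irreducibility that survives the passage. It speaks of
  arbitrary, not of closed, invariant subspaces \<open>G\<close>, so that spans of orbits can be fed
  back into the previous stage. It also records that every word, paired with vectors of
  \<open>K\<close>, acts as a multiple of the identity; so a vector of \<open>K\<close> orthogonal
  to \<open>G\<close> is orthogonal to everything that the words produce from \<open>G\<close>.
  Schur's lemma rests on these two facts.

  The second obstacle is \<open>A\<close>: its relation with \<open>D\<close> has the inhomogeneous
  term \<open>C B\<close>, and \<open>A'\<close> leaves the vacuum space of \<open>D\<close>. The
  compression removes both defects. On \<open>K\<close> all relations between different ones of
  \<open>B\<close>, \<open>C\<close>, \<open>F\<close> and their adjoints are pure q-commutations
  with factor 1 or \<open>Q\<close>, so the single dichotomy \<open>vacuum_or_unitary\<close> serves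
  for all three.\<close>

lemma scaleC_zero_left [simp]: "0 *\<^sub>C (x :: 'a :: chilbert_space) = 0"
  using scaleR_scaleC[of 0 x] by simp

lemma scaleC_minus1: "(- 1) *\<^sub>C (x :: 'a :: chilbert_space) = - x"
  using scaleR_scaleC[of "- 1" x] by simp

lemma scaleC_zero_right [simp]: "c *\<^sub>C (0 :: 'a :: chilbert_space) = 0"
  using scaleC_add_right[of c 0 "0 :: 'a"] by simp

lemma scaleC_minus_right: "c *\<^sub>C (- x :: 'a :: chilbert_space) = - (c *\<^sub>C x)"
  by (metis scaleC_minus1 scaleC_scaleC mult.commute)

lemma scaleC_minus_left: "(- c) *\<^sub>C (x :: 'a :: chilbert_space) = - (c *\<^sub>C x)"
  by (simp add: eq_neg_iff_add_eq_0 scaleC_add_left[symmetric])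

lemma scaleC_diff_left: "(c - d) *\<^sub>C (x :: 'a :: chilbert_space) = c *\<^sub>C x - d *\<^sub>C x"
  using scaleC_add_left[of c "- d" x] by (simp add: scaleC_minus_left)

lemma scaleC_diff_right: "c *\<^sub>C (x - y :: 'a :: chilbert_space) = c *\<^sub>C x - c *\<^sub>C y"
  using scaleC_add_right[of c x "- y"] by (simp add: scaleC_minus_right)

lemmas scaleC_one_left [simp] = scaleC_one[where 'a = "'a :: chilbert_space"]

lemma cinner_zero_left [simp]: "cinner 0 (y :: 'a :: chilbert_space) = 0"
  using cinner_scaleC_left[of 0 0 y] by simp

lemma cinner_zero_right [simp]: "cinner (y :: 'a :: chilbert_space) 0 = 0"
  using cinner_commute[of y 0] by simp

lemma cinner_add_right: "cinner (x :: 'a :: chilbert_space) (y + z) = cinner x y + cinner x z"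
  by (metis cinner_commute cinner_add_left complex_cnj_add)

lemma cinner_scaleC_right: "cinner (x :: 'a :: chilbert_space) (c *\<^sub>C y) = cnj c * cinner x y"
  by (metis cinner_commute cinner_scaleC_left complex_cnj_mult)

lemma cinner_minus_left: "cinner (- x :: 'a :: chilbert_space) y = - cinner x y"
  using cinner_scaleC_left[of "- 1" x y] by (simp add: scaleC_minus1)

lemma cinner_minus_right: "cinner (x :: 'a :: chilbert_space) (- y) = - cinner x y"
  using cinner_scaleC_right[of x "- 1" y] by (simp add: scaleC_minus1)

lemma cinner_diff_left: "cinner (x - y :: 'a :: chilbert_space) z = cinner x z - cinner y z"
  using cinner_add_left[of x "- y" z] by (simp add: cinner_minus_left)

lemma cinner_diff_right: "cinner (x :: 'a :: chilbert_space) (y - z) = cinner x y - cinner x z"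
  using cinner_add_right[of x y "- z"] by (simp add: cinner_minus_right)

lemmas cinner_simps = cinner_add_left cinner_add_right cinner_diff_left cinner_diff_right
  cinner_scaleC_left cinner_scaleC_right cinner_minus_left cinner_minus_right

lemma cinner_self: "cinner (x :: 'a :: chilbert_space) x = complex_of_real ((norm x)\<^sup>2)"
proof -
  have "Im (cinner x x) = Im (cnj (cinner x x))"
    by (rule arg_cong[OF cinner_commute])
  then have "Im (cinner x x) = 0"
    by simp
  then show ?thesis
    by (simp add: complex_eq_iff norm_eq_sqrt_cinner cinner_self_nonneg)
qed

lemma cvec_eqI:
  assumes "\<And>z. cinner x z = cinner (y :: 'a :: chilbert_space) z"
  shows "x = y"
proof -
  have "cinner (x - y) (x - y) = 0"
    by (simp add: cinner_diff_left assms)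
  then show ?thesis
    by (simp add: cinner_self)
qed

lemma norm_scaleC: "norm (c *\<^sub>C x :: 'a :: chilbert_space) = cmod c * norm x"
proof -
  have "complex_of_real ((norm (c *\<^sub>C x))\<^sup>2) = complex_of_real ((cmod c * norm x)\<^sup>2)"
    unfolding cinner_self[symmetric, of "c *\<^sub>C x"] cinner_simps power_mult_distrib of_real_mult
      complex_norm_square cinner_self[of x] by (simp only: mult_ac)
  then have "(norm (c *\<^sub>C x))\<^sup>2 = (cmod c * norm x)\<^sup>2"
    unfolding of_real_eq_iff .
  then show ?thesis
    by simp
qed

lemma cmod_cinner_le: "cmod (cinner x y) \<le> norm x * norm (y :: 'a :: chilbert_space)"
proof (cases "y = 0")
  case False
  \<comment> \<open>\<open>c *\<^sub>C y\<close> is the orthogonal projection of \<open>x\<close> to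
    the line of \<open>y\<close>; the inequality is the positivity of the squared norm of the
    remainder.\<close>
  define c where "c = cinner x y / cinner y y"
  have y: "norm y > 0"
    using False by simp
  have n: "cnj (cinner x y) = cinner y x"
    by (metis cinner_commute)
  have c: "c * cinner y y = cinner x y"
    using False by (simp add: c_def cinner_self_eq_0)
  have "cinner (x - c *\<^sub>C y) (x - c *\<^sub>C y)
      = cinner x x - cnj c * cinner x y - c * cinner y x + cnj c * (c * cinner y y)"
    by (simp add: cinner_simps algebra_simps)
  also have "\<dots> = cinner x x - cinner x y * cinner y x / cinner y y"
    unfolding c by (simp add: c_def)
  also have "\<dots> = complex_of_real ((norm x)\<^sup>2 - (cmod (cinner x y))\<^sup>2 / (norm y)\<^sup>2)"
    unfolding n[symmetric] complex_norm_square[symmetric] by (simp add: cinner_self)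
  finally have "(norm x)\<^sup>2 - (cmod (cinner x y))\<^sup>2 / (norm y)\<^sup>2 = (norm (x - c *\<^sub>C y))\<^sup>2"
    unfolding cinner_self of_real_eq_iff by simp
  then have "(cmod (cinner x y))\<^sup>2 / (norm y)\<^sup>2 \<le> (norm x)\<^sup>2"
    by (metis diff_ge_0_iff_ge zero_le_power2)
  then have "(cmod (cinner x y))\<^sup>2 \<le> (norm x * norm y)\<^sup>2"
    using y by (simp add: field_simps)
  then show ?thesis
    by (rule power2_le_imp_le) simp
qed simp

lemma bounded_linear_cinner_left: "bounded_linear (\<lambda>x. cinner x (y :: 'a :: chilbert_space))"
proof (rule bounded_linear_intro[where K = "norm y"])
  show "cinner (r *\<^sub>R x) y = r *\<^sub>R cinner x y" for r x
    unfolding scaleR_scaleC[of r x] cinner_scaleC_left by (simp add: scaleR_conv_of_real)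
qed (auto simp: cinner_add_left cmod_cinner_le)

lemma bounded_linear_cinner_right: "bounded_linear (\<lambda>x. cinner (y :: 'a :: chilbert_space) x)"
proof (rule bounded_linear_intro[where K = "norm y"])
  show "cinner y (r *\<^sub>R x) = r *\<^sub>R cinner y x" for r x
    unfolding scaleR_scaleC[of r x] cinner_scaleC_right by (simp add: scaleR_conv_of_real)
  show "norm (cinner y x) \<le> norm x * norm y" for x
    using cmod_cinner_le[of y x] by (simp add: mult.commute)
qed (auto simp: cinner_add_right)

lemma continuous_cinner_left: "continuous_on S (\<lambda>x. cinner x (y :: 'a :: chilbert_space))"
  by (rule linear_continuous_on[OF bounded_linear_cinner_left])

section \<open>Bounded complex-linear operators\<close>

lemma bounded_clinear_add: "bounded_clinear T \<Longrightarrow> T (x + y) = T x + T y"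
  and bounded_clinear_scaleC: "bounded_clinear T \<Longrightarrow> T (c *\<^sub>C x) = c *\<^sub>C T x"
  by (simp_all add: bounded_clinear_def)

lemma bounded_clinear_minus:
  assumes "bounded_clinear T"
  shows "T (- x) = - T x"
  using bounded_clinear_scaleC[OF assms, of "- 1" x] by (simp add: scaleC_minus1)

lemma bounded_clinear_diff:
  assumes "bounded_clinear T"
  shows "T (x - y) = T x - T y"
  using bounded_clinear_add[OF assms, of x "- y"] by (simp add: bounded_clinear_minus[OF assms])

lemma bounded_clinear_zero:
  assumes "bounded_clinear T"
  shows "T 0 = 0"
  using bounded_clinear_scaleC[OF assms, of 0 0] by simp

lemmas bounded_clinear_simps = bounded_clinear_add bounded_clinear_scaleC bounded_clinear_minus
  bounded_clinear_diff bounded_clinear_zero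

lemma bounded_clinear_bounded_linear:
  assumes "bounded_clinear T"
  shows "bounded_linear T"
proof -
  obtain K where "\<And>x. norm (T x) \<le> K * norm x"
    using assms unfolding bounded_clinear_def by blast
  then show ?thesis
    by (intro bounded_linear_intro[where K = K])
      (simp_all add: bounded_clinear_simps[OF assms] scaleR_scaleC mult.commute)
qed

lemma bounded_clinear_continuous: "bounded_clinear T \<Longrightarrow> continuous_on S T"
  by (simp add: bounded_clinear_bounded_linear linear_continuous_on)

lemma bounded_clinearI:
  assumes "\<And>x y. T (x + y) = T x + T y" "\<And>c x. T (c *\<^sub>C x) = c *\<^sub>C T x"
    and "\<And>x. norm (T x) \<le> K * norm x"
  shows "bounded_clinear T"
  using assms unfolding bounded_clinear_def by blast

lemma bounded_clinear_compose:
  assumes S: "bounded_clinear S" and T: "bounded_clinear T"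
  shows "bounded_clinear (\<lambda>x. S (T x))"
proof -
  have "bounded_linear (\<lambda>x. S (T x))"
    by (rule bounded_linear_compose[OF bounded_clinear_bounded_linear[OF S]
          bounded_clinear_bounded_linear[OF T]])
  then obtain K where "\<And>x. norm (S (T x)) \<le> norm x * K"
    using bounded_linear.bounded by blast
  then show ?thesis
    by (intro bounded_clinearI[where K = K])
      (simp_all add: bounded_clinear_simps[OF S] bounded_clinear_simps[OF T] mult.commute)
qed

lemma bounded_clinear_lin_comb:
  assumes S: "bounded_clinear S" and T: "bounded_clinear T"
  shows "bounded_clinear (\<lambda>x. a *\<^sub>C S x + b *\<^sub>C T x)"
proof -
  obtain K L where K: "\<And>x. norm (S x) \<le> K * norm x" and L: "\<And>x. norm (T x) \<le> L * norm x"
    using S T unfolding bounded_clinear_def by blast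
  show ?thesis
  proof (rule bounded_clinearI[where K = "cmod a * K + cmod b * L"])
    show "norm (a *\<^sub>C S x + b *\<^sub>C T x) \<le> (cmod a * K + cmod b * L) * norm x" for x
    proof -
      have "norm (a *\<^sub>C S x + b *\<^sub>C T x) \<le> cmod a * norm (S x) + cmod b * norm (T x)"
        by (metis norm_triangle_ineq norm_scaleC)
      also have "\<dots> \<le> cmod a * (K * norm x) + cmod b * (L * norm x)"
        by (intro add_mono mult_left_mono K L) auto
      finally show ?thesis
        by (simp add: algebra_simps)
    qed
  qed (simp_all add: bounded_clinear_simps[OF S] bounded_clinear_simps[OF T] scaleC_add_right
      scaleC_scaleC mult.commute add_ac)
qed

lemma bounded_clinear_ident: "bounded_clinear (\<lambda>x. x)"
  by (rule bounded_clinearI[where K = 1]) auto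

lemma bounded_clinear_scale: "bounded_clinear T \<Longrightarrow> bounded_clinear (\<lambda>x. c *\<^sub>C T x)"
  using bounded_clinear_lin_comb[of T T c 0] by simp

text \<open>The adjoint is carried as a second operator, because a representation supplies it as the
  image of the starred element.\<close>

definition adjoint_pair :: "('h :: chilbert_space \<Rightarrow> 'h) \<Rightarrow> ('h \<Rightarrow> 'h) \<Rightarrow> bool"
  where "adjoint_pair T T' \<longleftrightarrow> bounded_clinear T \<and> bounded_clinear T' \<and>
    (\<forall>x y. cinner (T x) y = cinner x (T' y))"

lemma adjoint_pair_sym: "adjoint_pair T T' \<Longrightarrow> adjoint_pair T' T"
  unfolding adjoint_pair_def by (metis cinner_commute)

lemma adjoint_pair_left: "adjoint_pair T T' \<Longrightarrow> cinner (T x) y = cinner x (T' y)"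
  and adjoint_pair_right: "adjoint_pair T T' \<Longrightarrow> cinner x (T y) = cinner (T' x) y"
  using adjoint_pair_sym[of T T'] by (simp_all add: adjoint_pair_def)

lemma adjoint_pair_compose:
  assumes "adjoint_pair S S'" "adjoint_pair T T'"
  shows "adjoint_pair (\<lambda>x. S (T x)) (\<lambda>x. T' (S' x))"
  using assms unfolding adjoint_pair_def by (simp add: bounded_clinear_compose)

lemma adjoint_pair_lin_comb:
  assumes "adjoint_pair S S'" "adjoint_pair T T'"
  shows "adjoint_pair (\<lambda>x. a *\<^sub>C S x + b *\<^sub>C T x) (\<lambda>x. cnj a *\<^sub>C S' x + cnj b *\<^sub>C T' x)"
  using assms unfolding adjoint_pair_def by (simp add: bounded_clinear_lin_comb cinner_simps)

lemma adjoint_pair_ident: "adjoint_pair (\<lambda>x. x) (\<lambda>x. x)"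
  by (simp add: adjoint_pair_def bounded_clinear_ident)

lemma adjoint_pair_bounded_clinear:
  "adjoint_pair T T' \<Longrightarrow> bounded_clinear T" "adjoint_pair T T' \<Longrightarrow> bounded_clinear T'"
  by (simp_all add: adjoint_pair_def)

text \<open>Closedness is left out on purpose: spans of orbits, to which irreducibility is applied
  later, are in general not closed.\<close>

definition csubspace :: "'h :: chilbert_space set \<Rightarrow> bool"
  where "csubspace G \<longleftrightarrow> 0 \<in> G \<and> (\<forall>x\<in>G. \<forall>y\<in>G. x + y \<in> G) \<and> (\<forall>c. \<forall>x\<in>G. c *\<^sub>C x \<in> G)"

lemma csubspaceD:
  assumes "csubspace G"
  shows "0 \<in> G" "x \<in> G \<Longrightarrow> y \<in> G \<Longrightarrow> x + y \<in> G" "x \<in> G \<Longrightarrow> c *\<^sub>C x \<in> G"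
  using assms by (auto simp: csubspace_def)

lemma csubspace_diff:
  assumes "csubspace G" "x \<in> G" "y \<in> G"
  shows "x - y \<in> G"
proof -
  have "x + (- 1) *\<^sub>C y \<in> G"
    by (intro csubspaceD assms)
  then show ?thesis
    by (simp add: scaleC_minus1)
qed

lemma closed_csubspace_iff: "closed_csubspace S \<longleftrightarrow> closed S \<and> csubspace S"
  by (simp add: closed_csubspace_def csubspace_def)

lemma csubspace_closure:
  assumes "csubspace G"
  shows "closed_csubspace (closure G)"
  unfolding closed_csubspace_def
proof (intro conjI ballI allI)
  show "0 \<in> closure G"
    using assms closure_subset csubspaceD(1) by blast
next
  fix x y assume "x \<in> closure G" "y \<in> closure G"
  then obtain f g where "\<And>n. f n \<in> G" "f \<longlonglongrightarrow> x" "\<And>n. g n \<in> G" "g \<longlonglongrightarrow> y"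
    unfolding closure_sequential by blast
  then have "\<And>n. f n + g n \<in> G" "(\<lambda>n. f n + g n) \<longlonglongrightarrow> x + y"
    by (auto intro: csubspaceD[OF assms] tendsto_add)
  then show "x + y \<in> closure G"
    unfolding closure_sequential by (intro exI[of _ "\<lambda>n. f n + g n"]) blast
next
  fix c x assume "x \<in> closure G"
  then obtain f where "\<And>n. f n \<in> G" "f \<longlonglongrightarrow> x"
    unfolding closure_sequential by blast
  moreover have "bounded_linear (\<lambda>x :: 'a. c *\<^sub>C x)"
    by (intro bounded_clinear_bounded_linear bounded_clinear_scale bounded_clinear_ident)
  ultimately have "\<And>n. c *\<^sub>C f n \<in> G" "(\<lambda>n. c *\<^sub>C f n) \<longlonglongrightarrow> c *\<^sub>C x"
    using csubspaceD(3)[OF assms] bounded_linear.tendsto by blast+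
  then show "c *\<^sub>C x \<in> closure G"
    unfolding closure_sequential by (intro exI[of _ "\<lambda>n. c *\<^sub>C f n"]) blast
qed simp

lemma closed_csubspace_Int:
  "closed_csubspace S \<Longrightarrow> closed_csubspace T \<Longrightarrow> closed_csubspace (S \<inter> T)"
  by (auto simp: closed_csubspace_def)

lemma closed_csubspace_UNIV: "closed_csubspace UNIV"
  by (simp add: closed_csubspace_def)

lemma closed_csubspace_kernel:
  assumes "bounded_clinear T"
  shows "closed_csubspace {x. T x = 0}"
  unfolding closed_csubspace_def
  by (auto simp: bounded_clinear_simps[OF assms]
      intro!: closed_Collect_eq bounded_clinear_continuous[OF assms])

lemma closed_csubspace_orthogonal: "closed_csubspace {x. cinner x (y :: 'h :: chilbert_space) = 0}"
  unfolding closed_csubspace_def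
  by (auto simp: cinner_simps intro!: closed_Collect_eq continuous_cinner_left)

lemma ex_unit_vector:
  assumes "csubspace K" "v \<in> K" "v \<noteq> 0"
  obtains u where "u \<in> K" "u \<noteq> 0" "cinner u u = 1"
proof (rule that)
  let ?u = "complex_of_real (1 / norm v) *\<^sub>C v"
  show "?u \<in> K"
    by (rule csubspaceD(3)[OF assms(1,2)])
  have n: "norm ?u = 1"
    using assms by (simp add: norm_scaleC norm_divide)
  then show "cinner ?u ?u = 1"
    unfolding cinner_self n by simp
  show "?u \<noteq> 0"
    using n by auto
qed

inductive_set cspan :: "'h :: chilbert_space set \<Rightarrow> 'h set" for S
  where
    cspan_zero: "0 \<in> cspan S"
  | cspan_base: "x \<in> S \<Longrightarrow> x \<in> cspan S"
  | cspan_add: "x \<in> cspan S \<Longrightarrow> y \<in> cspan S \<Longrightarrow> x + y \<in> cspan S"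
  | cspan_scale: "x \<in> cspan S \<Longrightarrow> c *\<^sub>C x \<in> cspan S"

lemma csubspace_cspan: "csubspace (cspan S)"
  by (auto simp: csubspace_def intro: cspan.intros)

lemma cspan_minimal:
  assumes "x \<in> cspan S" "csubspace G" "S \<subseteq> G"
  shows "x \<in> G"
  using assms(1) by induction (use assms csubspaceD[OF assms(2)] in auto)

lemma cspan_invariant:
  assumes X: "bounded_clinear X" and S: "\<And>s. s \<in> S \<Longrightarrow> X s \<in> cspan S" and x: "x \<in> cspan S"
  shows "X x \<in> cspan S"
  using x by induction (auto simp: bounded_clinear_simps[OF X] S intro: cspan.intros)

section \<open>The modulus of a self-adjoint operator\<close>

text \<open>\<open>sqrt_iter T n\<close> increases to \<open>1 - sqrt (1 - T)\<close>; \<open>sqrt_bound\<close> is the same iteration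
  at \<open>T = 1\<close> and dominates it.\<close>

fun sqrt_iter :: "('h :: chilbert_space \<Rightarrow> 'h) \<Rightarrow> nat \<Rightarrow> 'h \<Rightarrow> 'h"
  where
    "sqrt_iter T 0 v = 0"
  | "sqrt_iter T (Suc n) v = (1 / 2) *\<^sub>C T v + (1 / 2) *\<^sub>C sqrt_iter T n (sqrt_iter T n v)"

fun sqrt_bound :: "nat \<Rightarrow> real"
  where
    "sqrt_bound 0 = 0"
  | "sqrt_bound (Suc n) = (1 + (sqrt_bound n)\<^sup>2) / 2"

lemma sqrt_bound_range: "0 \<le> sqrt_bound n \<and> sqrt_bound n \<le> 1"
proof (induction n)
  case (Suc n)
  then have "(sqrt_bound n)\<^sup>2 \<le> 1"
    by (simp add: power_le_one)
  then show ?case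
    by simp
qed simp

lemma sqrt_bound_Suc_ge: "sqrt_bound n \<le> sqrt_bound (Suc n)"
  using zero_le_power2[of "1 - sqrt_bound n"] by (simp add: power2_eq_square algebra_simps)

lemma sqrt_iter_adjoint_pair:
  assumes "adjoint_pair T T"
  shows "adjoint_pair (sqrt_iter T n) (sqrt_iter T n)"
proof (induction n)
  case 0
  show ?case
    by (simp add: adjoint_pair_def) (auto intro!: bounded_clinearI[where K = 0])
next
  case (Suc n)
  have "adjoint_pair (\<lambda>v. (1 / 2) *\<^sub>C T v + (1 / 2) *\<^sub>C sqrt_iter T n (sqrt_iter T n v))
    (\<lambda>v. cnj (1 / 2) *\<^sub>C T v + cnj (1 / 2) *\<^sub>C sqrt_iter T n (sqrt_iter T n v))"
    by (rule adjoint_pair_lin_comb[OF assms adjoint_pair_compose[OF Suc Suc]])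
  then show ?case
    by simp
qed

text \<open>Each iterate is a polynomial in \<open>T\<close>. Everything is relative to
  \<open>K\<close>, because the operators to which Schur's lemma is applied commute with the others
  only on a vacuum space.\<close>

lemma sqrt_iter_commute:
  assumes X: "bounded_clinear X" and K: "csubspace K" "\<And>v. v \<in> K \<Longrightarrow> T v \<in> K" "\<And>v. v \<in> K \<Longrightarrow> X v \<in> K"
    and c: "\<And>v. v \<in> K \<Longrightarrow> T (X v) = X (T v)"
  shows "v \<in> K \<Longrightarrow> sqrt_iter T n v \<in> K \<and> sqrt_iter T n (X v) = X (sqrt_iter T n v)"
proof (induction n arbitrary: v)
  case (Suc n)
  then have "sqrt_iter T n (X v) = X (sqrt_iter T n v)" "sqrt_iter T n v \<in> K"
    by auto
  with Suc K c show ?case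
    by (simp add: bounded_clinear_simps[OF X] csubspaceD[OF K(1)])
qed (simp_all add: bounded_clinear_simps[OF X] csubspaceD[OF K(1)])

lemma sqrt_iter_commute_self:
  assumes T: "adjoint_pair T T"
  shows "sqrt_iter T m (sqrt_iter T n v) = sqrt_iter T n (sqrt_iter T m v)"
proof -
  have U: "csubspace (UNIV :: 'a set)"
    by (simp add: csubspace_def)
  have "sqrt_iter T n (T v) = T (sqrt_iter T n v)" for v
    using sqrt_iter_commute[OF adjoint_pair_bounded_clinear(1)[OF T] U] by simp
  then show ?thesis
    using sqrt_iter_commute[OF adjoint_pair_bounded_clinear(1)[OF sqrt_iter_adjoint_pair[OF T]] U, of T n]
    by simp
qed

lemma sqrt_iter_norm:
  assumes "\<And>v. norm (T v) \<le> norm v"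
  shows "norm (sqrt_iter T n v) \<le> sqrt_bound n * norm v"
proof (induction n arbitrary: v)
  case (Suc n)
  have "norm (sqrt_iter T n (sqrt_iter T n v)) \<le> sqrt_bound n * norm (sqrt_iter T n v)"
    by (rule Suc)
  also have "\<dots> \<le> sqrt_bound n * (sqrt_bound n * norm v)"
    using sqrt_bound_range by (intro mult_left_mono Suc) auto
  finally have "norm (sqrt_iter T n (sqrt_iter T n v)) \<le> (sqrt_bound n)\<^sup>2 * norm v"
    by (simp add: power2_eq_square mult.assoc)
  moreover have "norm (sqrt_iter T (Suc n) v) \<le> norm (T v) / 2 + norm (sqrt_iter T n (sqrt_iter T n v)) / 2"
    using norm_triangle_ineq[of "(1 / 2) *\<^sub>C T v" "(1 / 2) *\<^sub>C sqrt_iter T n (sqrt_iter T n v)"]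
    by (simp add: norm_scaleC norm_divide)
  ultimately show ?case
    using assms[of v] by (simp add: field_simps)
qed simp

text \<open>The iterates commute, so the difference of two consecutive squares factors as difference
  times sum. The scalar sequence obeys the same recursion, hence the bound propagates.\<close>

lemma sqrt_iter_diff_norm:
  assumes T: "adjoint_pair T T" "\<And>v. norm (T v) \<le> norm v"
  shows "norm (sqrt_iter T (Suc n) v - sqrt_iter T n v) \<le> (sqrt_bound (Suc n) - sqrt_bound n) * norm v"
proof (induction n arbitrary: v)
  case 0
  then show ?case
    using T(2)[of v] by (simp add: norm_scaleC norm_divide)
next
  case (Suc n)
  let ?Y = "sqrt_iter T" and ?y = sqrt_bound
  note lin = bounded_clinear_simps[OF adjoint_pair_bounded_clinear(1)[OF sqrt_iter_adjoint_pair[OF T(1)]]]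
  define u where "u = ?Y (Suc n) v + ?Y n v"
  have "?Y (Suc (Suc n)) v - ?Y (Suc n) v
      = (1 / 2) *\<^sub>C (?Y (Suc n) (?Y (Suc n) v) - ?Y n (?Y n v))"
    unfolding sqrt_iter.simps(2)[of T "Suc n"] sqrt_iter.simps(2)[of T n v]
    by (simp add: scaleC_diff_right)
  also have "\<dots> = (1 / 2) *\<^sub>C (?Y (Suc n) u - ?Y n u)"
    using sqrt_iter_commute_self[OF T(1), of n "Suc n" v]
    by (simp add: u_def lin del: sqrt_iter.simps)
  finally have "norm (?Y (Suc (Suc n)) v - ?Y (Suc n) v) = norm (?Y (Suc n) u - ?Y n u) / 2"
    by (simp add: norm_scaleC norm_divide del: sqrt_iter.simps)
  also have "\<dots> \<le> (?y (Suc n) - ?y n) * norm u / 2"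
    using Suc[of u] by simp
  also have "\<dots> \<le> (?y (Suc n) - ?y n) * ((?y (Suc n) + ?y n) * norm v) / 2"
  proof (intro divide_right_mono mult_left_mono)
    have "norm u \<le> norm (?Y (Suc n) v) + norm (?Y n v)"
      unfolding u_def by (rule norm_triangle_ineq)
    also have "\<dots> \<le> ?y (Suc n) * norm v + ?y n * norm v"
      by (intro add_mono sqrt_iter_norm T)
    finally show "norm u \<le> (?y (Suc n) + ?y n) * norm v"
      by (simp only: ring_distribs)
  qed (use sqrt_bound_Suc_ge[of n] in auto)
  also have "\<dots> = (?y (Suc (Suc n)) - ?y (Suc n)) * norm v"
    unfolding sqrt_bound.simps(2)[of "Suc n"] sqrt_bound.simps(2)[of n]
    by (simp add: power2_eq_square field_simps)
  finally show ?case .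
qed

lemma sqrt_iter_cauchy_bound:
  assumes T: "adjoint_pair T T" "\<And>v. norm (T v) \<le> norm v" and "n \<le> m"
  shows "norm (sqrt_iter T m v - sqrt_iter T n v) \<le> (sqrt_bound m - sqrt_bound n) * norm v"
  using assms(3)
proof (induction m rule: dec_induct)
  case (step m)
  have "norm (sqrt_iter T (Suc m) v - sqrt_iter T n v)
      \<le> norm (sqrt_iter T (Suc m) v - sqrt_iter T m v) + norm (sqrt_iter T m v - sqrt_iter T n v)"
    using norm_triangle_ineq[of "sqrt_iter T (Suc m) v - sqrt_iter T m v"
        "sqrt_iter T m v - sqrt_iter T n v"] by (simp del: sqrt_iter.simps)
  also have "\<dots> \<le> (sqrt_bound (Suc m) - sqrt_bound m) * norm v + (sqrt_bound m - sqrt_bound n) * norm v"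
    by (intro add_mono sqrt_iter_diff_norm T step.IH)
  finally show ?case
    by (simp add: algebra_simps del: sqrt_iter.simps sqrt_bound.simps)
qed simp

text \<open>The dominating scalar sequence increases and is bounded by 1, so its increments control
  those of the iterates and make them Cauchy.\<close>

lemma sqrt_iter_convergent:
  assumes T: "adjoint_pair T T" "\<And>v. norm (T v) \<le> norm v"
  shows "convergent (\<lambda>n. sqrt_iter T n v)"
proof -
  have "incseq sqrt_bound"
    by (intro incseq_SucI sqrt_bound_Suc_ge)
  then obtain L where "sqrt_bound \<longlonglongrightarrow> L"
    using incseq_convergent[of sqrt_bound 1] sqrt_bound_range by blast
  then have "convergent sqrt_bound"
    by (rule convergentI)
  then have C: "Cauchy sqrt_bound"
    by (simp add: Cauchy_convergent_iff)
  have "Cauchy (\<lambda>n. sqrt_iter T n v)"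
  proof (rule CauchyI')
    fix e :: real assume e: "e > 0"
    obtain N where N: "\<And>m n. m \<ge> N \<Longrightarrow> n \<ge> N \<Longrightarrow> norm (sqrt_bound m - sqrt_bound n) < e / (norm v + 1)"
      using CauchyD[OF C, of "e / (norm v + 1)"] e by (auto simp: add_nonneg_pos)
    have "dist (sqrt_iter T m v) (sqrt_iter T n v) < e" if "m \<ge> N" "n > m" for m n
    proof -
      have "dist (sqrt_iter T m v) (sqrt_iter T n v) \<le> (sqrt_bound n - sqrt_bound m) * norm v"
        using sqrt_iter_cauchy_bound[OF T, of m n v] that by (simp add: dist_norm norm_minus_commute)
      also have "\<dots> \<le> e / (norm v + 1) * norm v"
        using N[of n m] that by (intro mult_right_mono) auto
      also have "\<dots> < e"
        using e by (simp add: pos_divide_less_eq add_nonneg_pos)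
      finally show ?thesis .
    qed
    then show "\<exists>M. \<forall>m\<ge>M. \<forall>n>m. dist (sqrt_iter T m v) (sqrt_iter T n v) < e"
      by blast
  qed
  then show ?thesis
    by (simp add: Cauchy_convergent_iff)
qed

text \<open>This is the contraction bound that the iteration requires of its input
  \<open>1 - S S\<close>.\<close>

lemma self_adjoint_norm_square_le:
  assumes S: "adjoint_pair S S" "\<And>v. norm (S v) \<le> norm v"
  shows "norm (v - S (S v)) \<le> norm v"
proof -
  have "complex_of_real ((norm (v - S (S v)))\<^sup>2)
      = complex_of_real ((norm v)\<^sup>2 - 2 * (norm (S v))\<^sup>2 + (norm (S (S v)))\<^sup>2)"
    unfolding cinner_self[symmetric] of_real_add of_real_diff of_real_mult
    by (simp add: cinner_simps adjoint_pair_right[OF S(1)]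
        bounded_clinear_simps[OF adjoint_pair_bounded_clinear(1)[OF S(1)]])
  then have "(norm (v - S (S v)))\<^sup>2 = (norm v)\<^sup>2 - 2 * (norm (S v))\<^sup>2 + (norm (S (S v)))\<^sup>2"
    unfolding of_real_eq_iff .
  also have "\<dots> \<le> (norm v)\<^sup>2"
  proof -
    have "(norm (S (S v)))\<^sup>2 \<le> (norm (S v))\<^sup>2"
      by (intro power_mono S) simp
    then show ?thesis
      using zero_le_power2[of "norm (S v)"] by linarith
  qed
  finally show ?thesis
    by (rule power2_le_imp_le) simp
qed

text \<open>\<open>R\<close> is \<open>1 - Y\<close> for the limit \<open>Y\<close> of the iteration
  at \<open>1 - S S\<close>. It is positive because \<open>Y\<close> is a contraction. Being a
  pointwise limit of polynomials in \<open>S\<close>, it inherits closed invariant subspaces and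
  commutation relations from \<open>S\<close>, which is the last clause.\<close>

lemma operator_abs:
  assumes S: "adjoint_pair S S" "\<And>v. norm (S v) \<le> norm v"
  obtains R where "adjoint_pair R R" "\<And>v. R (R v) = S (S v)" "\<And>v. 0 \<le> Re (cinner (R v) v)"
    and "\<And>X K v. \<lbrakk>bounded_clinear X; closed_csubspace K; \<And>v. v \<in> K \<Longrightarrow> S v \<in> K; \<And>v. v \<in> K \<Longrightarrow> X v \<in> K;
      \<And>v. v \<in> K \<Longrightarrow> S (X v) = X (S v); v \<in> K\<rbrakk> \<Longrightarrow> R v \<in> K \<and> R (X v) = X (R v)"
proof -
  define T where "T = (\<lambda>v. v - S (S v))"
  have "adjoint_pair (\<lambda>v. 1 *\<^sub>C v + (- 1) *\<^sub>C S (S v)) (\<lambda>v. cnj 1 *\<^sub>C v + cnj (- 1) *\<^sub>C S (S v))"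
    by (rule adjoint_pair_lin_comb[OF adjoint_pair_ident adjoint_pair_compose[OF S(1) S(1)]])
  then have T: "adjoint_pair T T"
    by (simp add: T_def scaleC_minus1)
  have Tn: "norm (T v) \<le> norm v" for v
    unfolding T_def by (rule self_adjoint_norm_square_le[OF S])
  define Y where "Y = (\<lambda>v. lim (\<lambda>n. sqrt_iter T n v))"
  have Y: "(\<lambda>n. sqrt_iter T n v) \<longlonglongrightarrow> Y v" for v
    using sqrt_iter_convergent[OF T Tn] by (simp add: Y_def convergent_LIMSEQ_iff)
  note adj = sqrt_iter_adjoint_pair[OF T]
  note lin = bounded_clinear_simps[OF adjoint_pair_bounded_clinear(1)[OF adj]]
  have n1: "norm (sqrt_iter T n v) \<le> norm v" for n v
    using sqrt_iter_norm[OF Tn, of n v] mult_right_mono[of "sqrt_bound n" 1 "norm v"] sqrt_bound_range[of n]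
    by simp
  have Yn: "norm (Y v) \<le> norm v" for v
    by (rule LIMSEQ_le_const2[OF tendsto_norm[OF Y]]) (use n1 in auto)
  have scale_tendsto: "f \<longlonglongrightarrow> (l :: 'a) \<Longrightarrow> (\<lambda>n. c *\<^sub>C f n) \<longlonglongrightarrow> c *\<^sub>C l" for c f l
    using bounded_linear.tendsto[OF bounded_clinear_bounded_linear[OF bounded_clinear_scale[OF bounded_clinear_ident]]] .
  have Yadd: "Y (u + v) = Y u + Y v" for u v
    by (rule LIMSEQ_unique[OF Y]) (simp add: lin tendsto_add Y)
  have Yscale: "Y (c *\<^sub>C v) = c *\<^sub>C Y v" for c v
    by (rule LIMSEQ_unique[OF Y]) (simp add: lin scale_tendsto Y)
  have Yb: "bounded_clinear Y"
    by (rule bounded_clinearI[where K = 1]) (simp_all add: Yadd Yscale Yn)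
  have Yadj: "cinner (Y u) v = cinner u (Y v)" for u v
  proof (rule LIMSEQ_unique)
    show "(\<lambda>n. cinner (sqrt_iter T n u) v) \<longlonglongrightarrow> cinner (Y u) v"
      by (rule bounded_linear.tendsto[OF bounded_linear_cinner_left Y])
    show "(\<lambda>n. cinner (sqrt_iter T n u) v) \<longlonglongrightarrow> cinner u (Y v)"
      unfolding adjoint_pair_left[OF adj]
      by (rule bounded_linear.tendsto[OF bounded_linear_cinner_right Y])
  qed
  \<comment> \<open>Both factors vary with \<open>n\<close>; the uniform bound \<open>n1\<close>
    makes the \<open>n\<close>-th iterate of the vanishing difference vanish as well.\<close>
  have YY: "(\<lambda>n. sqrt_iter T n (sqrt_iter T n v)) \<longlonglongrightarrow> Y (Y v)" for v
  proof -
    have "(\<lambda>n. norm (sqrt_iter T n v - Y v)) \<longlonglongrightarrow> 0"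
      using Y[of v] LIM_zero tendsto_norm_zero by blast
    then have "(\<lambda>n. sqrt_iter T n (sqrt_iter T n v - Y v)) \<longlonglongrightarrow> 0"
      by (rule Lim_null_comparison[rotated]) (simp add: n1)
    then have "(\<lambda>n. sqrt_iter T n (sqrt_iter T n v - Y v) + sqrt_iter T n (Y v)) \<longlonglongrightarrow> 0 + Y (Y v)"
      by (intro tendsto_add Y)
    then show ?thesis
      by (simp add: lin)
  qed
  have Yfix: "Y v = (1 / 2) *\<^sub>C T v + (1 / 2) *\<^sub>C Y (Y v)" for v
  proof (rule LIMSEQ_unique)
    show "(\<lambda>n. sqrt_iter T (Suc n) v) \<longlonglongrightarrow> Y v"
      using Y by (rule LIMSEQ_Suc)
    show "(\<lambda>n. sqrt_iter T (Suc n) v) \<longlonglongrightarrow> (1 / 2) *\<^sub>C T v + (1 / 2) *\<^sub>C Y (Y v)"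
      unfolding sqrt_iter.simps by (intro tendsto_add scale_tendsto YY tendsto_const)
  qed
  define R where "R = (\<lambda>v. v - Y v)"
  \<comment> \<open>The fixed point equation says \<open>2 Y = T + Y Y\<close>, so the square of
    \<open>1 - Y\<close> is \<open>1 - T\<close>.\<close>
  have RR: "R (R v) = S (S v)" for v
  proof -
    have "Y v + Y v = T v + Y (Y v)"
    proof -
      have "2 *\<^sub>C Y v = T v + Y (Y v)"
        by (subst Yfix) (simp add: scaleC_add_right scaleC_scaleC)
      then show ?thesis
        using scaleC_add_left[of 1 1 "Y v"] by simp
    qed
    then show ?thesis
      by (simp add: R_def T_def bounded_clinear_simps[OF Yb] algebra_simps)
  qed
  show ?thesis
  proof (rule that[of R])
    have "adjoint_pair (\<lambda>v. 1 *\<^sub>C v + (- 1) *\<^sub>C Y v) (\<lambda>v. cnj 1 *\<^sub>C v + cnj (- 1) *\<^sub>C Y v)"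
      by (rule adjoint_pair_lin_comb[OF adjoint_pair_ident]) (simp add: adjoint_pair_def Yb Yadj)
    then show "adjoint_pair R R"
      by (simp add: R_def scaleC_minus1)
    show "R (R v) = S (S v)" for v
      by (rule RR)
    show "0 \<le> Re (cinner (R v) v)" for v
    proof -
      have "Re (cinner (Y v) v) \<le> norm (Y v) * norm v"
        using cmod_cinner_le[of "Y v" v] complex_Re_le_cmod order_trans by blast
      also have "\<dots> \<le> norm v * norm v"
        by (intro mult_right_mono Yn) simp
      finally show ?thesis
        by (simp add: R_def cinner_simps cinner_self power2_eq_square)
    qed
  next
    fix X :: "'a \<Rightarrow> 'a" and K v
    assume X: "bounded_clinear X" and K: "closed_csubspace K" and SK: "\<And>v. v \<in> K \<Longrightarrow> S v \<in> K"
      and XK: "\<And>v. v \<in> K \<Longrightarrow> X v \<in> K" and SX: "\<And>v. v \<in> K \<Longrightarrow> S (X v) = X (S v)" and v: "v \<in> K"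
    have K': "csubspace K" "closed K"
      using K by (simp_all add: closed_csubspace_iff)
    have TK: "T v \<in> K" "T (X v) = X (T v)" if "v \<in> K" for v
      using that by (simp_all add: T_def csubspace_diff[OF K'(1)] SK SX bounded_clinear_simps[OF X])
    note c = sqrt_iter_commute[where T = T and X = X and K = K and v = v, OF X K'(1) TK(1) XK TK(2) v]
    have "Y v \<in> K"
      using closed_sequentially[OF K'(2) _ Y[of v]] c by blast
    moreover have "Y (X v) = X (Y v)"
    proof (rule LIMSEQ_unique[OF Y])
      show "(\<lambda>n. sqrt_iter T n (X v)) \<longlonglongrightarrow> X (Y v)"
        using bounded_linear.tendsto[OF bounded_clinear_bounded_linear[OF X] Y[of v]]
        by (simp add: c)
    qed
    ultimately show "R v \<in> K \<and> R (X v) = X (R v)"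
      using v by (simp add: R_def csubspace_diff[OF K'(1)] bounded_clinear_simps[OF X])
  qed
qed

section \<open>Cyclic subspaces and Schur's lemma\<close>

text \<open>\<open>K\<close> plays the role of a space of vacuum vectors, \<open>\<B>\<close> is the family of operators that still
  act on it, and \<open>\<Phi>\<close> consists of the words in the creation operators that lead out of it.\<close>

definition generates :: "('h :: chilbert_space \<Rightarrow> 'h) set \<Rightarrow> ('h \<Rightarrow> 'h) set \<Rightarrow> 'h set \<Rightarrow> bool"
  where "generates \<Phi> \<B> K \<longleftrightarrow> closed_csubspace K \<and>
    (\<forall>\<phi>\<in>\<Phi>. bounded_clinear \<phi> \<and> (\<exists>c. \<forall>u\<in>K. \<forall>w\<in>K. cinner (\<phi> u) w = c * cinner u w)) \<and>
    (\<forall>X\<in>\<B>. bounded_clinear X \<and> (\<forall>v\<in>K. X v \<in> K)) \<and>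
    (\<forall>G Z. csubspace G \<and> G \<subseteq> K \<and> G \<noteq> {0} \<and> (\<forall>X\<in>\<B>. \<forall>g\<in>G. X g \<in> G) \<and>
      closed_csubspace Z \<and> (\<forall>\<phi>\<in>\<Phi>. \<forall>g\<in>G. \<phi> g \<in> Z) \<longrightarrow> Z = UNIV)"

lemma generates_closed: "generates \<Phi> \<B> K \<Longrightarrow> closed_csubspace K"
  and generates_csubspace: "generates \<Phi> \<B> K \<Longrightarrow> csubspace K"
  and generates_word: "generates \<Phi> \<B> K \<Longrightarrow> \<phi> \<in> \<Phi> \<Longrightarrow> bounded_clinear \<phi>"
  and generates_op: "generates \<Phi> \<B> K \<Longrightarrow> X \<in> \<B> \<Longrightarrow> bounded_clinear X"
  and generates_invariant: "generates \<Phi> \<B> K \<Longrightarrow> X \<in> \<B> \<Longrightarrow> v \<in> K \<Longrightarrow> X v \<in> K"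
  by (auto simp: generates_def closed_csubspace_iff)

lemma generates_UNIV:
  assumes "generates \<Phi> \<B> K" "csubspace G" "G \<subseteq> K" "G \<noteq> {0}"
    and "\<And>X g. X \<in> \<B> \<Longrightarrow> g \<in> G \<Longrightarrow> X g \<in> G" and "closed_csubspace Z"
    and "\<And>\<phi> g. \<phi> \<in> \<Phi> \<Longrightarrow> g \<in> G \<Longrightarrow> \<phi> g \<in> Z"
  shows "Z = UNIV"
proof -
  have "csubspace G \<and> G \<subseteq> K \<and> G \<noteq> {0} \<and> (\<forall>X\<in>\<B>. \<forall>g\<in>G. X g \<in> G) \<and>
      closed_csubspace Z \<and> (\<forall>\<phi>\<in>\<Phi>. \<forall>g\<in>G. \<phi> g \<in> Z)"
    using assms(2-) by blast
  then show ?thesis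
    using assms(1) unfolding generates_def by blast
qed

text \<open>Serves to discard operators that have turned out to be scalars or zero, and to rescale
  the others: the subspaces stable under the new family must be stable under the old one.\<close>

lemma generates_change_family:
  assumes gen: "generates \<Phi> \<A> K"
    and \<B>: "\<And>X. X \<in> \<B> \<Longrightarrow> bounded_clinear X" "\<And>X v. X \<in> \<B> \<Longrightarrow> v \<in> K \<Longrightarrow> X v \<in> K"
    and inv: "\<And>G X g. \<lbrakk>csubspace G; G \<subseteq> K; \<And>X g. X \<in> \<B> \<Longrightarrow> g \<in> G \<Longrightarrow> X g \<in> G; X \<in> \<A>; g \<in> G\<rbrakk> \<Longrightarrow> X g \<in> G"
  shows "generates \<Phi> \<B> K"
  unfolding generates_def
proof (intro conjI)
  show "closed_csubspace K"
    by (rule generates_closed[OF gen])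
  show "\<forall>\<phi>\<in>\<Phi>. bounded_clinear \<phi> \<and> (\<exists>c. \<forall>u\<in>K. \<forall>w\<in>K. cinner (\<phi> u) w = c * cinner u w)"
    using gen unfolding generates_def by (elim conjE)
  show "\<forall>X\<in>\<B>. bounded_clinear X \<and> (\<forall>v\<in>K. X v \<in> K)"
    using \<B> by blast
  show "\<forall>G Z. csubspace G \<and> G \<subseteq> K \<and> G \<noteq> {0} \<and> (\<forall>X\<in>\<B>. \<forall>g\<in>G. X g \<in> G) \<and>
      closed_csubspace Z \<and> (\<forall>\<phi>\<in>\<Phi>. \<forall>g\<in>G. \<phi> g \<in> Z) \<longrightarrow> Z = UNIV"
  proof (intro allI impI, elim conjE)
    fix G Z
    assume a: "csubspace G" "G \<subseteq> K" "G \<noteq> {0}" "\<forall>X\<in>\<B>. \<forall>g\<in>G. X g \<in> G" "closed_csubspace Z"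
      "\<forall>\<phi>\<in>\<Phi>. \<forall>g\<in>G. \<phi> g \<in> Z"
    show "Z = UNIV"
    proof (rule generates_UNIV[OF gen a(1,2,3) _ a(5)])
      show "X g \<in> G" if X: "X \<in> \<A>" and g: "g \<in> G" for X g
        by (rule inv[OF a(1,2) _ X g]) (use a(4) in blast)
    qed (use a(6) in blast)
  qed
qed

text \<open>A common eigenvector spans an invariant line, which can play the role of
  \<open>G\<close>. This turns the words applied to one vacuum vector into a total family.\<close>

lemma generates_total:
  assumes gen: "generates \<Phi> \<B> K" and v: "v \<in> K" "v \<noteq> 0" and eig: "\<And>X. X \<in> \<B> \<Longrightarrow> \<exists>c. X v = c *\<^sub>C v"
    and Z: "closed_csubspace Z" "\<And>\<phi>. \<phi> \<in> \<Phi> \<Longrightarrow> \<phi> v \<in> Z"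
  shows "Z = UNIV"
proof (rule generates_UNIV[OF gen _ _ _ _ Z(1)])
  show "csubspace (range (\<lambda>c. c *\<^sub>C v))"
    unfolding csubspace_def
    by (auto simp: scaleC_add_left[symmetric] scaleC_scaleC intro: range_eqI[of _ _ 0])
  show "range (\<lambda>c. c *\<^sub>C v) \<subseteq> K"
    using csubspaceD(3)[OF generates_csubspace[OF gen] v(1)] by blast
  show "range (\<lambda>c. c *\<^sub>C v) \<noteq> {0}"
    using v(2) scaleC_one_left[of v] by (metis rangeI singletonD)
  show "X g \<in> range (\<lambda>c. c *\<^sub>C v)" if X: "X \<in> \<B>" and g: "g \<in> range (\<lambda>c. c *\<^sub>C v)" for X g
  proof -
    obtain c d where "X v = c *\<^sub>C v" "g = d *\<^sub>C v"
      using eig[OF X] g by blast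
    then show ?thesis
      using bounded_clinear_scaleC[OF generates_op[OF gen X]] by (simp add: scaleC_scaleC)
  qed
  show "\<phi> g \<in> Z" if "\<phi> \<in> \<Phi>" "g \<in> range (\<lambda>c. c *\<^sub>C v)" for \<phi> g
    using that Z by (auto simp: bounded_clinear_scaleC[OF generates_word[OF gen that(1)]] closed_csubspace_def)
qed

text \<open>The kernel \<open>G\<close> of \<open>S\<close> in \<open>K\<close> is invariant, and
  the range of \<open>S\<close> on \<open>K\<close> is orthogonal to it. Words applied to
  \<open>G\<close> stay orthogonal to that range, because their pairing with \<open>K\<close> is a
  multiple of the original one. If \<open>G\<close> is not zero, these words are total, so the range
  is zero.\<close>

lemma self_adjoint_injective_or_zero:
  assumes gen: "generates \<Phi> \<B> K" and S: "adjoint_pair S S" "\<And>v. v \<in> K \<Longrightarrow> S v \<in> K"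
    and comm: "\<And>X v. X \<in> \<B> \<Longrightarrow> v \<in> K \<Longrightarrow> S (X v) = X (S v)"
  shows "(\<forall>v\<in>K. S v = 0) \<or> (\<forall>v\<in>K. S v = 0 \<longrightarrow> v = 0)"
proof (rule disjCI)
  assume "\<not> (\<forall>v\<in>K. S v = 0 \<longrightarrow> v = 0)"
  then obtain v where v: "v \<in> K" "S v = 0" "v \<noteq> 0"
    by blast
  note lin = bounded_clinear_simps[OF adjoint_pair_bounded_clinear(1)[OF S(1)]]
  define G where "G = {v \<in> K. S v = 0}"
  have G: "csubspace G"
    using csubspaceD[OF generates_csubspace[OF gen]] by (auto simp: csubspace_def G_def lin)
  show "\<forall>v\<in>K. S v = 0"
  proof
    fix w assume w: "w \<in> K"
    have "{x. cinner x (S w) = 0} = UNIV"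
    proof (rule generates_UNIV[OF gen G _ _ _ closed_csubspace_orthogonal])
      show "G \<subseteq> K" "G \<noteq> {0}"
        using v by (auto simp: G_def)
      show "X g \<in> G" if "X \<in> \<B>" "g \<in> G" for X g
        using that generates_invariant[OF gen] by (auto simp: G_def comm
            bounded_clinear_zero[OF generates_op[OF gen]])
      show "\<phi> g \<in> {x. cinner x (S w) = 0}" if \<phi>: "\<phi> \<in> \<Phi>" and g: "g \<in> G" for \<phi> g
      proof -
        obtain c where "\<And>u w. u \<in> K \<Longrightarrow> w \<in> K \<Longrightarrow> cinner (\<phi> u) w = c * cinner u w"
          using gen \<phi> unfolding generates_def by meson
        then have "cinner (\<phi> g) (S w) = c * cinner g (S w)"
          using g w S(2) by (simp add: G_def)
        also have "cinner g (S w) = 0"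
          using g by (simp add: adjoint_pair_left[OF S(1), symmetric] G_def)
        finally show ?thesis
          by simp
      qed
    qed
    then have "cinner (S w) (S w) = 0"
      by blast
    then show "S w = 0"
      by (simp add: cinner_self_eq_0)
  qed
qed

text \<open>\<open>(R - S) (R + S) = 0\<close> for the modulus \<open>R\<close> of \<open>S\<close>, so that \<open>S = R\<close> or \<open>S = - R\<close> on \<open>K\<close>.\<close>

lemma self_adjoint_definite:
  assumes gen: "generates \<Phi> \<B> K" and S: "adjoint_pair S S" "\<And>v. v \<in> K \<Longrightarrow> S v \<in> K"
    and comm: "\<And>X v. X \<in> \<B> \<Longrightarrow> v \<in> K \<Longrightarrow> S (X v) = X (S v)"
  shows "(\<forall>v\<in>K. 0 \<le> Re (cinner (S v) v)) \<or> (\<forall>v\<in>K. Re (cinner (S v) v) \<le> 0)"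
proof -
  obtain M where M: "\<And>v. norm (S v) \<le> M * norm v"
    using adjoint_pair_bounded_clinear(1)[OF S(1)] unfolding bounded_clinear_def by blast
  \<comment> \<open>The modulus is constructed for contractions only; the summand 1 keeps the
    divisor positive whatever the bound \<open>M\<close> is.\<close>
  define N where "N = \<bar>M\<bar> + 1"
  have N: "N > 0"
    by (simp add: N_def)
  define S1 where "S1 = (\<lambda>v. complex_of_real (1 / N) *\<^sub>C S v)"
  have S1: "adjoint_pair S1 S1"
    using adjoint_pair_lin_comb[OF S(1) S(1), of "complex_of_real (1 / N)" 0] by (simp add: S1_def)
  have S1n: "norm (S1 v) \<le> norm v" for v
  proof -
    have "norm (S v) \<le> N * norm v"
      using M[of v] mult_right_mono[of M N "norm v"] abs_ge_self[of M] by (simp add: N_def)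
    then show ?thesis
      using N by (simp add: S1_def norm_scaleC norm_divide field_simps)
  qed
  have K: "closed_csubspace K" "csubspace K"
    using gen by (simp_all add: generates_closed generates_csubspace)
  have S1K: "S1 v \<in> K" if "v \<in> K" for v
    using that S(2) by (simp add: S1_def csubspaceD[OF K(2)])
  have S1c: "S1 (X v) = X (S1 v)" if "X \<in> \<B>" "v \<in> K" for X v
    using that comm by (simp add: S1_def bounded_clinear_scaleC[OF generates_op[OF gen]])
  obtain R where R: "adjoint_pair R R" "\<And>v. R (R v) = S1 (S1 v)" "\<And>v. 0 \<le> Re (cinner (R v) v)"
    and Rc: "\<And>X K v. \<lbrakk>bounded_clinear X; closed_csubspace K; \<And>v. v \<in> K \<Longrightarrow> S1 v \<in> K; \<And>v. v \<in> K \<Longrightarrow> X v \<in> K;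
      \<And>v. v \<in> K \<Longrightarrow> S1 (X v) = X (S1 v); v \<in> K\<rbrakk> \<Longrightarrow> R v \<in> K \<and> R (X v) = X (R v)"
    using operator_abs[OF S1 S1n] by blast
  have RX: "R (X v) = X (R v)" if "X \<in> \<B>" "v \<in> K" for X v
    using Rc[OF generates_op[OF gen that(1)] K(1) S1K generates_invariant[OF gen that(1)] S1c[OF that(1)] that(2)]
    by simp
  have RK: "R v \<in> K" and RS: "R (S1 v) = S1 (R v)" if "v \<in> K" for v
    using Rc[OF adjoint_pair_bounded_clinear(1)[OF S1] K(1) S1K S1K _ that] by simp_all
  note linR = bounded_clinear_simps[OF adjoint_pair_bounded_clinear(1)[OF R(1)]]
  note linS1 = bounded_clinear_simps[OF adjoint_pair_bounded_clinear(1)[OF S1]]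
  define P where "P = (\<lambda>v. R v - S1 v)"
  have P: "adjoint_pair P P"
    using adjoint_pair_lin_comb[OF R(1) S1, of 1 "- 1"] by (simp add: P_def scaleC_minus1)
  have dich: "(\<forall>v\<in>K. P v = 0) \<or> (\<forall>v\<in>K. P v = 0 \<longrightarrow> v = 0)"
    by (rule self_adjoint_injective_or_zero[OF gen P])
      (simp_all add: P_def RK S1K csubspace_diff[OF K(2)] RX S1c bounded_clinear_simps[OF generates_op[OF gen]])
  have sgn: "Re (cinner (S v) v) = N * Re (cinner (S1 v) v)" for v
    using N by (simp add: S1_def cinner_simps)
  from dich show ?thesis
  proof
    assume 0: "\<forall>v\<in>K. P v = 0"
    have "0 \<le> Re (cinner (S v) v)" if "v \<in> K" for v
    proof -
      have "S1 v = R v"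
        using 0 that by (simp add: P_def)
      then show ?thesis
        using sgn[of v] R(3)[of v] N by simp
    qed
    then show ?thesis
      by blast
  next
    assume inj: "\<forall>v\<in>K. P v = 0 \<longrightarrow> v = 0"
    have "Re (cinner (S v) v) \<le> 0" if v: "v \<in> K" for v
    proof -
      have "P (R v + S1 v) = 0"
        using RS[OF v] R(2)[of v] by (simp add: P_def linR linS1)
      then have "R v + S1 v = 0"
        using inj RK[OF v] S1K[OF v] csubspaceD(2)[OF K(2)] by blast
      then have "S1 v = - R v"
        by (simp add: eq_neg_iff_add_eq_0 add.commute)
      then show ?thesis
        using sgn[of v] R(3)[of v] N by (simp add: cinner_simps)
    qed
    then show ?thesis
      by blast
  qed
qed

text \<open>Evaluating the form at \<open>v + S v\<close> leaves twice the squared norm of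
  \<open>S v\<close>, because the terms at \<open>v\<close> and at \<open>S v\<close>
  vanish.\<close>

lemma quadratic_form_zero:
  assumes S: "adjoint_pair S S" and K: "csubspace K" "\<And>v. v \<in> K \<Longrightarrow> S v \<in> K"
    and z: "\<And>v. v \<in> K \<Longrightarrow> Re (cinner (S v) v) = 0" and v: "v \<in> K"
  shows "S v = 0"
proof -
  note lin = bounded_clinear_simps[OF adjoint_pair_bounded_clinear(1)[OF S]]
  have "Re (cinner (S (v + S v)) (v + S v)) = 0"
    using v by (intro z csubspaceD K)
  moreover have "Re (cinner (S (S v)) v) = Re (cinner (S v) (S v))"
    by (simp add: adjoint_pair_left[OF S])
  ultimately have "Re (cinner (S v) (S v)) = 0"
    using z[OF v] z[OF K(2)[OF v]] by (simp add: lin cinner_simps)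
  then show ?thesis
    by (simp add: cinner_self)
qed

text \<open>Definiteness of \<open>S - c\<close> places every real \<open>c\<close> entirely below
  or entirely above the quotients \<open>f v / (norm v)\<^sup>2\<close>. The supremum
  \<open>s\<close> of the lower bounds is then also an upper bound, so the form of
  \<open>S - s\<close> is zero.\<close>

lemma schur_self_adjoint:
  assumes gen: "generates \<Phi> \<B> K" and S: "adjoint_pair S S" "\<And>v. v \<in> K \<Longrightarrow> S v \<in> K"
    and comm: "\<And>X v. X \<in> \<B> \<Longrightarrow> v \<in> K \<Longrightarrow> S (X v) = X (S v)"
  shows "\<exists>c. \<forall>v\<in>K. S v = complex_of_real c *\<^sub>C v"
proof (cases "K = {0}")
  case True
  then show ?thesis
    by (simp add: bounded_clinear_zero[OF adjoint_pair_bounded_clinear(1)[OF S(1)]])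
next
  case False
  have K: "csubspace K"
    by (rule generates_csubspace[OF gen])
  obtain u where u: "u \<in> K" "u \<noteq> 0"
    using False csubspaceD(1)[OF K] by blast
  define f where "f = (\<lambda>v. Re (cinner (S v) v))"
  define T where "T = (\<lambda>c v. S v - complex_of_real c *\<^sub>C v)"
  have T: "adjoint_pair (T c) (T c)" for c
    using adjoint_pair_lin_comb[OF S(1) adjoint_pair_ident, of 1 "- complex_of_real c"]
    by (simp add: T_def scaleC_minus_left)
  have TK: "T c v \<in> K" if "v \<in> K" for c v
    using that S(2) by (simp add: T_def csubspace_diff[OF K] csubspaceD[OF K])
  have Tf: "Re (cinner (T c v) v) = f v - c * (norm v)\<^sup>2" for c v
    by (simp add: T_def f_def cinner_simps cinner_self)
  have dich: "(\<forall>v\<in>K. c * (norm v)\<^sup>2 \<le> f v) \<or> (\<forall>v\<in>K. f v \<le> c * (norm v)\<^sup>2)" for c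
    using self_adjoint_definite[OF gen T[of c] TK] unfolding Tf
    by (simp add: T_def comm bounded_clinear_simps[OF generates_op[OF gen]])
  obtain M where M: "\<And>v. norm (S v) \<le> M * norm v"
    using adjoint_pair_bounded_clinear(1)[OF S(1)] unfolding bounded_clinear_def by blast
  have fM: "\<bar>f v\<bar> \<le> M * (norm v)\<^sup>2" for v
  proof -
    have "\<bar>f v\<bar> \<le> norm (S v) * norm v"
      unfolding f_def using cmod_cinner_le[of "S v" v] abs_Re_le_cmod order_trans by blast
    also have "\<dots> \<le> M * norm v * norm v"
      by (intro mult_right_mono M) simp
    finally show ?thesis
      by (simp add: power2_eq_square mult.assoc)
  qed
  define C where "C = {c. \<forall>v\<in>K. c * (norm v)\<^sup>2 \<le> f v}"
  have "- M \<in> C"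
    using fM by (auto simp: C_def abs_le_iff minus_le_iff)
  have bdd: "bdd_above C"
  proof (rule bdd_aboveI)
    fix c assume "c \<in> C"
    then have "c * (norm u)\<^sup>2 \<le> f u"
      using u by (simp add: C_def)
    also have "f u \<le> M * (norm u)\<^sup>2"
      using fM[of u] by simp
    finally have "c * (norm u)\<^sup>2 \<le> M * (norm u)\<^sup>2" .
    then show "c \<le> M"
      using u by simp
  qed
  define s where "s = Sup C"
  have s1: "s * (norm v)\<^sup>2 \<le> f v" if v: "v \<in> K" for v
  proof (cases "v = 0")
    case False
    have "s \<le> f v / (norm v)\<^sup>2"
      unfolding s_def
    proof (rule cSup_least)
      show "C \<noteq> {}"
        using \<open>- M \<in> C\<close> by blast
    qed (use False v in \<open>auto simp: C_def pos_le_divide_eq\<close>)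
    then show ?thesis
      using False by (simp add: pos_le_divide_eq)
  qed (simp add: f_def)
  have s2: "f v \<le> s * (norm v)\<^sup>2" if v: "v \<in> K" for v
  proof (rule ccontr)
    assume "\<not> ?thesis"
    then have less: "s * (norm v)\<^sup>2 < f v" and "v \<noteq> 0"
      by (auto simp: f_def)
    then have "s < f v / (norm v)\<^sup>2"
      by (simp add: pos_less_divide_eq)
    then obtain c where c: "s < c" "c < f v / (norm v)\<^sup>2"
      using dense by blast
    have "c \<notin> C"
      using cSup_upper[OF _ bdd, of c] c(1) by (auto simp: s_def)
    then have "f v \<le> c * (norm v)\<^sup>2"
      using dich[of c] v by (auto simp: C_def)
    moreover have "c * (norm v)\<^sup>2 < f v"
      using c(2) \<open>v \<noteq> 0\<close> by (simp add: pos_less_divide_eq)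
    ultimately show False
      by simp
  qed
  have "T s v = 0" if "v \<in> K" for v
    by (rule quadratic_form_zero[OF T K TK _ that])
      (use s1 s2 in \<open>force simp: Tf intro: antisym\<close>)+
  then show ?thesis
    by (auto simp: T_def)
qed

section \<open>Schur's lemma for unitary operators\<close>

lemma unit_complex_cis:
  assumes "cmod z = 1"
  obtains \<phi> where "\<phi> \<in> {0..<2 * pi}" "z = cis \<phi>"
proof
  show "Arg2pi z \<in> {0..<2 * pi}"
    using Arg2pi[of z] by simp
  show "z = cis (Arg2pi z)"
    using Arg2pi[of z] assms by (simp add: cis_conv_exp is_Arg_def)
qed

lemma schur_unitary:
  assumes gen: "generates \<Phi> \<B> K" and U: "adjoint_pair U U'"
    and K: "\<And>v. v \<in> K \<Longrightarrow> U v \<in> K" "\<And>v. v \<in> K \<Longrightarrow> U' v \<in> K" "\<And>v. v \<in> K \<Longrightarrow> U' (U v) = v"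
    and comm: "\<And>X v. X \<in> \<B> \<Longrightarrow> v \<in> K \<Longrightarrow> U (X v) = X (U v)"
      "\<And>X v. X \<in> \<B> \<Longrightarrow> v \<in> K \<Longrightarrow> U' (X v) = X (U' v)"
  obtains \<phi> where "\<phi> \<in> {0..<2 * pi}" "\<And>v. v \<in> K \<Longrightarrow> U v = cis \<phi> *\<^sub>C v"
    "\<And>v. v \<in> K \<Longrightarrow> U' v = cis (- \<phi>) *\<^sub>C v"
proof -
  have S: "csubspace K"
    by (rule generates_csubspace[OF gen])
  note U' = adjoint_pair_sym[OF U]
  have a: "adjoint_pair (\<lambda>v. c *\<^sub>C U v + cnj c *\<^sub>C U' v) (\<lambda>v. c *\<^sub>C U v + cnj c *\<^sub>C U' v)" for c
    using adjoint_pair_lin_comb[OF U U', of c "cnj c"] by (simp add: add.commute)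
  have ex: "\<exists>r. \<forall>v\<in>K. c *\<^sub>C U v + cnj c *\<^sub>C U' v = complex_of_real r *\<^sub>C v" for c
    by (rule schur_self_adjoint[OF gen a])
      (simp_all add: csubspaceD[OF S] K comm bounded_clinear_simps[OF generates_op[OF gen]])
  obtain r where r: "\<And>v. v \<in> K \<Longrightarrow> U v + U' v = complex_of_real r *\<^sub>C v"
    using ex[of 1] by auto
  obtain s where s: "\<And>v. v \<in> K \<Longrightarrow> \<i> *\<^sub>C U v + (- \<i>) *\<^sub>C U' v = complex_of_real s *\<^sub>C v"
    using ex[of \<i>] by auto
  \<comment> \<open>The two self-adjoint combinations give \<open>U + U' = r\<close> and
    \<open>U - U' = - \<i> s\<close>, of which \<open>z\<close> is half the sum.\<close>
  define z where "z = (complex_of_real r - \<i> * complex_of_real s) / 2"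
  have Uz: "U v = z *\<^sub>C v" if "v \<in> K" for v
  proof (rule cvec_eqI)
    fix w
    have "cinner (U v) w + cinner (U' v) w = complex_of_real r * cinner v w"
      using arg_cong[OF r[OF that], of "\<lambda>x. cinner x w"] by (simp add: cinner_simps)
    moreover have "\<i> * cinner (U v) w - \<i> * cinner (U' v) w = complex_of_real s * cinner v w"
      using arg_cong[OF s[OF that], of "\<lambda>x. cinner x w"] by (simp add: cinner_simps)
    then have "\<i> * (\<i> * cinner (U v) w - \<i> * cinner (U' v) w) = \<i> * (complex_of_real s * cinner v w)"
      by simp
    then have "cinner (U' v) w - cinner (U v) w = \<i> * complex_of_real s * cinner v w"
      by (simp add: algebra_simps)
    ultimately have "2 * cinner (U v) w = (complex_of_real r - \<i> * complex_of_real s) * cinner v w"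
      by (simp add: algebra_simps)
    then show "cinner (U v) w = cinner (z *\<^sub>C v) w"
      by (simp add: z_def cinner_simps mult.commute)
  qed
  show ?thesis
  proof (cases "K = {0}")
    case True
    then show ?thesis
      using that[of 0] by (simp add: bounded_clinear_zero[OF adjoint_pair_bounded_clinear(1)[OF U]]
          bounded_clinear_zero[OF adjoint_pair_bounded_clinear(2)[OF U]])
  next
    case False
    then obtain u where u: "u \<in> K" "u \<noteq> 0"
      using csubspaceD(1)[OF S] by blast
    have "cinner (U u) (U u) = cinner u u"
      using K(3)[OF u(1)] by (simp add: adjoint_pair_right[OF U])
    then have "norm (U u) = norm u"
      by (simp add: norm_eq_sqrt_cinner)
    then have "cmod z = 1"
      using u by (simp add: Uz norm_scaleC)
    then obtain \<phi> where \<phi>: "\<phi> \<in> {0..<2 * pi}" "z = cis \<phi>"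
      by (rule unit_complex_cis)
    have "U' v = cis (- \<phi>) *\<^sub>C v" if v: "v \<in> K" for v
    proof -
      have "v = U' (cis \<phi> *\<^sub>C v)"
        using K(3)[OF v] Uz[OF v] \<phi>(2) by simp
      also have "\<dots> = cis \<phi> *\<^sub>C U' v"
        by (simp add: bounded_clinear_scaleC[OF adjoint_pair_bounded_clinear(2)[OF U]])
      finally have "cis (- \<phi>) *\<^sub>C v = cis (- \<phi>) *\<^sub>C (cis \<phi> *\<^sub>C U' v)"
        by simp
      then show ?thesis
        by (simp add: scaleC_scaleC cis_mult)
    qed
    then show ?thesis
      using that \<phi> Uz by blast
  qed
qed

lemma schur_unitary_UNIV:
  assumes gen: "generates \<Phi> \<B> UNIV" and U: "adjoint_pair U U'" "\<And>v. U' (U v) = v"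
    and comm: "\<forall>X\<in>\<B>. \<forall>v. U (X v) = X (U v) \<and> U' (X v) = X (U' v)"
  obtains \<phi> where "\<phi> \<in> {0..<2 * pi}" "\<And>v. U v = cis \<phi> *\<^sub>C v" "\<And>v. U' v = cis (- \<phi>) *\<^sub>C v"
proof (rule schur_unitary[OF gen U(1) UNIV_I UNIV_I U(2)])
  show "U (X v) = X (U v)" "U' (X v) = X (U' v)" if "X \<in> \<B>" for X v
    using comm that by blast+
next
  fix \<phi>
  assume "\<phi> \<in> {0..<2 * pi}" "\<And>v. v \<in> UNIV \<Longrightarrow> U v = cis \<phi> *\<^sub>C v"
    "\<And>v. v \<in> UNIV \<Longrightarrow> U' v = cis (- \<phi>) *\<^sub>C v"
  then show thesis
    by (intro that[of \<phi>]) auto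
qed

section \<open>The q-oscillator relation\<close>

text \<open>The squared norm of \<open>T' v\<close> is the inner product of \<open>T (T' v)\<close>
  with \<open>v\<close>. Cauchy-Schwarz and the bound for \<open>T\<close> at the vector
  \<open>T' v\<close> leave a common factor to cancel; this is why \<open>T'\<close> has to preserve
  \<open>K\<close>.\<close>

lemma norm_square_bound_adjoint:
  assumes T: "adjoint_pair T T'" and K: "\<And>v. v \<in> K \<Longrightarrow> T' v \<in> K"
    and t: "0 \<le> t" "\<And>v. v \<in> K \<Longrightarrow> (norm (T v))\<^sup>2 \<le> t * (norm v)\<^sup>2" and v: "v \<in> K"
  shows "(norm (T' v))\<^sup>2 \<le> t * (norm v)\<^sup>2"
proof (cases "T' v = 0")
  case False
  let ?n = "norm (T' v)"
  have "complex_of_real (?n\<^sup>2) = cinner (T (T' v)) v"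
    by (simp add: adjoint_pair_left[OF T] cinner_self)
  then have "?n\<^sup>2 \<le> norm (T (T' v)) * norm v"
    using cmod_cinner_le[of "T (T' v)" v] by (metis norm_of_real abs_of_nonneg zero_le_power2)
  then have "(?n\<^sup>2)\<^sup>2 \<le> (norm (T (T' v)))\<^sup>2 * (norm v)\<^sup>2"
    unfolding power_mult_distrib[symmetric] by (rule power_mono) simp
  also have "\<dots> \<le> (t * ?n\<^sup>2) * (norm v)\<^sup>2"
    by (intro mult_right_mono t K v) simp
  finally have "?n\<^sup>2 * ?n\<^sup>2 \<le> ?n\<^sup>2 * (t * (norm v)\<^sup>2)"
    by (simp add: power2_eq_square mult_ac)
  then show ?thesis
    by (rule mult_left_le_imp_le) (simp add: False)
qed (simp add: t)

lemma oscillator_norm_square_eq: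
  assumes T: "adjoint_pair T T'"
    and rel: "T' (T v) = complex_of_real (q\<^sup>2) *\<^sub>C T (T' v) + complex_of_real c *\<^sub>C v"
  shows "(norm (T v))\<^sup>2 = q\<^sup>2 * (norm (T' v))\<^sup>2 + c * (norm v)\<^sup>2"
proof -
  have "complex_of_real ((norm (T v))\<^sup>2) = cinner (T' (T v)) v"
    by (simp add: adjoint_pair_left[OF adjoint_pair_sym[OF T]] cinner_self)
  also have "\<dots> = complex_of_real (q\<^sup>2 * (norm (T' v))\<^sup>2 + c * (norm v)\<^sup>2)"
    unfolding rel by (simp add: cinner_simps adjoint_pair_left[OF T] cinner_self)
  finally show ?thesis
    unfolding of_real_eq_iff .
qed

text \<open>A bound \<open>t\<close> for \<open>\<parallel>T\<parallel>\<^sup>2\<close> improves to \<open>q\<^sup>2 t + c\<close>; iterating gives the fixed point.\<close>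

lemma oscillator_norm_bound:
  assumes q: "0 < q" "q < (1 :: real)" and c: "0 \<le> c" and T: "adjoint_pair T T'"
    and K: "\<And>v. v \<in> K \<Longrightarrow> T' v \<in> K"
    and rel: "\<And>v. v \<in> K \<Longrightarrow> T' (T v) = complex_of_real (q\<^sup>2) *\<^sub>C T (T' v) + complex_of_real c *\<^sub>C v"
    and v: "v \<in> K"
  shows "(norm (T v))\<^sup>2 \<le> c / (1 - q\<^sup>2) * (norm v)\<^sup>2"
proof -
  obtain M where M: "\<And>v. norm (T v) \<le> M * norm v"
    using adjoint_pair_bounded_clinear(1)[OF T] unfolding bounded_clinear_def by blast
  have q2: "0 < q\<^sup>2" "q\<^sup>2 < 1"
    using q by (simp_all add: power_less_one_iff)
  define s where "s = c / (1 - q\<^sup>2)"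
  have s: "q\<^sup>2 * s + c = s"
    using q2 by (simp add: s_def field_simps)
  have s0: "0 \<le> s"
    using q2 c by (simp add: s_def)
  have "\<forall>v\<in>K. (norm (T v))\<^sup>2 \<le> ((q\<^sup>2) ^ n * M\<^sup>2 + s) * (norm v)\<^sup>2" for n
  proof (induction n)
    case 0
    have "(norm (T v))\<^sup>2 \<le> M\<^sup>2 * (norm v)\<^sup>2" for v
      using power_mono[OF M[of v], of 2] by (simp add: power_mult_distrib)
    moreover have "M\<^sup>2 * (norm v)\<^sup>2 \<le> (M\<^sup>2 + s) * (norm v)\<^sup>2" for v :: 'a
      using s0 by (intro mult_right_mono) auto
    ultimately show ?case
      using order_trans by fastforce
  next
    case (Suc n)
    show ?case
    proof
      fix v assume v: "v \<in> K"
      have "(norm (T' v))\<^sup>2 \<le> ((q\<^sup>2) ^ n * M\<^sup>2 + s) * (norm v)\<^sup>2"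
        by (rule norm_square_bound_adjoint[OF T K _ _ v]) (use Suc s0 q in auto)
      then have "q\<^sup>2 * (norm (T' v))\<^sup>2 + c * (norm v)\<^sup>2
          \<le> q\<^sup>2 * (((q\<^sup>2) ^ n * M\<^sup>2 + s) * (norm v)\<^sup>2) + c * (norm v)\<^sup>2"
        using q2 by simp
      also have "\<dots> = ((q\<^sup>2) ^ Suc n * M\<^sup>2 + (q\<^sup>2 * s + c)) * (norm v)\<^sup>2"
        by (simp add: algebra_simps)
      finally show "(norm (T v))\<^sup>2 \<le> ((q\<^sup>2) ^ Suc n * M\<^sup>2 + s) * (norm v)\<^sup>2"
        unfolding oscillator_norm_square_eq[OF T rel[OF v]] s .
    qed
  qed
  then have le: "(norm (T v))\<^sup>2 \<le> ((q\<^sup>2) ^ n * M\<^sup>2 + s) * (norm v)\<^sup>2" for n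
    using v by blast
  have "(\<lambda>n. ((q\<^sup>2) ^ n * M\<^sup>2 + s) * (norm v)\<^sup>2) \<longlonglongrightarrow> (0 * M\<^sup>2 + s) * (norm v)\<^sup>2"
    using q2 by (intro tendsto_intros LIMSEQ_power_zero) simp
  from LIMSEQ_le_const[OF this] show ?thesis
    using le by (simp add: s_def)
qed

text \<open>Without the constant term the fixed point of the norm estimate is 0. This is what kills
  \<open>B\<close> and \<open>C\<close> when \<open>D\<close> is unitary, and \<open>F\<close> when
  \<open>B\<close> or \<open>C\<close> is.\<close>

lemma oscillator_null:
  assumes q: "0 < q" "q < (1 :: real)" and T: "adjoint_pair T T'"
    and K: "\<And>v. v \<in> K \<Longrightarrow> T' v \<in> K"
    and rel: "\<And>v. v \<in> K \<Longrightarrow> T' (T v) = complex_of_real (q\<^sup>2) *\<^sub>C T (T' v)" and v: "v \<in> K"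
  shows "T v = 0" "T' v = 0"
proof -
  have T0: "(norm (T v))\<^sup>2 \<le> 0 / (1 - q\<^sup>2) * (norm v)\<^sup>2" if "v \<in> K" for v
    by (rule oscillator_norm_bound[OF q _ T K _ that]) (simp_all add: rel)
  then show "T v = 0"
    using v by simp
  have "(norm (T' v))\<^sup>2 \<le> 0 * (norm v)\<^sup>2"
    by (rule norm_square_bound_adjoint[OF T K _ _ v]) (use T0 in simp_all)
  then show "T' v = 0"
    by simp
qed

text \<open>The relation is required on \<open>K\<close> only: \<open>D\<close> satisfies it
  everywhere, but \<open>B\<close>, \<open>C\<close> and \<open>F\<close> only on successive vacuum
  spaces.\<close>

locale q_oscillator =
  fixes q :: real and T T' :: "'h :: chilbert_space \<Rightarrow> 'h" and K :: "'h set"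
  assumes q: "0 < q" "q < 1"
    and adj: "adjoint_pair T T'"
    and K: "closed_csubspace K"
    and T_K: "\<And>v. v \<in> K \<Longrightarrow> T v \<in> K" and T'_K: "\<And>v. v \<in> K \<Longrightarrow> T' v \<in> K"
    and rel: "\<And>v. v \<in> K \<Longrightarrow>
      T' (T v) = complex_of_real (q\<^sup>2) *\<^sub>C T (T' v) + complex_of_real (1 - q\<^sup>2) *\<^sub>C v"
begin

lemma q2: "0 < q\<^sup>2" "q\<^sup>2 < 1"
  using q by (simp_all add: power_less_one_iff)

lemma csub: "csubspace K"
  using K by (simp add: closed_csubspace_iff)

lemmas lin = bounded_clinear_simps[OF adjoint_pair_bounded_clinear(1)[OF adj]]
lemmas lin' = bounded_clinear_simps[OF adjoint_pair_bounded_clinear(2)[OF adj]]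

lemma norm_square_T: "v \<in> K \<Longrightarrow> (norm (T v))\<^sup>2 \<le> (norm v)\<^sup>2"
  using oscillator_norm_bound[OF q _ adj T'_K rel, of v] q2 by simp

lemma norm_square_T': "v \<in> K \<Longrightarrow> (norm (T' v))\<^sup>2 \<le> (norm v)\<^sup>2"
  using norm_square_bound_adjoint[OF adj T'_K, where t = 1 and v = v] norm_square_T by simp

lemma defect_norm:
  "complex_of_real ((norm (v - T (T' v)))\<^sup>2)
    = complex_of_real ((norm v)\<^sup>2 - 2 * (norm (T' v))\<^sup>2 + (norm (T (T' v)))\<^sup>2)"
  unfolding cinner_self[symmetric] of_real_add of_real_diff of_real_mult
  by (simp add: cinner_simps adjoint_pair_right[OF adj] adjoint_pair_left[OF adj, of "T' v"] lin')

text \<open>Makes \<open>1 - T T'\<close> a contraction on \<open>K\<close>, so that the map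
  iterated in the next proof contracts by \<open>q\<^sup>2\<close>.\<close>

lemma defect_norm_le: "v \<in> K \<Longrightarrow> norm (v - T (T' v)) \<le> norm v"
  using norm_square_T[OF T'_K, of v] defect_norm[of v] zero_le_power2[of "norm (T' v)"]
  unfolding of_real_eq_iff by (intro power2_le_imp_le[OF _ norm_ge_zero]) linarith

text \<open>Without vacuum vectors \<open>T\<close> is onto: \<open>T' T = 1 - q\<^sup>2 (1 - T T')\<close> is invertible by a Neumann
  series, and the solution \<open>w\<close> of \<open>T' T w = T' v\<close> satisfies \<open>T' (T w - v) = 0\<close>.\<close>

lemma surj_on_if_no_vacuum:
  assumes no_vacuum: "\<And>v. v \<in> K \<Longrightarrow> T' v = 0 \<Longrightarrow> v = 0" and v: "v \<in> K"
  shows "\<exists>w\<in>K. T w = v"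
proof -
  \<comment> \<open>A fixed point satisfies \<open>w - q\<^sup>2 (w - T (T' w)) = T' v\<close>, and
    the left side is \<open>T' (T w)\<close> by \<open>rel\<close>.\<close>
  define f where "f = (\<lambda>w. T' v + complex_of_real (q\<^sup>2) *\<^sub>C (w - T (T' w)))"
  have "\<exists>!w\<in>K. f w = w"
  proof (rule Banach_fix)
    show "complete K" "K \<noteq> {}"
      using K v by (auto simp: closed_csubspace_def complete_eq_closed)
    show "0 \<le> q\<^sup>2" "q\<^sup>2 < 1"
      using q2 by auto
    show fK: "f ` K \<subseteq> K"
      using v by (auto simp: f_def intro!: csubspaceD[OF csub] csubspace_diff[OF csub] T_K T'_K)
    show "dist (f w) (f w') \<le> q\<^sup>2 * dist w w'" if "w \<in> K" "w' \<in> K" for w w'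
    proof -
      have "f w - f w' = complex_of_real (q\<^sup>2) *\<^sub>C ((w - w') - T (T' (w - w')))"
        by (simp add: f_def lin lin' scaleC_diff_right scaleC_add_right algebra_simps)
      then have "norm (f w - f w') = q\<^sup>2 * norm ((w - w') - T (T' (w - w')))"
        by (simp add: norm_scaleC norm_power)
      then show ?thesis
        using defect_norm_le[OF csubspace_diff[OF csub that]] by (simp add: dist_norm mult_left_mono)
    qed
  qed
  then obtain w where w: "w \<in> K" "f w = w"
    by blast
  have "T' (T w) = T' v"
  proof -
    have "w = T' v + complex_of_real (q\<^sup>2) *\<^sub>C (w - T (T' w))"
      using w(2) by (simp add: f_def)
    then show ?thesis
      unfolding rel[OF w(1)] by (simp add: scaleC_diff_left scaleC_diff_right algebra_simps)
  qed
  then have "T' (T w - v) = 0"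
    by (simp add: lin')
  moreover have "T w - v \<in> K"
    using w v by (simp add: csubspace_diff[OF csub] T_K)
  ultimately have "T w - v = 0"
    using no_vacuum by blast
  then show ?thesis
    using w(1) by auto
qed

text \<open>With \<open>y = 1 - T T'\<close> the relation \<open>y T = q\<^sup>2 T y\<close> forces the quotients \<open>\<langle>y v, v\<rangle> / \<parallel>v\<parallel>\<^sup>2\<close>,
  which are at most 1, to grow by \<open>q\<^sup>-\<^sup>2\<close> with every application of \<open>T\<^sup>-\<^sup>1\<close>.\<close>

lemma unitary_if_no_vacuum:
  assumes no_vacuum: "\<And>v. v \<in> K \<Longrightarrow> T' v = 0 \<Longrightarrow> v = 0" and v: "v \<in> K"
  shows "T (T' v) = v" "T' (T v) = v"
proof -
  define g where "g = (\<lambda>v. SOME w. w \<in> K \<and> T w = v)"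
  have g: "g v \<in> K" "T (g v) = v" if "v \<in> K" for v
    using someI_ex[of "\<lambda>w. w \<in> K \<and> T w = v"] surj_on_if_no_vacuum[OF no_vacuum that]
    by (auto simp: g_def)
  define a where "a = (\<lambda>v :: 'h. (norm v)\<^sup>2 - (norm (T' v))\<^sup>2)"
  have a0: "0 \<le> a v" if "v \<in> K" for v
    using norm_square_T'[OF that] by (simp add: a_def)
  \<comment> \<open>With denominators cleared: the quotient \<open>a / norm\<^sup>2\<close> at
    \<open>T w\<close> is at most \<open>q\<^sup>2\<close> times the quotient at
    \<open>w\<close>.\<close>
  have step: "a (T w) * (norm w)\<^sup>2 \<le> q\<^sup>2 * a w * (norm (T w))\<^sup>2" if w: "w \<in> K" for w
  proof -
    define y where "y = w - T (T' w)"
    have b: "(norm (T w))\<^sup>2 = (norm w)\<^sup>2 - q\<^sup>2 * a w"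
      unfolding oscillator_norm_square_eq[OF adj rel[OF w]] by (simp add: a_def algebra_simps)
    have wy: "cinner w y = complex_of_real (a w)"
      by (simp add: y_def a_def cinner_simps cinner_self adjoint_pair_right[OF adj])
    then have yw: "cinner y w = complex_of_real (a w)"
      by (metis cinner_commute complex_cnj_complex_of_real)
    have T'T: "T' (T w) = w - complex_of_real (q\<^sup>2) *\<^sub>C y"
      unfolding rel[OF w] y_def by (simp add: scaleC_diff_left scaleC_diff_right algebra_simps)
    have "cinner (T' (T w)) (T' (T w)) = cinner w w - 2 * complex_of_real (q\<^sup>2 * a w)
        + complex_of_real (q\<^sup>2 * q\<^sup>2) * cinner y y"
      unfolding T'T by (simp add: cinner_simps wy yw algebra_simps)
    then have "complex_of_real ((norm (T' (T w)))\<^sup>2)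
        = complex_of_real ((norm w)\<^sup>2 - 2 * q\<^sup>2 * a w + q\<^sup>2 * (q\<^sup>2 * (norm y)\<^sup>2))"
      by (simp add: cinner_self)
    then have n: "(norm (T' (T w)))\<^sup>2 = (norm w)\<^sup>2 - 2 * q\<^sup>2 * a w + q\<^sup>2 * (q\<^sup>2 * (norm y)\<^sup>2)"
      unfolding of_real_eq_iff .
    have "a (T w) = (norm (T w))\<^sup>2 - (norm (T' (T w)))\<^sup>2"
      by (simp add: a_def)
    then have a1: "a (T w) = q\<^sup>2 * a w - q\<^sup>2 * (q\<^sup>2 * (norm y)\<^sup>2)"
      unfolding b n by simp
    \<comment> \<open>After insertion of \<open>a1\<close> and \<open>b\<close> and cancellation of
      the common term, the claim is the square of this instance of Cauchy-Schwarz, multiplied by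
      \<open>q\<^sup>2\<close> twice.\<close>
    have "\<bar>a w\<bar> \<le> norm y * norm w"
      using cmod_cinner_le[of y w] unfolding yw by simp
    then have "\<bar>a w\<bar>\<^sup>2 \<le> (norm y * norm w)\<^sup>2"
      by (rule power_mono) simp
    then have "(a w)\<^sup>2 \<le> (norm y)\<^sup>2 * (norm w)\<^sup>2"
      by (simp add: power_mult_distrib)
    then have "q\<^sup>2 * (q\<^sup>2 * (a w)\<^sup>2) \<le> q\<^sup>2 * (q\<^sup>2 * ((norm y)\<^sup>2 * (norm w)\<^sup>2))"
      using q2 by simp
    then show ?thesis
      unfolding a1 b by (simp add: algebra_simps power2_eq_square)
  qed
  have a_zero: "a v = 0" if v: "v \<in> K" for v
  proof (cases "v = 0")
    case False
    have gK: "(g ^^ n) v \<in> K" for n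
      by (induction n) (simp_all add: v g)
    have Tg: "T ((g ^^ Suc n) v) = (g ^^ n) v" for n
      using g(2)[OF gK] by simp
    have g0: "(g ^^ n) v \<noteq> 0" for n
    proof (induction n)
      case (Suc n)
      then show ?case
        using Tg[of n] by (metis lin(5))
    qed (simp add: False)
    have grow: "a v * (norm ((g ^^ n) v))\<^sup>2 \<le> (q\<^sup>2) ^ n * a ((g ^^ n) v) * (norm v)\<^sup>2" for n
    proof (induction n)
      case (Suc n)
      let ?w = "(g ^^ n) v" and ?u = "(g ^^ Suc n) v"
      have "(norm ?w)\<^sup>2 * (a v * (norm ?u)\<^sup>2) = a v * (norm ?w)\<^sup>2 * (norm ?u)\<^sup>2"
        by simp
      also have "\<dots> \<le> (q\<^sup>2) ^ n * a ?w * (norm v)\<^sup>2 * (norm ?u)\<^sup>2"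
        by (intro mult_right_mono Suc) simp
      also have "\<dots> = (q\<^sup>2) ^ n * (norm v)\<^sup>2 * (a ?w * (norm ?u)\<^sup>2)"
        by simp
      also have "\<dots> \<le> (q\<^sup>2) ^ n * (norm v)\<^sup>2 * (q\<^sup>2 * a ?u * (norm ?w)\<^sup>2)"
        using step[OF gK[of "Suc n"]] unfolding Tg by (intro mult_left_mono) auto
      also have "\<dots> = (norm ?w)\<^sup>2 * ((q\<^sup>2) ^ Suc n * a ?u * (norm v)\<^sup>2)"
        by simp
      finally show ?case
        by (rule mult_left_le_imp_le) (simp add: g0)
    qed simp
    have le: "a v \<le> (q\<^sup>2) ^ n * (norm v)\<^sup>2" for n
    proof -
      have "(norm ((g ^^ n) v))\<^sup>2 * a v \<le> (q\<^sup>2) ^ n * (norm v)\<^sup>2 * a ((g ^^ n) v)"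
        using grow[of n] by (simp add: mult_ac)
      also have "\<dots> \<le> (q\<^sup>2) ^ n * (norm v)\<^sup>2 * (norm ((g ^^ n) v))\<^sup>2"
        by (intro mult_left_mono) (auto simp: a_def)
      finally have "(norm ((g ^^ n) v))\<^sup>2 * a v \<le> (norm ((g ^^ n) v))\<^sup>2 * ((q\<^sup>2) ^ n * (norm v)\<^sup>2)"
        by (simp add: mult_ac)
      then show ?thesis
        by (rule mult_left_le_imp_le) (simp add: g0)
    qed
    have "(\<lambda>n. (q\<^sup>2) ^ n * (norm v)\<^sup>2) \<longlonglongrightarrow> 0 * (norm v)\<^sup>2"
      using q2 by (intro tendsto_intros LIMSEQ_power_zero) simp
    from LIMSEQ_le_const[OF this] have "a v \<le> 0"
      using le by simp
    then show ?thesis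
      using a0[OF v] by simp
  qed (simp add: a_def lin')
  \<comment> \<open>Since \<open>a v = 0\<close>, \<open>T'\<close> preserves the norm of
    \<open>v\<close>, and the formula for the norm of the defect leaves nothing positive.\<close>
  show TT': "T (T' v) = v"
  proof -
    have "(norm (v - T (T' v)))\<^sup>2 = (norm v)\<^sup>2 - 2 * (norm (T' v))\<^sup>2 + (norm (T (T' v)))\<^sup>2"
      using defect_norm[of v] unfolding of_real_eq_iff .
    also have "\<dots> \<le> (norm v)\<^sup>2 - 2 * (norm (T' v))\<^sup>2 + (norm (T' v))\<^sup>2"
      using norm_square_T[OF T'_K[OF v]] by simp
    also have "\<dots> = 0"
      using a_zero[OF v] by (simp add: a_def)
    finally show ?thesis
      by simp
  qed
  show "T' (T v) = v"
    unfolding rel[OF v] TT' scaleC_add_left[symmetric] by simp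
qed

end

text \<open>\<open>osc q T n v\<close> is \<open>T\<^sup>n v\<close> scaled so that \<open>T\<close> acts on the sequence as in the standard basis.\<close>

primrec osc :: "real \<Rightarrow> ('h :: chilbert_space \<Rightarrow> 'h) \<Rightarrow> nat \<Rightarrow> 'h \<Rightarrow> 'h"
  where
    "osc q T 0 v = v"
  | "osc q T (Suc n) v = complex_of_real (1 / sqrt (1 - q ^ (2 * (n + 1)))) *\<^sub>C T (osc q T n v)"

section \<open>Normalised orbits of a creation operator\<close>

lemma bounded_clinear_osc: "bounded_clinear T \<Longrightarrow> bounded_clinear (osc q T n)"
proof (induction n)
  case 0
  have "osc q T 0 = (\<lambda>v. v)"
    by auto
  then show ?case
    by (simp add: bounded_clinear_ident)
next
  case (Suc n)
  have "osc q T (Suc n) = (\<lambda>v. complex_of_real (1 / sqrt (1 - q ^ (2 * (n + 1)))) *\<^sub>C T (osc q T n v))"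
    by auto
  then show ?case
    using Suc by (simp only: bounded_clinear_scale bounded_clinear_compose)
qed

lemma osc_mem:
  assumes "csubspace K" "\<And>v. v \<in> K \<Longrightarrow> T v \<in> K" "v \<in> K"
  shows "osc q T n v \<in> K"
  using assms by (induction n) (simp_all add: csubspaceD)

lemma osc_commute:
  assumes X: "bounded_clinear X" and T: "bounded_clinear T"
    and K: "csubspace K" "\<And>v. v \<in> K \<Longrightarrow> T v \<in> K"
    and c: "\<And>u. u \<in> K \<Longrightarrow> X (T u) = c *\<^sub>C T (X u)" and v: "v \<in> K"
  shows "X (osc q T n v) = c ^ n *\<^sub>C osc q T n (X v)"
proof (induction n)
  case (Suc n)
  then show ?case
    using osc_mem[OF K v]
    by (simp add: bounded_clinear_simps[OF X] bounded_clinear_simps[OF T] c scaleC_scaleC mult_ac)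
qed simp

lemma osc_raise:
  assumes "0 < q" "q < 1"
  shows "T (osc q T n v) = complex_of_real (sqrt (1 - q ^ (2 * (n + 1)))) *\<^sub>C osc q T (Suc n) v"
proof -
  have "q ^ (2 * (n + 1)) < 1"
    using assms by (subst power_less_one_iff) auto
  then have "complex_of_real (sqrt (1 - q ^ (2 * (n + 1)))) \<noteq> 0"
    by simp
  then show ?thesis
    unfolding osc.simps scaleC_scaleC of_real_mult[symmetric] by simp
qed

text \<open>The new operator acts innermost: its orbit stays in the space that the old words start
  from.\<close>

definition osc_words :: "real \<Rightarrow> ('h :: chilbert_space \<Rightarrow> 'h) \<Rightarrow> ('h \<Rightarrow> 'h) set \<Rightarrow> ('h \<Rightarrow> 'h) set"
  where "osc_words q T \<Phi> = (\<Union>\<phi>\<in>\<Phi>. range (\<lambda>n v. \<phi> (osc q T n v)))"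

lemma osc_wordsI: "\<phi> \<in> \<Phi> \<Longrightarrow> (\<lambda>v. \<phi> (osc q T n v)) \<in> osc_words q T \<Phi>"
  unfolding osc_words_def by (rule UN_I, assumption, rule rangeI)

lemma osc_wordsE:
  assumes "\<psi> \<in> osc_words q T \<Phi>"
  obtains \<phi> n where "\<phi> \<in> \<Phi>" "\<psi> = (\<lambda>v. \<phi> (osc q T n v))"
  using assms unfolding osc_words_def by (elim UN_E rangeE) (rule that)

context q_oscillator
begin

lemma osc_K: "v \<in> K \<Longrightarrow> osc q T n v \<in> K"
  by (rule osc_mem[OF csub T_K])

text \<open>\<open>T T'\<close> has eigenvalue \<open>1 - q ^ (2 * n)\<close> on the
  \<open>n\<close>-th vector, \<open>rel\<close> turns it into the next eigenvalue for
  \<open>T' T\<close>, and the normalisation leaves its square root. At \<open>n = 0\<close> the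
  coefficient is 0, so the truncated predecessor does no harm.\<close>

lemma osc_lower:
  assumes v: "v \<in> K" "T' v = 0"
  shows "T' (osc q T n v) = complex_of_real (sqrt (1 - q ^ (2 * n))) *\<^sub>C osc q T (n - 1) v"
proof (induction n)
  case (Suc n)
  let ?u = "osc q T n v"
  have le: "q ^ (2 * k) \<le> 1" for k
    using q by (intro power_le_one) auto
  have lt: "q ^ (2 * (n + 1)) < 1"
    using q by (subst power_less_one_iff) auto
  have TT': "T (T' ?u) = complex_of_real (1 - q ^ (2 * n)) *\<^sub>C ?u"
  proof (cases n)
    case (Suc m)
    have "complex_of_real (sqrt (1 - q ^ (2 * n))) * complex_of_real (sqrt (1 - q ^ (2 * (m + 1))))
        = complex_of_real (1 - q ^ (2 * n))"
      unfolding of_real_mult[symmetric] using le[of n] by (simp add: Suc)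
    then show ?thesis
      unfolding Suc.IH lin using osc_raise[OF q, of T m v] Suc
      by (simp only: scaleC_scaleC diff_Suc_1)
  qed (simp add: v lin)
  have "T' (T ?u) = complex_of_real (q\<^sup>2 * (1 - q ^ (2 * n)) + (1 - q\<^sup>2)) *\<^sub>C ?u"
    unfolding rel[OF osc_K[OF v(1)]] TT' scaleC_scaleC scaleC_add_left[symmetric] by simp
  also have "q\<^sup>2 * (1 - q ^ (2 * n)) + (1 - q\<^sup>2) = 1 - q ^ (2 * (n + 1))"
    by (simp add: algebra_simps power_add power2_eq_square)
  finally have "T' (osc q T (Suc n) v)
      = complex_of_real (1 / sqrt (1 - q ^ (2 * (n + 1))) * (1 - q ^ (2 * (n + 1)))) *\<^sub>C ?u"
    by (simp add: lin' scaleC_scaleC)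
  also have "1 / sqrt (1 - q ^ (2 * (n + 1))) * (1 - q ^ (2 * (n + 1))) = sqrt (1 - q ^ (2 * (n + 1)))"
    using lt by (simp add: real_div_sqrt)
  finally show ?case
    by simp
qed (simp add: v)

lemma osc_inner_vacuum:
  assumes "v \<in> K" "w \<in> K" "T' v = 0" "T' w = 0"
  shows "cinner (osc q T n v) (osc q T m w) = (if n = m then cinner v w else 0)"
proof (induction n arbitrary: m)
  case 0
  show ?case
    using assms by (cases m) (simp_all add: cinner_scaleC_right adjoint_pair_right[OF adj])
next
  case (Suc n)
  show ?case
  proof (cases m)
    case 0
    then show ?thesis
      using assms by (simp add: cinner_scaleC_left adjoint_pair_left[OF adj])
  next
    case (Suc k)
    have "q ^ (2 * (k + 1)) < 1"
      using q by (subst power_less_one_iff) auto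
    then have "complex_of_real (1 / sqrt (1 - q ^ (2 * (k + 1)))) * complex_of_real (sqrt (1 - q ^ (2 * (k + 1)))) = 1"
      unfolding of_real_mult[symmetric] by simp
    moreover have "cinner (osc q T (Suc n) v) (osc q T m w)
        = complex_of_real (1 / sqrt (1 - q ^ (2 * (n + 1))))
          * (complex_of_real (sqrt (1 - q ^ (2 * (k + 1)))) * cinner (osc q T n v) (osc q T k w))"
      unfolding osc.simps(2)[of q T n] cinner_scaleC_left adjoint_pair_left[OF adj]
        osc_lower[OF assms(2,4)] cinner_scaleC_right by (simp add: Suc)
    ultimately show ?thesis
      using Suc.IH[of k] by (auto simp: Suc simp flip: mult.assoc)
  qed
qed

lemma closed_csubspace_vacuum: "closed_csubspace {v \<in> K. T' v = 0}"
proof -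
  have "{v \<in> K. T' v = 0} = K \<inter> {v. T' v = 0}"
    by blast
  then show ?thesis
    using closed_csubspace_Int[OF K closed_csubspace_kernel[OF adjoint_pair_bounded_clinear(2)[OF adj]]]
    by simp
qed

text \<open>A subspace \<open>G\<close> of the vacuum space is enlarged to the span of its orbits,
  which \<open>inv\<close> makes invariant under the old family; the old property then applies to
  that span.\<close>

lemma generates_vacuum:
  assumes gen: "generates \<Phi> \<A> K"
    and \<B>: "\<And>X. X \<in> \<B> \<Longrightarrow> bounded_clinear X"
      "\<And>X v. X \<in> \<B> \<Longrightarrow> v \<in> K \<Longrightarrow> T' v = 0 \<Longrightarrow> X v \<in> K \<and> T' (X v) = 0"
    and inv: "\<And>G X g n. \<lbrakk>csubspace G; G \<subseteq> {v \<in> K. T' v = 0}; \<And>X g. X \<in> \<B> \<Longrightarrow> g \<in> G \<Longrightarrow> X g \<in> G;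
      X \<in> \<A>; g \<in> G\<rbrakk> \<Longrightarrow> X (osc q T n g) \<in> cspan {osc q T n g |n g. g \<in> G}"
  shows "generates (osc_words q T \<Phi>) \<B> {v \<in> K. T' v = 0}"
  unfolding generates_def
proof (intro conjI ballI allI impI)
  show "closed_csubspace {v \<in> K. T' v = 0}"
    by (rule closed_csubspace_vacuum)
next
  fix \<psi> assume "\<psi> \<in> osc_words q T \<Phi>"
  then obtain \<phi> n where \<phi>: "\<phi> \<in> \<Phi>" and \<psi>: "\<psi> = (\<lambda>v. \<phi> (osc q T n v))"
    by (rule osc_wordsE)
  show "bounded_clinear \<psi>"
    unfolding \<psi> by (rule bounded_clinear_compose[OF generates_word[OF gen \<phi>]
          bounded_clinear_osc[OF adjoint_pair_bounded_clinear(1)[OF adj]]])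
  obtain c where c: "\<And>u w. u \<in> K \<Longrightarrow> w \<in> K \<Longrightarrow> cinner (\<phi> u) w = c * cinner u w"
    using gen \<phi> unfolding generates_def by meson
  \<comment> \<open>For positive \<open>n\<close> the orbit is orthogonal to the vacuum space, which
    gives the multiple 0.\<close>
  have "cinner (\<psi> u) w = (if n = 0 then c else 0) * cinner u w"
    if "u \<in> K" "w \<in> K" "T' u = 0" "T' w = 0" for u w
    using that c[OF osc_K, of u w n] osc_inner_vacuum[of u w n 0] by (simp add: \<psi>)
  then show "\<exists>c. \<forall>u\<in>{v \<in> K. T' v = 0}. \<forall>w\<in>{v \<in> K. T' v = 0}. cinner (\<psi> u) w = c * cinner u w"
    by blast
next
  fix X assume X: "X \<in> \<B>"
  show "bounded_clinear X" "v \<in> {v \<in> K. T' v = 0} \<Longrightarrow> X v \<in> {v \<in> K. T' v = 0}" for v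
    using \<B> X by auto
next
  fix G Z
  assume a: "csubspace G \<and> G \<subseteq> {v \<in> K. T' v = 0} \<and> G \<noteq> {0} \<and> (\<forall>X\<in>\<B>. \<forall>g\<in>G. X g \<in> G) \<and>
    closed_csubspace Z \<and> (\<forall>\<phi>\<in>osc_words q T \<Phi>. \<forall>g\<in>G. \<phi> g \<in> Z)"
  define S where "S = {osc q T n g |n g. g \<in> G}"
  have SZ: "\<phi> s \<in> Z" if \<phi>: "\<phi> \<in> \<Phi>" and s: "s \<in> S" for \<phi> s
  proof -
    obtain n g where g: "g \<in> G" and sg: "s = osc q T n g"
      using s by (auto simp: S_def)
    have "\<forall>\<psi>\<in>osc_words q T \<Phi>. \<forall>g\<in>G. \<psi> g \<in> Z"
      using a by blast
    from bspec[OF bspec[OF this osc_wordsI[OF \<phi>, of q T n]] g] show ?thesis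
      by (simp add: sg)
  qed
  have GS: "G \<subseteq> S"
    by (auto simp: S_def intro!: exI[of _ "0 :: nat"])
  show "Z = UNIV"
  proof (rule generates_UNIV[OF gen csubspace_cspan])
    have "S \<subseteq> K"
      using a osc_K by (auto simp: S_def)
    then show "cspan S \<subseteq> K"
      using cspan_minimal[OF _ csub] by blast
    show "cspan S \<noteq> {0}"
    proof -
      have "0 \<in> G" "G \<noteq> {0}"
        using a by (simp_all add: csubspaceD(1))
      then obtain g where "g \<in> G" "g \<noteq> 0"
        by blast
      then show ?thesis
        using GS cspan_base by blast
    qed
    show "X g \<in> cspan S" if X: "X \<in> \<A>" and g: "g \<in> cspan S" for X g
    proof (rule cspan_invariant[OF generates_op[OF gen X] _ g])
      show "X s \<in> cspan S" if "s \<in> S" for s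
        using that a X unfolding S_def by (auto intro!: inv)
    qed
    show "closed_csubspace Z"
      using a by blast
    then have Z: "csubspace Z"
      by (simp add: closed_csubspace_iff)
    show "\<phi> g \<in> Z" if \<phi>: "\<phi> \<in> \<Phi>" and g: "g \<in> cspan S" for \<phi> g
      using g by induction (simp_all add: bounded_clinear_simps[OF generates_word[OF gen \<phi>]]
          csubspaceD[OF Z] SZ[OF \<phi>])
  qed
qed

text \<open>The two commutation premises have separate purposes: the one with \<open>T'\<close>
  keeps the vacuum space invariant under the remaining operators, the one with \<open>T\<close>
  keeps the span of orbits invariant.\<close>

lemma vacuum_or_unitary:
  assumes gen: "generates \<Phi> (insert T (insert T' \<B>)) K"
    and comm: "\<forall>X\<in>\<B>. \<exists>c. \<forall>u\<in>K. X (T u) = c *\<^sub>C T (X u)"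
    and comm': "\<forall>X\<in>\<B>. \<exists>c. \<forall>u\<in>K. T' (X u) = c *\<^sub>C X (T' u)"
  obtains (unitary) "\<And>v. v \<in> K \<Longrightarrow> T (T' v) = v" "\<And>v. v \<in> K \<Longrightarrow> T' (T v) = v"
  | (vacuum) v where "v \<in> K" "T' v = 0" "v \<noteq> 0"
    "generates (osc_words q T \<Phi>) \<B> {v \<in> K. T' v = 0}"
proof (cases "\<exists>v\<in>K. T' v = 0 \<and> v \<noteq> 0")
  case False
  then have "\<And>v. v \<in> K \<Longrightarrow> T' v = 0 \<Longrightarrow> v = 0"
    by blast
  from unitary_if_no_vacuum[OF this] show ?thesis
    by (rule unitary)
next
  case True
  have \<B>K: "X v \<in> K" if "X \<in> \<B>" "v \<in> K" for X v
    using generates_invariant[OF gen] that by blast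
  have b: "bounded_clinear X" if "X \<in> \<B>" for X
    using generates_op[OF gen] that by blast
  have "generates (osc_words q T \<Phi>) \<B> {v \<in> K. T' v = 0}"
  proof (rule generates_vacuum[OF gen b])
    show "X v \<in> K \<and> T' (X v) = 0" if X: "X \<in> \<B>" and v: "v \<in> K" "T' v = 0" for X v
    proof -
      obtain c where "T' (X v) = c *\<^sub>C X (T' v)"
        using comm' X v(1) by blast
      then show ?thesis
        using \<B>K X v by (simp add: bounded_clinear_zero[OF b])
    qed
  next
    fix G X g n
    assume G: "csubspace G" "G \<subseteq> {v \<in> K. T' v = 0}" and BG: "\<And>X g. X \<in> \<B> \<Longrightarrow> g \<in> G \<Longrightarrow> X g \<in> G"
      and X: "X \<in> insert T (insert T' \<B>)" and g: "g \<in> G"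
    have gK: "g \<in> K" "T' g = 0"
      using G g by auto
    have base: "osc q T n g \<in> cspan {osc q T n g |n g. g \<in> G}" if "g \<in> G" for n g
      using that by (intro cspan_base) blast
    show "X (osc q T n g) \<in> cspan {osc q T n g |n g. g \<in> G}"
      using X
    proof (elim insertE)
      assume "X = T"
      then show ?thesis
        unfolding osc_raise[OF q] by (simp only: osc_raise[OF q] cspan_scale base g)
    next
      assume "X = T'"
      then show ?thesis
        by (simp only: osc_lower[OF gK] cspan_scale base g)
    next
      assume X: "X \<in> \<B>"
      then obtain c where c: "\<And>u. u \<in> K \<Longrightarrow> X (T u) = c *\<^sub>C T (X u)"
        using comm by blast
      have "X (osc q T n g) = c ^ n *\<^sub>C osc q T n (X g)"
        by (rule osc_commute[OF b[OF X] adjoint_pair_bounded_clinear(1)[OF adj] csub])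
          (simp_all add: T_K gK c)
      then show ?thesis
        by (simp only: cspan_scale base BG X g)
    qed
  qed
  then show ?thesis
    using True by (blast intro: vacuum)
qed

end

section \<open>Unitary equivalence through an orthonormal basis\<close>

definition orthonormal :: "('i \<Rightarrow> 'h :: chilbert_space) \<Rightarrow> bool"
  where "orthonormal e \<longleftrightarrow> (\<forall>i j. cinner (e i) (e j) = (if i = j then 1 else 0))"

definition total_family :: "('i \<Rightarrow> 'h :: chilbert_space) \<Rightarrow> bool"
  where "total_family e \<longleftrightarrow> (\<forall>Z. closed_csubspace Z \<and> (\<forall>i. e i \<in> Z) \<longrightarrow> Z = UNIV)"

section \<open>Orthonormal families and the standard basis\<close>

lemma csubspace_sum:
  assumes "csubspace G" "\<And>i. i \<in> F \<Longrightarrow> f i \<in> G"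
  shows "(\<Sum>i\<in>F. f i) \<in> G"
  using assms by (induction F rule: infinite_finite_induct) (auto intro: csubspaceD)

lemma cinner_sum_left: "cinner (\<Sum>i\<in>F. f i) (y :: 'h :: chilbert_space) = (\<Sum>i\<in>F. cinner (f i) y)"
  by (induction F rule: infinite_finite_induct) (auto simp: cinner_add_left)

lemma cinner_sum_right: "cinner (y :: 'h :: chilbert_space) (\<Sum>i\<in>F. f i) = (\<Sum>i\<in>F. cinner y (f i))"
  by (induction F rule: infinite_finite_induct) (auto simp: cinner_add_right)

text \<open>Bessel's identity. It gives the square-summability of coefficients and, for the standard
  basis, the approximation by finite sums.\<close>

lemma orthonormal_projection_norm:
  assumes e: "orthonormal e" and F: "finite F"
  shows "(norm (x - (\<Sum>i\<in>F. cinner x (e i) *\<^sub>C e i)))\<^sup>2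
    = (norm x)\<^sup>2 - (\<Sum>i\<in>F. (cmod (cinner x (e i)))\<^sup>2)"
proof -
  define y where "y = (\<Sum>i\<in>F. cinner x (e i) *\<^sub>C e i)"
  have "cinner y (e j) = cinner x (e j)" if "j \<in> F" for j
  proof -
    have "cinner y (e j) = (\<Sum>i\<in>F. if i = j then cinner x (e i) else 0)"
      using e unfolding y_def cinner_sum_left orthonormal_def
      by (intro sum.cong) (auto simp: cinner_scaleC_left)
    then show ?thesis
      using F that by simp
  qed
  then have "cinner (x - y) y = 0"
    by (subst (2) y_def) (simp add: cinner_sum_right cinner_simps)
  then have "cinner (x - y) (x - y) = cinner x x - cinner y x"
    by (simp add: cinner_diff_right[of "x - y"]) (simp add: cinner_diff_left)
  also have "cinner y x = (\<Sum>i\<in>F. cinner x (e i) * cnj (cinner x (e i)))"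
    unfolding y_def cinner_sum_left
    by (intro sum.cong) (auto simp: cinner_scaleC_left cinner_commute[of "e _" x])
  finally have "complex_of_real ((norm (x - y))\<^sup>2)
      = complex_of_real ((norm x)\<^sup>2 - (\<Sum>i\<in>F. (cmod (cinner x (e i)))\<^sup>2))"
    unfolding cinner_self complex_norm_square[symmetric] by simp
  then show ?thesis
    unfolding of_real_eq_iff y_def .
qed

lemma cinner_ket_right: "cinner x (ket i) = coord x i"
proof -
  have "cinner x (ket i) = (\<Sum>\<^sub>\<infinity>j. coord x j * cnj (if j = i then 1 else 0))"
    by (simp add: cinner_ell2.rep_eq ket.rep_eq)
  also have "\<dots> = (\<Sum>\<^sub>\<infinity>j\<in>{i}. coord x j * cnj (if j = i then 1 else 0))"
    by (rule infsum_cong_neutral) auto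
  finally show ?thesis
    by simp
qed

lemma orthonormal_ket: "orthonormal ket"
  by (simp add: orthonormal_def cinner_ket_right ket.rep_eq)

lemma total_ket: "total_family ket"
  unfolding total_family_def
proof (intro allI impI, elim conjE)
  fix Z :: "'a ell2 set"
  assume Z: "closed_csubspace Z" and ket: "\<forall>i. ket i \<in> Z"
  have "x \<in> closure Z" for x
    unfolding closure_approachable
  proof (intro allI impI)
    fix \<epsilon> :: real assume \<epsilon>: "\<epsilon> > 0"
    have "((\<lambda>i. (cmod (coord x i))\<^sup>2) has_sum (norm x)\<^sup>2) UNIV"
      using has_sum_infsum[OF coord_summable[of x]] by (simp add: norm_ell2.rep_eq infsum_nonneg)
    then have "\<forall>\<^sub>F F in finite_subsets_at_top UNIV. dist (\<Sum>i\<in>F. (cmod (coord x i))\<^sup>2) ((norm x)\<^sup>2) < \<epsilon>\<^sup>2"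
      unfolding has_sum_def using \<epsilon> by (intro tendstoD) auto
    then obtain F where F: "finite F" "dist (\<Sum>i\<in>F. (cmod (coord x i))\<^sup>2) ((norm x)\<^sup>2) < \<epsilon>\<^sup>2"
      unfolding eventually_finite_subsets_at_top by blast
    define y where "y = (\<Sum>i\<in>F. cinner x (ket i) *\<^sub>C ket i)"
    have "(norm (x - y))\<^sup>2 < \<epsilon>\<^sup>2"
      using F(2) unfolding y_def orthonormal_projection_norm[OF orthonormal_ket F(1)]
      by (simp add: cinner_ket_right dist_real_def)
    then have "dist y x < \<epsilon>"
      using \<epsilon> power_less_imp_less_base[of "norm (x - y)" 2 \<epsilon>] by (simp add: dist_norm norm_minus_commute)
    moreover have "y \<in> Z"
      using Z ket by (auto simp: y_def closed_csubspace_iff intro!: csubspace_sum csubspaceD)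
    ultimately show "\<exists>y\<in>Z. dist y x < \<epsilon>"
      by blast
  qed
  then show "Z = UNIV"
    using Z by (auto simp: closed_csubspace_def)
qed

section \<open>Unitary maps and transport of representations\<close>

lemma unitary_map_norm:
  assumes "unitary_map U"
  shows "norm (U x) = norm x"
  using assms by (simp add: unitary_map_def norm_eq_sqrt_cinner)

text \<open>\<open>U\<close> takes the coefficients with respect to \<open>e\<close>. The vectors on
  which it preserves inner products form a closed subspace containing every \<open>e i\<close>,
  hence all vectors do. The range of an isometry is complete, hence closed, and it contains the
  standard basis.\<close>

lemma ex_unitary_map:
  fixes e :: "'i \<Rightarrow> 'h :: chilbert_space"
  assumes e: "orthonormal e" "total_family e"
  obtains U :: "'h \<Rightarrow> 'i ell2" where "unitary_map U" "\<And>i. U (e i) = ket i"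
proof -
  have s: "(\<lambda>i. (cmod (cinner x (e i)))\<^sup>2) summable_on UNIV"
    and b: "sqrt (\<Sum>\<^sub>\<infinity>i. (cmod (cinner x (e i)))\<^sup>2) \<le> norm x" for x
  proof -
    have L2: "L2_set (\<lambda>i. cmod (cinner x (e i))) F \<le> norm x" if "finite F" for F
    proof -
      have "(\<Sum>i\<in>F. (cmod (cinner x (e i)))\<^sup>2) \<le> (norm x)\<^sup>2"
        using orthonormal_projection_norm[OF e(1) that, of x]
          zero_le_power2[of "norm (x - (\<Sum>i\<in>F. cinner x (e i) *\<^sub>C e i))"] by linarith
      then show ?thesis
        by (simp add: L2_set_def real_le_lsqrt sum_nonneg)
    qed
    show "(\<lambda>i. (cmod (cinner x (e i)))\<^sup>2) summable_on UNIV"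
      "sqrt (\<Sum>\<^sub>\<infinity>i. (cmod (cinner x (e i)))\<^sup>2) \<le> norm x"
      using ell2_of_L2_set_bound[OF L2] by blast+
  qed
  define U where "U x = Abs_ell2 (\<lambda>i. cinner x (e i))" for x
  have coord_U: "coord (U x) i = cinner x (e i)" for x i
    unfolding U_def by (subst Abs_ell2_inverse) (use s in auto)
  have U: "bounded_clinear U"
  proof (rule bounded_clinearI[where K = 1])
    show "U (x + y) = U x + U y" for x y
      by (rule ell2_eqI) (simp add: coord_U plus_ell2.rep_eq cinner_add_left)
    show "U (c *\<^sub>C x) = c *\<^sub>C U x" for c x
      by (rule ell2_eqI) (simp add: coord_U scaleC_ell2.rep_eq cinner_scaleC_left)
    show "norm (U x) \<le> 1 * norm x" for x
      using b[of x] by (simp add: norm_ell2.rep_eq coord_U)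
  qed
  note lin = bounded_clinear_simps[OF U]
  have Ue: "U (e i) = ket i" for i
    using e(1) by (intro ell2_eqI) (auto simp: coord_U orthonormal_def ket.rep_eq)
  have iso: "cinner (U x) (U y) = cinner x y" for x y
  proof -
    have "closed_csubspace {x. cinner (U x) (U y) = cinner x y}"
      unfolding closed_csubspace_def
      by (auto simp: lin cinner_simps intro!: closed_Collect_eq continuous_cinner_left
          continuous_on_compose2[OF continuous_cinner_left[of UNIV] bounded_clinear_continuous[OF U]])
    moreover have "cinner (U (e i)) (U y) = cinner (e i) y" for i
      using cinner_ket_right[of "U y" i] cinner_commute[of "ket i" "U y"] cinner_commute[of "e i" y]
      by (simp add: Ue coord_U)
    ultimately have "{x. cinner (U x) (U y) = cinner x y} = UNIV"
      using e(2) unfolding total_family_def by blast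
    then show ?thesis
      by blast
  qed
  have norm_U: "norm (U x) = norm x" for x
    by (simp add: norm_eq_sqrt_cinner iso)
  have "closed (range U)"
  proof (rule complete_imp_closed)
    show "complete (range U)"
      by (rule complete_isometric_image[where e = 1])
        (auto simp: norm_U closed_csubspace_def complete_eq_closed bounded_clinear_bounded_linear[OF U])
  qed
  then have "closed_csubspace (range U)"
    unfolding closed_csubspace_def using lin(1,2,5) by (auto simp flip: lin(1,2) intro: range_eqI[of _ _ 0])
  then have "range U = UNIV"
    using total_ket Ue unfolding total_family_def by (metis rangeI)
  then show ?thesis
    using that U iso Ue unfolding unitary_map_def by blast
qed

lemma star_representation_transfer:
  fixes \<pi> :: "'a \<Rightarrow> 'h :: chilbert_space \<Rightarrow> 'h" and U :: "'h \<Rightarrow> 'k :: chilbert_space"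
  assumes \<pi>: "star_representation A \<pi>" and U: "unitary_map U"
  obtains \<sigma> where "star_representation A \<sigma>" "unitarily_equivalent A \<pi> \<sigma>" "\<And>a x. \<sigma> a (U x) = U (\<pi> a x)"
proof -
  have bU: "bounded_clinear U" and iso: "\<And>x y. cinner (U x) (U y) = cinner x y" and surj: "surj U"
    using U by (simp_all add: unitary_map_def)
  note lin = bounded_clinear_simps[OF bU]
  define V where "V = inv_into UNIV U"
  have UV: "U (V y) = y" for y
    by (simp add: V_def surj surj_f_inv_f)
  have VU: "V (U x) = x" for x
  proof -
    have "norm (U (V (U x)) - U x) = norm (V (U x) - x)"
      unfolding lin(4)[symmetric] by (rule unitary_map_norm[OF U])
    then show ?thesis
      by (simp add: UV)
  qed
  have V_eq: "V y = x" if "U x = y" for x y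
    using VU[of x] that by simp
  have V_add: "V (x + y) = V x + V y" and V_scale: "V (c *\<^sub>C x) = c *\<^sub>C V x" for x y c
    by (rule V_eq, simp add: lin UV)+
  have V_norm: "norm (V y) = norm y" for y
    using unitary_map_norm[OF U, of "V y"] by (simp add: UV)
  define \<sigma> where "\<sigma> = (\<lambda>a y. U (\<pi> a (V y)))"
  have "star_representation A \<sigma>"
    unfolding star_representation_def
  proof (intro conjI ballI allI)
    obtain x :: 'h where "x \<noteq> 0"
      using \<pi> unfolding star_representation_def by blast
    then have "U x \<noteq> 0"
      using unitary_map_norm[OF U, of x] by auto
    then show "\<exists>y :: 'k. y \<noteq> 0" ..
    have "separable_space (euclidean :: 'h topology)"
      using \<pi> unfolding star_representation_def by blast
    moreover have "continuous_map euclidean euclidean U"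
      using bounded_clinear_continuous[OF bU] by simp
    ultimately show "separable_space (euclidean :: 'k topology)"
      by (rule separable_space_continuous_map_image) (simp add: surj)
  next
    fix a assume a: "a \<in> carrier A"
    then have b: "bounded_clinear (\<pi> a)"
      using \<pi> unfolding star_representation_def by blast
    then obtain K where K: "\<And>x. norm (\<pi> a x) \<le> K * norm x"
      unfolding bounded_clinear_def by blast
    show "bounded_clinear (\<sigma> a)"
      by (rule bounded_clinearI[where K = K])
        (use K[of "V _"] in \<open>simp_all add: \<sigma>_def V_add V_scale lin bounded_clinear_simps[OF b]
          unitary_map_norm[OF U] V_norm\<close>)
    show "\<sigma> (c \<odot>\<^bsub>A\<^esub> a) x = c *\<^sub>C \<sigma> a x" for c x
      using \<pi> a unfolding star_representation_def \<sigma>_def by (simp add: lin)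
    show "cinner (\<sigma> (invol A a) x) y = cinner x (\<sigma> a y)" for x y
    proof -
      have "cinner (\<pi> (invol A a) (V x)) (V y) = cinner (V x) (\<pi> a (V y))"
        using \<pi> a unfolding star_representation_def by blast
      then show ?thesis
        unfolding \<sigma>_def by (metis iso UV)
    qed
    fix b assume "b \<in> carrier A"
    then show "\<sigma> (a \<oplus>\<^bsub>A\<^esub> b) x = \<sigma> a x + \<sigma> b x" "\<sigma> (a \<otimes>\<^bsub>A\<^esub> b) x = \<sigma> a (\<sigma> b x)" for x
      using \<pi> a unfolding star_representation_def \<sigma>_def by (simp_all add: lin VU)
  next
    show "\<sigma> \<one>\<^bsub>A\<^esub> x = x" for x
      using \<pi> unfolding star_representation_def \<sigma>_def by (simp add: UV)
  qed
  moreover have "\<sigma> a (U x) = U (\<pi> a x)" for a x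
    by (simp add: \<sigma>_def VU)
  moreover from this have "unitarily_equivalent A \<pi> \<sigma>"
    unfolding unitarily_equivalent_def using U by auto
  ultimately show ?thesis
    using that by blast
qed

section \<open>Operators satisfying the relations of the quantum matrix ball\<close>

locale quantum_matrix_ops =
  fixes q :: real and A A' B B' C C' D D' :: "'h :: chilbert_space \<Rightarrow> 'h" and Q :: complex
  defines "Q \<equiv> complex_of_real q"
  assumes q: "0 < q" "q < 1"
    and adj: "adjoint_pair A A'" "adjoint_pair B B'" "adjoint_pair C C'" "adjoint_pair D D'"
    and AB: "A (B v) = Q *\<^sub>C B (A v)"
    and BC: "B (C v) = C (B v)"
    and AC: "A (C v) = Q *\<^sub>C C (A v)"
    and BD: "B (D v) = Q *\<^sub>C D (B v)"
    and AD: "A (D v) = D (A v) + (Q - inverse Q) *\<^sub>C C (B v)"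
    and CD: "C (D v) = Q *\<^sub>C D (C v)"
    and A'A: "A' (A v) = Q\<^sup>2 *\<^sub>C A (A' v) - (1 - Q\<^sup>2) *\<^sub>C (B (B' v) + C (C' v))
      + (inverse (Q\<^sup>2) * (1 - Q\<^sup>2)\<^sup>2) *\<^sub>C D (D' v) + (1 - Q\<^sup>2) *\<^sub>C v"
    and B'B: "B' (B v) = Q\<^sup>2 *\<^sub>C B (B' v) - (1 - Q\<^sup>2) *\<^sub>C D (D' v) + (1 - Q\<^sup>2) *\<^sub>C v"
    and C'C: "C' (C v) = Q\<^sup>2 *\<^sub>C C (C' v) - (1 - Q\<^sup>2) *\<^sub>C D (D' v) + (1 - Q\<^sup>2) *\<^sub>C v"
    and D'D: "D' (D v) = Q\<^sup>2 *\<^sub>C D (D' v) + (1 - Q\<^sup>2) *\<^sub>C v"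
    and A'B: "A' (B v) = Q *\<^sub>C B (A' v) + (Q - inverse Q) *\<^sub>C D (C' v)"
    and D'B: "D' (B v) = Q *\<^sub>C B (D' v)"
    and A'C: "A' (C v) = Q *\<^sub>C C (A' v) + (Q - inverse Q) *\<^sub>C D (B' v)"
    and D'C: "D' (C v) = Q *\<^sub>C C (D' v)"
    and A'D: "A' (D v) = D (A' v)"
    and B'C: "B' (C v) = C (B' v)"
    and irreducible: "\<And>Z. closed_csubspace Z \<Longrightarrow>
      (\<And>X v. X \<in> {A, A', B, B', C, C', D, D'} \<Longrightarrow> v \<in> Z \<Longrightarrow> X v \<in> Z) \<Longrightarrow> Z = {0} \<or> Z = UNIV"
    and nontrivial: "\<exists>x :: 'h. x \<noteq> 0"
begin

lemmas bl = adjoint_pair_bounded_clinear[OF adj(1)] adjoint_pair_bounded_clinear[OF adj(2)]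
  adjoint_pair_bounded_clinear[OF adj(3)] adjoint_pair_bounded_clinear[OF adj(4)]

lemmas lins = bl[THEN bounded_clinear_add] bl[THEN bounded_clinear_scaleC]
  bl[THEN bounded_clinear_minus] bl[THEN bounded_clinear_diff] bl[THEN bounded_clinear_zero]

lemmas adj_move = adj[THEN adjoint_pair_sym, THEN adjoint_pair_left]

lemma Q: "Q \<noteq> 0" "cnj Q = Q"
  using q by (simp_all add: Q_def)

section \<open>Relations obtained by taking adjoints\<close>

lemma C'B: "C' (B v) = B (C' v)"
  by (rule cvec_eqI) (simp add: adj_move adj[THEN adjoint_pair_left] B'C)

lemma C'B': "C' (B' v) = B' (C' v)"
  by (rule cvec_eqI) (simp add: adj_move BC)

lemma B'A': "B' (A' v) = Q *\<^sub>C A' (B' v)"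
  by (rule cvec_eqI) (simp add: adj_move cinner_simps AB Q)

lemma C'A': "C' (A' v) = Q *\<^sub>C A' (C' v)"
  by (rule cvec_eqI) (simp add: adj_move cinner_simps AC Q)

lemma D'B': "D' (B' v) = Q *\<^sub>C B' (D' v)"
  by (rule cvec_eqI) (simp add: adj_move cinner_simps BD Q)

lemma D'C': "D' (C' v) = Q *\<^sub>C C' (D' v)"
  by (rule cvec_eqI) (simp add: adj_move cinner_simps CD Q)

lemma D'A': "D' (A' v) = A' (D' v) + (Q - inverse Q) *\<^sub>C B' (C' v)"
  by (rule cvec_eqI) (simp add: adj_move cinner_simps AD Q)

lemma D'A: "D' (A v) = A (D' v)"
  by (rule cvec_eqI) (simp add: adj_move adj[THEN adjoint_pair_left] A'D)

lemma B'D: "B' (D v) = Q *\<^sub>C D (B' v)"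
  by (rule cvec_eqI) (simp add: adj_move adj[THEN adjoint_pair_left] cinner_simps D'B Q)

lemma C'D: "C' (D v) = Q *\<^sub>C D (C' v)"
  by (rule cvec_eqI) (simp add: adj_move adj[THEN adjoint_pair_left] cinner_simps D'C Q)

lemma B'A: "B' (A v) = Q *\<^sub>C A (B' v) + (Q - inverse Q) *\<^sub>C C (D' v)"
  by (rule cvec_eqI) (simp add: adj_move adj[THEN adjoint_pair_left] cinner_simps A'B Q)

lemma C'A: "C' (A v) = Q *\<^sub>C A (C' v) + (Q - inverse Q) *\<^sub>C B (D' v)"
  by (rule cvec_eqI) (simp add: adj_move adj[THEN adjoint_pair_left] cinner_simps A'C Q)

text \<open>The closure of an invariant subspace is invariant by continuity, so irreducibility makes
  every nonzero invariant subspace dense. The only word is the identity, with multiple 1.\<close>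

lemma generates_initial: "generates {\<lambda>v. v} {A, A', B, B', C, C', D, D'} UNIV"
  unfolding generates_def
proof (intro conjI ballI allI impI)
  fix G Z :: "'h set"
  assume a: "csubspace G \<and> G \<subseteq> UNIV \<and> G \<noteq> {0} \<and> (\<forall>X\<in>{A, A', B, B', C, C', D, D'}. \<forall>g\<in>G. X g \<in> G) \<and>
    closed_csubspace Z \<and> (\<forall>\<phi>\<in>{\<lambda>v. v}. \<forall>g\<in>G. \<phi> g \<in> Z)"
  have "closure G = {0} \<or> closure G = UNIV"
  proof (rule irreducible)
    show "closed_csubspace (closure G)"
      using a by (simp add: csubspace_closure)
    show "X v \<in> closure G" if X: "X \<in> {A, A', B, B', C, C', D, D'}" and v: "v \<in> closure G" for X v
    proof -
      have "bounded_clinear X"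
        using X bl by auto
      then have "continuous_on (closure G) X"
        by (rule bounded_clinear_continuous)
      moreover have "X ` G \<subseteq> closure G"
        using a X closure_subset by blast
      ultimately have "X ` closure G \<subseteq> closure G"
        by (intro image_closure_subset) auto
      then show ?thesis
        using v by blast
    qed
  qed
  moreover have "closure G \<noteq> {0}"
    using a closure_subset[of G] csubspaceD(1)[of G] by auto
  moreover have "closure G \<subseteq> Z"
    using a by (intro closure_minimal) (auto simp: closed_csubspace_def)
  ultimately show "Z = UNIV"
    by blast
qed (use bl in \<open>auto simp: closed_csubspace_UNIV bounded_clinear_ident intro: exI[of _ 1]\<close>)

definition K :: "'h set"
  where "K = {v. D' v = 0}"

text \<open>On \<open>K\<close> the operator \<open>F\<close> agrees with \<open>A\<close>, and its adjoint \<open>F'\<close>, unlike \<open>A'\<close>, preserves \<open>K\<close>.\<close>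

definition F :: "'h \<Rightarrow> 'h"
  where "F v = A v + inverse Q *\<^sub>C C (B (D' v))"

definition F' :: "'h \<Rightarrow> 'h"
  where "F' v = A' v + inverse Q *\<^sub>C D (B' (C' v))"

section \<open>The compression of \<open>A\<close> to the vacuum space of \<open>D\<close>\<close>

lemma adjF: "adjoint_pair F F'"
proof -
  have "adjoint_pair (\<lambda>v. 1 *\<^sub>C A v + inverse Q *\<^sub>C C (B (D' v)))
    (\<lambda>v. cnj 1 *\<^sub>C A' v + cnj (inverse Q) *\<^sub>C D (B' (C' v)))"
    by (rule adjoint_pair_lin_comb[OF adj(1)
          adjoint_pair_compose[OF adj(3) adjoint_pair_compose[OF adj(2) adjoint_pair_sym[OF adj(4)]]]])
  then show ?thesis
    unfolding F_def[abs_def] F'_def[abs_def] by (simp add: Q)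
qed

lemma closed_csubspace_K: "closed_csubspace K"
  unfolding K_def by (rule closed_csubspace_kernel[OF bl(8)])

lemma csubspace_K: "csubspace K"
  using closed_csubspace_K by (simp add: closed_csubspace_iff)

lemma F_eq_A: "v \<in> K \<Longrightarrow> F v = A v"
  by (simp add: F_def K_def lins)

lemma K_invariant:
  assumes "v \<in> K"
  shows "B v \<in> K" "B' v \<in> K" "C v \<in> K" "C' v \<in> K" "F v \<in> K" "F' v \<in> K"
proof -
  show 1: "B v \<in> K" "B' v \<in> K" "C v \<in> K" "C' v \<in> K"
    using assms by (simp_all add: K_def D'B D'B' D'C D'C' lins)
  show "F v \<in> K"
    using assms by (simp add: F_eq_A) (simp add: K_def D'A lins)
  \<comment> \<open>On this vector \<open>D' D\<close> is multiplication by
    \<open>1 - Q\<^sup>2\<close>, so the correction term in \<open>F'\<close> cancels exactly the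
    inhomogeneous term of \<open>D'A'\<close>.\<close>
  have "B' (C' v) \<in> K"
    using assms by (simp add: K_def D'B' D'C' lins)
  then have "D' (F' v) = (Q - inverse Q) *\<^sub>C B' (C' v) + inverse Q *\<^sub>C (1 - Q\<^sup>2) *\<^sub>C B' (C' v)"
    using assms by (simp add: F'_def lins D'A' D'D K_def)
  also have "\<dots> = ((Q - inverse Q) + inverse Q * (1 - Q\<^sup>2)) *\<^sub>C B' (C' v)"
    by (simp only: scaleC_add_left scaleC_scaleC)
  also have "(Q - inverse Q) + inverse Q * (1 - Q\<^sup>2) = 0"
    using Q by (simp add: field_simps power2_eq_square)
  finally show "F' v \<in> K"
    by (simp add: K_def)
qed

lemma F_B: "v \<in> K \<Longrightarrow> F (B v) = Q *\<^sub>C B (F v)"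
  by (simp add: F_eq_A K_invariant AB)

lemma F_C: "v \<in> K \<Longrightarrow> F (C v) = Q *\<^sub>C C (F v)"
  by (simp add: F_eq_A K_invariant AC)

lemma B'_F: "v \<in> K \<Longrightarrow> B' (F v) = Q *\<^sub>C F (B' v)"
  by (simp add: F_eq_A K_invariant B'A) (simp add: K_def lins)

lemma C'_F: "v \<in> K \<Longrightarrow> C' (F v) = Q *\<^sub>C F (C' v)"
  by (simp add: F_eq_A K_invariant C'A) (simp add: K_def lins)

lemma B'B_K: "v \<in> K \<Longrightarrow> B' (B v) = Q\<^sup>2 *\<^sub>C B (B' v) + (1 - Q\<^sup>2) *\<^sub>C v"
  by (simp add: B'B K_def lins)

lemma C'C_K: "v \<in> K \<Longrightarrow> C' (C v) = Q\<^sup>2 *\<^sub>C C (C' v) + (1 - Q\<^sup>2) *\<^sub>C v"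
  by (simp add: C'C K_def lins)

text \<open>The correction in \<open>F'\<close> contributes
  \<open>inverse Q * (1 - Q\<^sup>2)\<close> times \<open>D (C' v)\<close>, which cancels the
  inhomogeneous term of \<open>A'B\<close>. A pure q-commutation remains.\<close>

lemma F'_B:
  assumes v: "v \<in> K"
  shows "F' (B v) = Q *\<^sub>C B (F' v)"
proof (rule cvec_eqI)
  fix z
  have "F' (B v) = Q *\<^sub>C B (A' v) + (Q - inverse Q) *\<^sub>C D (C' v)
      + inverse Q *\<^sub>C (Q\<^sup>2 *\<^sub>C D (B (B' (C' v))) + (1 - Q\<^sup>2) *\<^sub>C D (C' v))"
    by (simp add: F'_def A'B C'B B'B_K K_invariant v lins)
  moreover have "Q *\<^sub>C B (F' v) = Q *\<^sub>C (B (A' v) + inverse Q *\<^sub>C Q *\<^sub>C D (B (B' (C' v))))"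
    by (simp add: F'_def lins BD)
  ultimately show "cinner (F' (B v)) z = cinner (Q *\<^sub>C B (F' v)) z"
    using Q by (simp add: cinner_simps field_simps power2_eq_square)
qed

lemma F'_C:
  assumes v: "v \<in> K"
  shows "F' (C v) = Q *\<^sub>C C (F' v)"
proof (rule cvec_eqI)
  fix z
  have "F' (C v) = Q *\<^sub>C C (A' v) + (Q - inverse Q) *\<^sub>C D (B' v)
      + inverse Q *\<^sub>C (Q\<^sup>2 *\<^sub>C D (C (B' (C' v))) + (1 - Q\<^sup>2) *\<^sub>C D (B' v))"
    by (simp add: F'_def A'C B'C C'C_K C'B'[symmetric] K_invariant v lins)
  moreover have "Q *\<^sub>C C (F' v) = Q *\<^sub>C (C (A' v) + inverse Q *\<^sub>C Q *\<^sub>C D (C (B' (C' v))))"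
    by (simp add: F'_def lins CD)
  ultimately show "cinner (F' (C v)) z = cinner (Q *\<^sub>C C (F' v)) z"
    using Q by (simp add: cinner_simps field_simps power2_eq_square)
qed

lemma B'_F': "v \<in> K \<Longrightarrow> B' (F' v) = Q *\<^sub>C F' (B' v)"
  by (simp add: F'_def lins B'A' B'D C'B' scaleC_scaleC scaleC_add_right mult.commute)

lemma C'_F': "v \<in> K \<Longrightarrow> C' (F' v) = Q *\<^sub>C F' (C' v)"
  by (simp add: F'_def lins C'A' C'D C'B' scaleC_scaleC scaleC_add_right mult.commute)

text \<open>The bracket is \<open>(1 - B B') (1 - C C')\<close> multiplied out; the order of its
  last term uses that \<open>C\<close> commutes with \<open>B\<close> and \<open>B'\<close>.\<close>

lemma F'F:
  assumes v: "v \<in> K"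
  shows "F' (F v) = Q\<^sup>2 *\<^sub>C F (F' v)
    + (1 - Q\<^sup>2) *\<^sub>C (v - B (B' v) - C (C' v) + C (B (B' (C' v))))"
proof (rule cvec_eqI)
  fix z
  have "D' v = 0"
    using v by (simp add: K_def)
  then have 1: "F' (F v) = A' (A v) + inverse Q *\<^sub>C Q *\<^sub>C Q *\<^sub>C D (A (B' (C' v)))"
    unfolding F_eq_A[OF v] by (simp add: F'_def lins C'A B'A D'C')
  have 2: "A' (A v) = Q\<^sup>2 *\<^sub>C A (A' v) - (1 - Q\<^sup>2) *\<^sub>C (B (B' v) + C (C' v)) + (1 - Q\<^sup>2) *\<^sub>C v"
    using \<open>D' v = 0\<close> by (simp add: A'A lins)
  have 3: "F (F' v) = A (A' v) + inverse Q *\<^sub>C (D (A (B' (C' v))) + (Q - inverse Q) *\<^sub>C C (B (B' (C' v))))"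
    by (simp add: F_eq_A K_invariant v) (simp add: F'_def lins AD)
  show "cinner (F' (F v)) z = cinner (Q\<^sup>2 *\<^sub>C F (F' v)
    + (1 - Q\<^sup>2) *\<^sub>C (v - B (B' v) - C (C' v) + C (B (B' (C' v))))) z"
    unfolding 1 2 3 using Q by (simp add: cinner_simps field_simps power2_eq_square)
qed

subsection \<open>The vacuum vectors of \<open>D\<close>\<close>

lemma oscillator_D: "q_oscillator q D D' UNIV"
  by unfold_locales (use q adj(4) in \<open>auto simp: closed_csubspace_UNIV D'D Q_def\<close>)

lemma oscillator_B:
  assumes "closed_csubspace L" "L \<subseteq> K" "\<And>v. v \<in> L \<Longrightarrow> B v \<in> L" "\<And>v. v \<in> L \<Longrightarrow> B' v \<in> L"
  shows "q_oscillator q B B' L"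
proof
  show "B' (B v) = complex_of_real (q\<^sup>2) *\<^sub>C B (B' v) + complex_of_real (1 - q\<^sup>2) *\<^sub>C v" if "v \<in> L" for v
    using that assms(2) B'B_K[of v] by (auto simp: Q_def)
qed (use assms q adj(2) in auto)

lemma oscillator_C:
  assumes "closed_csubspace L" "L \<subseteq> K" "\<And>v. v \<in> L \<Longrightarrow> C v \<in> L" "\<And>v. v \<in> L \<Longrightarrow> C' v \<in> L"
  shows "q_oscillator q C C' L"
proof
  show "C' (C v) = complex_of_real (q\<^sup>2) *\<^sub>C C (C' v) + complex_of_real (1 - q\<^sup>2) *\<^sub>C v" if "v \<in> L" for v
    using that assms(2) C'C_K[of v] by (auto simp: Q_def)
qed (use assms q adj(3) in auto)

section \<open>Action of the operators on orbits\<close>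

lemma osc_commute_UNIV:
  assumes "bounded_clinear X" "bounded_clinear T" "\<And>u. X (T u) = c *\<^sub>C T (X u)"
  shows "X (osc q T n v) = c ^ n *\<^sub>C osc q T n (X v)"
  by (rule osc_commute[where K = UNIV]) (use assms in \<open>auto simp: csubspace_def\<close>)

lemma D_osc: "D (osc q D k w) = complex_of_real (sqrt (1 - q ^ (2 * (k + 1)))) *\<^sub>C osc q D (k + 1) w"
  using osc_raise[OF q, of D k w] by simp

lemma B_osc: "B (osc q B k w) = complex_of_real (sqrt (1 - q ^ (2 * (k + 1)))) *\<^sub>C osc q B (k + 1) w"
  using osc_raise[OF q, of B k w] by simp

lemma C_osc: "C (osc q C k w) = complex_of_real (sqrt (1 - q ^ (2 * (k + 1)))) *\<^sub>C osc q C (k + 1) w"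
  using osc_raise[OF q, of C k w] by simp

lemma F_osc: "F (osc q F k w) = complex_of_real (sqrt (1 - q ^ (2 * (k + 1)))) *\<^sub>C osc q F (k + 1) w"
  using osc_raise[OF q, of F k w] by simp

lemma B_osc_D: "B (osc q D k w) = Q ^ k *\<^sub>C osc q D k (B w)"
  by (rule osc_commute_UNIV) (simp_all add: bl BD)

lemma C_osc_D: "C (osc q D k w) = Q ^ k *\<^sub>C osc q D k (C w)"
  by (rule osc_commute_UNIV) (simp_all add: bl CD)

lemma B'_osc_D: "B' (osc q D k w) = Q ^ k *\<^sub>C osc q D k (B' w)"
  by (rule osc_commute_UNIV) (simp_all add: bl B'D)

lemma C'_osc_D: "C' (osc q D k w) = Q ^ k *\<^sub>C osc q D k (C' w)"
  by (rule osc_commute_UNIV) (simp_all add: bl C'D)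

lemma A'_osc_D: "A' (osc q D k w) = osc q D k (A' w)"
  using osc_commute_UNIV[of A' D 1 k w] by (simp add: bl A'D)

lemma D_commute_osc: "osc q D k (D w) = D (osc q D k w)"
  using osc_commute_UNIV[of D D 1 k w] by (simp add: bl)

lemma C_osc_B: "C (osc q B k w) = osc q B k (C w)"
  using osc_commute_UNIV[of C B 1 k w] by (simp add: bl BC)

lemma F_osc_B: "w \<in> K \<Longrightarrow> F (osc q B k w) = Q ^ k *\<^sub>C osc q B k (F w)"
  by (rule osc_commute[OF _ _ csubspace_K])
    (simp_all add: bl adjoint_pair_bounded_clinear[OF adjF] K_invariant F_B)

lemma F_osc_C: "w \<in> K \<Longrightarrow> F (osc q C k w) = Q ^ k *\<^sub>C osc q C k (F w)"
  by (rule osc_commute[OF _ _ csubspace_K])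
    (simp_all add: bl adjoint_pair_bounded_clinear[OF adjF] K_invariant F_C)

lemma osc_B_mem_K: "w \<in> K \<Longrightarrow> osc q B k w \<in> K"
  and osc_C_mem_K: "w \<in> K \<Longrightarrow> osc q C k w \<in> K"
  and osc_F_mem_K: "w \<in> K \<Longrightarrow> osc q F k w \<in> K"
  by (simp_all add: osc_mem[OF csubspace_K] K_invariant)

lemmas osc_lins = bounded_clinear_simps[OF bounded_clinear_osc[OF bl(7)]]
  bounded_clinear_simps[OF bounded_clinear_osc[OF bl(5)]]
  bounded_clinear_simps[OF bounded_clinear_osc[OF bl(3)]]

text \<open>Each passage of \<open>A\<close> through a factor \<open>D\<close> adds
  \<open>Q - inverse Q\<close> times \<open>C B\<close>, and moving \<open>C B\<close> inward past
  \<open>j\<close> factors costs \<open>Q ^ (2 * j)\<close>. The geometric sum is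
  \<open>- inverse q * (1 - q ^ (2 * k))\<close>, and the normalisation turns it into the square
  root. This is the origin of the lowering term of the first generator in the series.\<close>

lemma A_osc_D:
  "A (osc q D k w) = osc q D k (A w)
    - complex_of_real (inverse q * sqrt (1 - q ^ (2 * k))) *\<^sub>C osc q D (k - 1) (C (B w))"
proof (induction k)
  case (Suc k)
  let ?r = "1 / sqrt (1 - q ^ (2 * (k + 1)))" and ?y = "osc q D k (C (B w))"
  have le: "q ^ (2 * j) \<le> 1" for j
    using q by (intro power_le_one) auto
  have lt: "q ^ (2 * (k + 1)) < 1"
    using q by (subst power_less_one_iff) auto
  have CB: "C (B (osc q D k w)) = Q ^ (2 * k) *\<^sub>C ?y"
    by (simp add: B_osc_D C_osc_D lins scaleC_scaleC power_add[symmetric] mult_2)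
  \<comment> \<open>For \<open>k = 0\<close> both sides vanish, although \<open>k - 1\<close> is
    then truncated to 0.\<close>
  have D_pred: "complex_of_real (inverse q * sqrt (1 - q ^ (2 * k))) *\<^sub>C D (osc q D (k - 1) (C (B w)))
      = complex_of_real (inverse q * (1 - q ^ (2 * k))) *\<^sub>C ?y"
  proof (cases k)
    case (Suc j)
    have "sqrt (1 - q ^ (2 * k)) * sqrt (1 - q ^ (2 * (j + 1))) = 1 - q ^ (2 * k)"
      using le[of k] by (simp add: Suc)
    then have "complex_of_real (inverse q * sqrt (1 - q ^ (2 * k))) * complex_of_real (sqrt (1 - q ^ (2 * (j + 1))))
        = complex_of_real (inverse q * (1 - q ^ (2 * k)))"
      unfolding of_real_mult[symmetric] of_real_eq_iff by (simp only: mult.assoc)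
    then show ?thesis
      using D_osc[of j "C (B w)"] by (simp only: Suc diff_Suc_1 scaleC_scaleC) simp
  qed simp
  have "A (D (osc q D k w)) = D (osc q D k (A w))
      - complex_of_real (inverse q * (1 - q ^ (2 * k))) *\<^sub>C ?y + (Q - inverse Q) *\<^sub>C Q ^ (2 * k) *\<^sub>C ?y"
    unfolding AD Suc.IH CB lins D_pred ..
  also have "\<dots> = D (osc q D k (A w)) - complex_of_real (inverse q * (1 - q ^ (2 * (k + 1)))) *\<^sub>C ?y"
  proof -
    have "complex_of_real (inverse q * (1 - q ^ (2 * (k + 1))))
        = complex_of_real (inverse q * (1 - q ^ (2 * k))) - (Q - inverse Q) * Q ^ (2 * k)"
      using q by (simp add: Q_def field_simps power_add power2_eq_square)
    then show ?thesis
      by (simp only: scaleC_scaleC scaleC_diff_left) simp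
  qed
  finally have "A (osc q D (Suc k) w) = osc q D (Suc k) (A w)
      - complex_of_real (?r * (inverse q * (1 - q ^ (2 * (k + 1))))) *\<^sub>C ?y"
    unfolding osc.simps(2)[of q D] by (simp only: lins scaleC_diff_right scaleC_scaleC of_real_mult)
  also have "?r * (inverse q * (1 - q ^ (2 * (k + 1)))) = inverse q * sqrt (1 - q ^ (2 * (k + 1)))"
  proof -
    have "1 / sqrt t * (inverse q * t) = inverse q * sqrt t" if "0 \<le> t" for t
      using real_div_sqrt[OF that] by (simp add: times_divide_eq_right[symmetric] del: times_divide_eq_right)
    then show ?thesis
      using lt by simp
  qed
  finally show ?case
    by simp
qed simp

abbreviation \<Phi>D :: "('h \<Rightarrow> 'h) set"
  where "\<Phi>D \<equiv> osc_words q D {\<lambda>v. v}"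

text \<open>The dichotomy does not cover this step, since \<open>A\<close> and \<open>A'\<close> do
  not q-commute with \<open>D\<close> and \<open>D'\<close>. The family is therefore changed on the
  way, with \<open>F\<close> and \<open>F'\<close> in place of \<open>A\<close> and
  \<open>A'\<close>.\<close>

lemma generates_K: "generates \<Phi>D {B, B', C, C', F, F'} K"
proof -
  interpret D: q_oscillator q D D' UNIV
    by (rule oscillator_D)
  have K: "{v \<in> UNIV. D' v = 0} = K"
    by (simp add: K_def)
  have "generates \<Phi>D {B, B', C, C', F, F'} {v \<in> UNIV. D' v = 0}"
  proof (rule D.generates_vacuum[OF generates_initial])
    show "bounded_clinear X" if "X \<in> {B, B', C, C', F, F'}" for X
      using that bl adjoint_pair_bounded_clinear[OF adjF] by auto
    show "X v \<in> UNIV \<and> D' (X v) = 0" if "X \<in> {B, B', C, C', F, F'}" "D' v = 0" for X v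
      using that K_invariant[of v] by (auto simp: K_def)
  next
    fix G X g n
    assume G: "csubspace G" "G \<subseteq> {v \<in> UNIV. D' v = 0}"
      and inv: "\<And>X g. X \<in> {B, B', C, C', F, F'} \<Longrightarrow> g \<in> G \<Longrightarrow> X g \<in> G"
      and X: "X \<in> {A, A', B, B', C, C', D, D'}" and g: "g \<in> G"
    let ?S = "{osc q D n g |n g. g \<in> G}"
    have gK: "g \<in> K"
      using G g by (auto simp: K_def)
    have base: "osc q D n g \<in> cspan ?S" if "g \<in> G" for n g
      using that by (intro cspan_base) blast
    have S: "csubspace (cspan ?S)"
      by (rule csubspace_cspan)
    note mem = inv[of B, simplified] inv[of B', simplified] inv[of C, simplified] inv[of C', simplified]
      inv[of F, simplified] inv[of F', simplified]
    show "X (osc q D n g) \<in> cspan ?S"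
      using X
    proof (elim insertE emptyE)
      assume X: "X = A"
      have "A g \<in> G"
        using mem(5)[OF g] gK by (simp add: F_eq_A)
      then show ?thesis
        unfolding X A_osc_D by (intro csubspace_diff[OF S] cspan_scale base mem g)
    next
      assume X: "X = A'"
      \<comment> \<open>\<open>A'\<close> leaves \<open>K\<close> only through an image under
        \<open>D\<close>, which is again a member of an orbit of \<open>G\<close>.\<close>
      have A': "A' g = F' g - inverse Q *\<^sub>C D (B' (C' g))"
        by (simp add: F'_def)
      show ?thesis
        unfolding X A'_osc_D A' osc_lins D_commute_osc D_osc
        by (intro csubspace_diff[OF S] cspan_scale base mem g)
    next
      assume X: "X = D'"
      have "D' g = 0"
        using gK by (simp add: K_def)
      then show ?thesis
        unfolding X by (simp only: D.osc_lower UNIV_I) (intro cspan_scale base g)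
    qed (simp_all only: B_osc_D B'_osc_D C_osc_D C'_osc_D D_osc cspan_scale base mem g)
  qed
  then show ?thesis
    unfolding K .
qed

lemma inner_osc_D:
  "v \<in> K \<Longrightarrow> w \<in> K \<Longrightarrow> cinner (osc q D n v) (osc q D m w) = (if n = m then cinner v w else 0)"
  using q_oscillator.osc_inner_vacuum[OF oscillator_D, of v w n m] by (simp add: K_def)

lemma inner_osc_B:
  "\<lbrakk>v \<in> K; w \<in> K; B' v = 0; B' w = 0\<rbrakk> \<Longrightarrow>
    cinner (osc q B n v) (osc q B m w) = (if n = m then cinner v w else 0)"
  by (rule q_oscillator.osc_inner_vacuum[OF oscillator_B]) (auto simp: closed_csubspace_K K_invariant)

lemma inner_osc_C:
  "\<lbrakk>v \<in> K; w \<in> K; C' v = 0; C' w = 0\<rbrakk> \<Longrightarrow>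
    cinner (osc q C n v) (osc q C m w) = (if n = m then cinner v w else 0)"
  by (rule q_oscillator.osc_inner_vacuum[OF oscillator_C]) (auto simp: closed_csubspace_K K_invariant)

subsection \<open>Bases spanned by a common vacuum vector\<close>

abbreviation KB :: "'h set"
  where "KB \<equiv> {v \<in> K. B' v = 0}"

abbreviation KC :: "'h set"
  where "KC \<equiv> {v \<in> K. C' v = 0}"

abbreviation KBC :: "'h set"
  where "KBC \<equiv> {v \<in> KB. C' v = 0}"

lemma B'_osc_C: "B' (osc q C k w) = osc q C k (B' w)"
  using osc_commute_UNIV[of B' C 1 k w] by (simp add: bl B'C)

lemma closed_csubspace_KB: "closed_csubspace KB"
  by (rule q_oscillator.closed_csubspace_vacuum[OF oscillator_B])
    (simp_all add: closed_csubspace_K K_invariant)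

lemma closed_csubspace_KBC: "closed_csubspace KBC"
  by (rule q_oscillator.closed_csubspace_vacuum[OF oscillator_C])
    (simp_all add: closed_csubspace_KB K_invariant B'C C'B'[symmetric] lins)

lemma F_zero_if_defect_zero:
  assumes L: "L \<subseteq> K" "\<And>v. v \<in> L \<Longrightarrow> F' v \<in> L"
    and z: "\<And>v. v \<in> L \<Longrightarrow> v - B (B' v) - C (C' v) + C (B (B' (C' v))) = 0" and v: "v \<in> L"
  shows "F v = 0" "F' v = 0"
proof -
  have "F' (F v) = complex_of_real (q\<^sup>2) *\<^sub>C F (F' v)" if "v \<in> L" for v
    using F'F[of v] z[OF that] L(1) that by (auto simp: Q_def)
  from oscillator_null[OF q adjF L(2) this v] show "F v = 0" "F' v = 0"
    by blast+
qed

lemma oscillator_F: "q_oscillator q F F' KBC"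
proof
  show "closed_csubspace KBC"
    by (rule closed_csubspace_KBC)
  show "F' (F v) = complex_of_real (q\<^sup>2) *\<^sub>C F (F' v) + complex_of_real (1 - q\<^sup>2) *\<^sub>C v" if "v \<in> KBC" for v
    using F'F[of v] that by (auto simp: Q_def lins)
qed (use q adjF in \<open>auto simp: K_invariant B'_F B'_F' C'_F C'_F'
      bounded_clinear_zero[OF adjoint_pair_bounded_clinear(1)[OF adjF]]
      bounded_clinear_zero[OF adjoint_pair_bounded_clinear(2)[OF adjF]]\<close>)

lemma C_B_osc:
  "C (B (osc q B m (osc q C l w)))
    = complex_of_real (sqrt (1 - q ^ (2 * (m + 1))) * sqrt (1 - q ^ (2 * (l + 1))))
      *\<^sub>C osc q B (m + 1) (osc q C (l + 1) w)"
  by (simp add: B_osc C_osc lins C_osc_B osc_lins scaleC_scaleC del: osc.simps)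

text \<open>Inside \<open>K\<close> the operator \<open>A\<close> is \<open>F\<close>, which passes
  \<open>m\<close> factors \<open>B\<close> and \<open>l\<close> factors \<open>C\<close>. The value
  \<open>f\<close> is left open: it is a multiple of the next vector of an orbit in series 6 and a
  multiple of \<open>w\<close> in series 5.\<close>

lemma A_osc_full:
  assumes w: "w \<in> K" and Fw: "F w = f"
  shows "A (osc q D k (osc q B m (osc q C l w)))
    = Q ^ (m + l) *\<^sub>C osc q D k (osc q B m (osc q C l f))
      - complex_of_real (inverse q * sqrt ((1 - q ^ (2 * (l + 1))) * (1 - q ^ (2 * (m + 1))) * (1 - q ^ (2 * k))))
        *\<^sub>C osc q D (k - 1) (osc q B (m + 1) (osc q C (l + 1) w))"
proof -
  have "A (osc q B m (osc q C l w)) = Q ^ (m + l) *\<^sub>C osc q B m (osc q C l f)"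
    using F_eq_A[OF osc_B_mem_K[OF osc_C_mem_K[OF w]], symmetric] w
    by (simp add: F_osc_B F_osc_C osc_C_mem_K Fw osc_lins scaleC_scaleC power_add)
  then show ?thesis
    unfolding A_osc_D C_B_osc
    by (simp add: osc_lins scaleC_scaleC real_sqrt_mult mult_ac del: osc.simps)
qed

text \<open>Here and in the definitions below the formulas of a series are imposed on the given
  operators in a basis of the original space; only afterwards is everything transported to
  \<open>ell2\<close>.\<close>

definition rho_basis :: "(nat \<times> nat \<times> nat \<times> nat \<Rightarrow> 'h) \<Rightarrow> bool"
  where "rho_basis e \<longleftrightarrow> orthonormal e \<and> total_family e \<and> (\<forall>s m l k.
      A (e (s, m, l, k)) = complex_of_real (q ^ (m + l) * sqrt (1 - q ^ (2 * (s + 1)))) *\<^sub>C e (s + 1, m, l, k)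
          - complex_of_real (inverse q * sqrt ((1 - q ^ (2 * (l + 1))) * (1 - q ^ (2 * (m + 1)))
              * (1 - q ^ (2 * k)))) *\<^sub>C e (s, m + 1, l + 1, k - 1) \<and>
      B (e (s, m, l, k)) = complex_of_real (q ^ k * sqrt (1 - q ^ (2 * (m + 1)))) *\<^sub>C e (s, m + 1, l, k) \<and>
      C (e (s, m, l, k)) = complex_of_real (q ^ k * sqrt (1 - q ^ (2 * (l + 1)))) *\<^sub>C e (s, m, l + 1, k) \<and>
      D (e (s, m, l, k)) = complex_of_real (sqrt (1 - q ^ (2 * (k + 1)))) *\<^sub>C e (s, m, l, k + 1))"

text \<open>The order of the words is forced by the order of the vacuum spaces, with
  \<open>F\<close> innermost. Orthonormality is peeled off from outside: each inner vector is a
  vacuum vector of the next operator, for \<open>B\<close> because \<open>B'\<close> commutes with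
  \<open>C\<close>.\<close>

lemma basis_rho:
  assumes gen: "generates (osc_words q F (osc_words q C (osc_words q B \<Phi>D))) {} {v \<in> KBC. F' v = 0}"
    and v: "v \<in> KBC" "F' v = 0" "cinner v v = 1"
  shows "\<exists>e. rho_basis e"
proof -
  define e where "e = (\<lambda>(s, m, l, k). osc q D k (osc q B m (osc q C l (osc q F s v))))"
  have e: "e (s, m, l, k) = osc q D k (osc q B m (osc q C l (osc q F s v)))" for s m l k
    by (simp add: e_def)
  have FV: "osc q F s v \<in> KBC" for s
    by (rule q_oscillator.osc_K[OF oscillator_F v(1)])
  have "orthonormal e"
    unfolding orthonormal_def using FV v
    by (auto simp: e inner_osc_D inner_osc_B inner_osc_C osc_B_mem_K osc_C_mem_K B'_osc_C osc_lins
        q_oscillator.osc_inner_vacuum[OF oscillator_F])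
  moreover have "total_family e"
    unfolding total_family_def
  proof (intro allI impI, elim conjE)
    fix Z :: "'h set" assume Z: "closed_csubspace Z" "\<forall>i. e i \<in> Z"
    then have eZ: "osc q D k (osc q B m (osc q C l (osc q F s v))) \<in> Z" for s m l k
      unfolding e[symmetric] by blast
    show "Z = UNIV"
    proof (rule generates_total[OF gen _ _ _ Z(1)])
      show "v \<noteq> 0"
        using v(3) by auto
    qed (use v eZ in \<open>auto elim!: osc_wordsE\<close>)
  qed
  moreover have "A (e (s, m, l, k)) = complex_of_real (q ^ (m + l) * sqrt (1 - q ^ (2 * (s + 1)))) *\<^sub>C e (s + 1, m, l, k)
      - complex_of_real (inverse q * sqrt ((1 - q ^ (2 * (l + 1))) * (1 - q ^ (2 * (m + 1)))
          * (1 - q ^ (2 * k)))) *\<^sub>C e (s, m + 1, l + 1, k - 1)" for s m l k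
    unfolding e using FV[of s] A_osc_full[OF _ F_osc, of s v k m l]
    by (simp add: osc_lins scaleC_scaleC Q_def del: osc.simps)
  moreover have "B (e (s, m, l, k)) = complex_of_real (q ^ k * sqrt (1 - q ^ (2 * (m + 1)))) *\<^sub>C e (s, m + 1, l, k)"
    "C (e (s, m, l, k)) = complex_of_real (q ^ k * sqrt (1 - q ^ (2 * (l + 1)))) *\<^sub>C e (s, m, l + 1, k)"
    "D (e (s, m, l, k)) = complex_of_real (sqrt (1 - q ^ (2 * (k + 1)))) *\<^sub>C e (s, m, l, k + 1)" for s m l k
    unfolding e by (simp_all add: B_osc_D C_osc_D D_osc B_osc C_osc_B C_osc osc_lins scaleC_scaleC Q_def
        del: osc.simps)
  ultimately show ?thesis
    unfolding rho_basis_def by blast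
qed

definition rho_hat_basis :: "real \<Rightarrow> (nat \<times> nat \<times> nat \<Rightarrow> 'h) \<Rightarrow> bool"
  where "rho_hat_basis \<phi> e \<longleftrightarrow> orthonormal e \<and> total_family e \<and> (\<forall>m l k.
      A (e (m, l, k)) = (cis \<phi> * complex_of_real (q ^ (m + l))) *\<^sub>C e (m, l, k)
          - complex_of_real (inverse q * sqrt ((1 - q ^ (2 * (l + 1))) * (1 - q ^ (2 * (m + 1)))
              * (1 - q ^ (2 * k)))) *\<^sub>C e (m + 1, l + 1, k - 1) \<and>
      B (e (m, l, k)) = complex_of_real (q ^ k * sqrt (1 - q ^ (2 * (m + 1)))) *\<^sub>C e (m + 1, l, k) \<and>
      C (e (m, l, k)) = complex_of_real (q ^ k * sqrt (1 - q ^ (2 * (l + 1)))) *\<^sub>C e (m, l + 1, k) \<and>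
      D (e (m, l, k)) = complex_of_real (sqrt (1 - q ^ (2 * (k + 1)))) *\<^sub>C e (m, l, k + 1))"

lemma basis_rho_hat:
  assumes gen: "generates (osc_words q C (osc_words q B \<Phi>D)) {F, F'} KBC"
    and F: "\<And>v. v \<in> KBC \<Longrightarrow> F v = cis \<phi> *\<^sub>C v" "\<And>v. v \<in> KBC \<Longrightarrow> F' v = cis (- \<phi>) *\<^sub>C v"
    and v: "v \<in> KBC" "cinner v v = 1"
  shows "\<exists>e. rho_hat_basis \<phi> e"
proof -
  define e where "e = (\<lambda>(m, l, k). osc q D k (osc q B m (osc q C l v)))"
  have e: "e (m, l, k) = osc q D k (osc q B m (osc q C l v))" for m l k
    by (simp add: e_def)
  have "orthonormal e"
    unfolding orthonormal_def using v
    by (auto simp: e inner_osc_D inner_osc_B inner_osc_C osc_B_mem_K osc_C_mem_K B'_osc_C osc_lins)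
  moreover have "total_family e"
    unfolding total_family_def
  proof (intro allI impI, elim conjE)
    fix Z :: "'h set" assume Z: "closed_csubspace Z" "\<forall>i. e i \<in> Z"
    then have eZ: "osc q D k (osc q B m (osc q C l v)) \<in> Z" for m l k
      unfolding e[symmetric] by blast
    show "Z = UNIV"
    proof (rule generates_total[OF gen v(1) _ _ Z(1)])
      show "v \<noteq> 0"
        using v(2) by auto
      show "\<exists>c. X v = c *\<^sub>C v" if "X \<in> {F, F'}" for X
        using that F v(1) by blast
    qed (use eZ in \<open>auto elim!: osc_wordsE\<close>)
  qed
  moreover have "A (e (m, l, k)) = (cis \<phi> * complex_of_real (q ^ (m + l))) *\<^sub>C e (m, l, k)
      - complex_of_real (inverse q * sqrt ((1 - q ^ (2 * (l + 1))) * (1 - q ^ (2 * (m + 1)))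
          * (1 - q ^ (2 * k)))) *\<^sub>C e (m + 1, l + 1, k - 1)" for m l k
    unfolding e using v A_osc_full[OF _ F(1)[OF v(1)], of k m l]
    by (simp add: osc_lins scaleC_scaleC Q_def mult.commute del: osc.simps)
  moreover have "B (e (m, l, k)) = complex_of_real (q ^ k * sqrt (1 - q ^ (2 * (m + 1)))) *\<^sub>C e (m + 1, l, k)"
    "C (e (m, l, k)) = complex_of_real (q ^ k * sqrt (1 - q ^ (2 * (l + 1)))) *\<^sub>C e (m, l + 1, k)"
    "D (e (m, l, k)) = complex_of_real (sqrt (1 - q ^ (2 * (k + 1)))) *\<^sub>C e (m, l, k + 1)" for m l k
    unfolding e by (simp_all add: B_osc_D C_osc_D D_osc B_osc C_osc_B C_osc osc_lins scaleC_scaleC Q_def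
        del: osc.simps)
  ultimately show ?thesis
    unfolding rho_hat_basis_def by blast
qed

definition rho1_basis :: "real \<Rightarrow> (nat \<times> nat \<Rightarrow> 'h) \<Rightarrow> bool"
  where "rho1_basis \<phi> e \<longleftrightarrow> orthonormal e \<and> total_family e \<and> (\<forall>m k.
      A (e (m, k)) = (- cis \<phi> * complex_of_real
            (inverse q * sqrt (1 - q ^ (2 * (m + 1))) * sqrt (1 - q ^ (2 * k)))) *\<^sub>C e (m + 1, k - 1) \<and>
      B (e (m, k)) = complex_of_real (q ^ k * sqrt (1 - q ^ (2 * (m + 1)))) *\<^sub>C e (m + 1, k) \<and>
      C (e (m, k)) = (cis \<phi> * complex_of_real (q ^ k)) *\<^sub>C e (m, k) \<and>
      D (e (m, k)) = complex_of_real (sqrt (1 - q ^ (2 * (k + 1)))) *\<^sub>C e (m, k + 1))"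

lemma basis_rho1:
  assumes gen: "generates (osc_words q B \<Phi>D) \<B> KB" and eig: "\<And>X. X \<in> \<B> \<Longrightarrow> \<exists>c. X v = c *\<^sub>C v"
    and F: "F v = 0" and C: "C v = cis \<phi> *\<^sub>C v" and v: "v \<in> KB" "cinner v v = 1"
  shows "\<exists>e. rho1_basis \<phi> e"
proof -
  define e where "e = (\<lambda>(m, k). osc q D k (osc q B m v))"
  have e: "e (m, k) = osc q D k (osc q B m v)" for m k
    by (simp add: e_def)
  have "orthonormal e"
    unfolding orthonormal_def using v by (auto simp: e inner_osc_D inner_osc_B osc_B_mem_K)
  moreover have "total_family e"
    unfolding total_family_def
  proof (intro allI impI, elim conjE)
    fix Z :: "'h set" assume Z: "closed_csubspace Z" "\<forall>i. e i \<in> Z"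
    then have eZ: "osc q D k (osc q B m v) \<in> Z" for m k
      unfolding e[symmetric] by blast
    show "Z = UNIV"
    proof (rule generates_total[OF gen v(1) _ _ Z(1)])
      show "v \<noteq> 0"
        using v(2) by auto
      show "\<exists>c. X v = c *\<^sub>C v" if "X \<in> \<B>" for X
        by (rule eig[OF that])
    qed (use eZ in \<open>auto elim!: osc_wordsE\<close>)
  qed
  moreover have "A (e (m, k)) = (- cis \<phi> * complex_of_real
      (inverse q * sqrt (1 - q ^ (2 * (m + 1))) * sqrt (1 - q ^ (2 * k)))) *\<^sub>C e (m + 1, k - 1)" for m k
  proof -
    \<comment> \<open>\<open>F\<close> annihilates \<open>v\<close>, so only the lowering term of
      \<open>A_osc_D\<close> survives; in it \<open>B\<close> raises \<open>m\<close> and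
      \<open>C\<close> contributes the phase.\<close>
    have "A (osc q B m v) = 0"
      using F_eq_A[OF osc_B_mem_K, of v m, symmetric] v by (simp add: F_osc_B F osc_lins)
    then show ?thesis
      unfolding e A_osc_D B_osc lins C_osc_B C osc_lins scaleC_scaleC
      by (simp add: osc_lins scaleC_minus_left mult_ac del: osc.simps)
  qed
  moreover have "B (e (m, k)) = complex_of_real (q ^ k * sqrt (1 - q ^ (2 * (m + 1)))) *\<^sub>C e (m + 1, k)"
    "C (e (m, k)) = (cis \<phi> * complex_of_real (q ^ k)) *\<^sub>C e (m, k)"
    "D (e (m, k)) = complex_of_real (sqrt (1 - q ^ (2 * (k + 1)))) *\<^sub>C e (m, k + 1)" for m k
    unfolding e by (simp_all add: B_osc_D C_osc_D D_osc B_osc C_osc_B C osc_lins scaleC_scaleC Q_def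
        mult.commute del: osc.simps)
  ultimately show ?thesis
    unfolding rho1_basis_def by blast
qed

definition rho2_basis :: "real \<Rightarrow> (nat \<times> nat \<Rightarrow> 'h) \<Rightarrow> bool"
  where "rho2_basis \<phi> e \<longleftrightarrow> orthonormal e \<and> total_family e \<and> (\<forall>m k.
      A (e (m, k)) = (- cis \<phi> * complex_of_real
            (inverse q * sqrt (1 - q ^ (2 * (m + 1))) * sqrt (1 - q ^ (2 * k)))) *\<^sub>C e (m + 1, k - 1) \<and>
      B (e (m, k)) = (cis \<phi> * complex_of_real (q ^ k)) *\<^sub>C e (m, k) \<and>
      C (e (m, k)) = complex_of_real (q ^ k * sqrt (1 - q ^ (2 * (m + 1)))) *\<^sub>C e (m + 1, k) \<and>
      D (e (m, k)) = complex_of_real (sqrt (1 - q ^ (2 * (k + 1)))) *\<^sub>C e (m, k + 1))"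

lemma basis_rho2:
  assumes gen: "generates (osc_words q C \<Phi>D) \<B> KC" and eig: "\<And>X. X \<in> \<B> \<Longrightarrow> \<exists>c. X v = c *\<^sub>C v"
    and F: "F v = 0" and B: "B v = cis \<phi> *\<^sub>C v" and v: "v \<in> KC" "cinner v v = 1"
  shows "\<exists>e. rho2_basis \<phi> e"
proof -
  define e where "e = (\<lambda>(m, k). osc q D k (osc q C m v))"
  have e: "e (m, k) = osc q D k (osc q C m v)" for m k
    by (simp add: e_def)
  have B_osc_C: "B (osc q C m w) = osc q C m (B w)" for m w
    using osc_commute_UNIV[of B C 1 m w] by (simp add: bl BC)
  have "orthonormal e"
    unfolding orthonormal_def using v by (auto simp: e inner_osc_D inner_osc_C osc_C_mem_K)
  moreover have "total_family e"
    unfolding total_family_def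
  proof (intro allI impI, elim conjE)
    fix Z :: "'h set" assume Z: "closed_csubspace Z" "\<forall>i. e i \<in> Z"
    then have eZ: "osc q D k (osc q C m v) \<in> Z" for m k
      unfolding e[symmetric] by blast
    show "Z = UNIV"
    proof (rule generates_total[OF gen v(1) _ _ Z(1)])
      show "v \<noteq> 0"
        using v(2) by auto
      show "\<exists>c. X v = c *\<^sub>C v" if "X \<in> \<B>" for X
        by (rule eig[OF that])
    qed (use eZ in \<open>auto elim!: osc_wordsE\<close>)
  qed
  moreover have "A (e (m, k)) = (- cis \<phi> * complex_of_real
      (inverse q * sqrt (1 - q ^ (2 * (m + 1))) * sqrt (1 - q ^ (2 * k)))) *\<^sub>C e (m + 1, k - 1)" for m k
  proof -
    have "A (osc q C m v) = 0"
      using F_eq_A[OF osc_C_mem_K, of v m, symmetric] v by (simp add: F_osc_C F osc_lins)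
    then show ?thesis
      unfolding e A_osc_D B_osc_C lins B C_osc osc_lins scaleC_scaleC
      by (simp add: osc_lins scaleC_minus_left mult_ac del: osc.simps)
  qed
  moreover have "B (e (m, k)) = (cis \<phi> * complex_of_real (q ^ k)) *\<^sub>C e (m, k)"
    "C (e (m, k)) = complex_of_real (q ^ k * sqrt (1 - q ^ (2 * (m + 1)))) *\<^sub>C e (m + 1, k)"
    "D (e (m, k)) = complex_of_real (sqrt (1 - q ^ (2 * (k + 1)))) *\<^sub>C e (m, k + 1)" for m k
    unfolding e by (simp_all add: B_osc_D C_osc_D D_osc C_osc B_osc_C B osc_lins scaleC_scaleC Q_def
        mult.commute del: osc.simps)
  ultimately show ?thesis
    unfolding rho2_basis_def by blast
qed

definition rho_pair_basis :: "real \<Rightarrow> real \<Rightarrow> (nat \<Rightarrow> 'h) \<Rightarrow> bool"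
  where "rho_pair_basis \<phi>1 \<phi>2 e \<longleftrightarrow> orthonormal e \<and> total_family e \<and> (\<forall>k.
      A (e k) = (- cis (\<phi>1 + \<phi>2) * complex_of_real (inverse q * sqrt (1 - q ^ (2 * k)))) *\<^sub>C e (k - 1) \<and>
      B (e k) = (cis \<phi>1 * complex_of_real (q ^ k)) *\<^sub>C e k \<and>
      C (e k) = (cis \<phi>2 * complex_of_real (q ^ k)) *\<^sub>C e k \<and>
      D (e k) = complex_of_real (sqrt (1 - q ^ (2 * (k + 1)))) *\<^sub>C e (k + 1))"

lemma basis_rho_pair:
  assumes gen: "generates \<Phi>D \<B> K" and eig: "\<And>X. X \<in> \<B> \<Longrightarrow> \<exists>c. X v = c *\<^sub>C v"
    and F: "F v = 0" and B: "B v = cis \<phi>1 *\<^sub>C v" and C: "C v = cis \<phi>2 *\<^sub>C v"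
    and v: "v \<in> K" "cinner v v = 1"
  shows "\<exists>e. rho_pair_basis \<phi>1 \<phi>2 e"
proof -
  define e where "e k = osc q D k v" for k
  have "orthonormal e"
    unfolding orthonormal_def using v by (auto simp: e_def inner_osc_D)
  moreover have "total_family e"
    unfolding total_family_def
  proof (intro allI impI, elim conjE)
    fix Z :: "'h set" assume Z: "closed_csubspace Z" "\<forall>i. e i \<in> Z"
    show "Z = UNIV"
    proof (rule generates_total[OF gen v(1) _ _ Z(1)])
      show "v \<noteq> 0"
        using v(2) by auto
      show "\<exists>c. X v = c *\<^sub>C v" if "X \<in> \<B>" for X
        by (rule eig[OF that])
    qed (use Z in \<open>auto simp: e_def elim!: osc_wordsE\<close>)
  qed
  moreover have "A (e k) = (- cis (\<phi>1 + \<phi>2) * complex_of_real (inverse q * sqrt (1 - q ^ (2 * k)))) *\<^sub>C e (k - 1)" for k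
    using F_eq_A[OF v(1)] unfolding e_def A_osc_D B lins C osc_lins scaleC_scaleC F
    by (simp add: scaleC_minus_left cis_mult[symmetric] osc_lins mult_ac del: osc.simps)
  moreover have "B (e k) = (cis \<phi>1 * complex_of_real (q ^ k)) *\<^sub>C e k"
    "C (e k) = (cis \<phi>2 * complex_of_real (q ^ k)) *\<^sub>C e k"
    "D (e k) = complex_of_real (sqrt (1 - q ^ (2 * (k + 1)))) *\<^sub>C e (k + 1)" for k
    unfolding e_def by (simp_all add: B_osc_D C_osc_D D_osc B C osc_lins scaleC_scaleC Q_def
        mult.commute del: osc.simps)
  ultimately show ?thesis
    unfolding rho_pair_basis_def by blast
qed

subsection \<open>Classification\<close>

lemma B_relations_K:
  "\<forall>X\<in>{C, C', F, F'}. \<exists>c. \<forall>u\<in>K. X (B u) = c *\<^sub>C B (X u)"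
  "\<forall>X\<in>{C, C', F, F'}. \<exists>c. \<forall>u\<in>K. B' (X u) = c *\<^sub>C X (B' u)"
proof -
  \<comment> \<open>The factor 1 is made explicit so that plain commutation has the shape of a
    q-commutation.\<close>
  have "C (B u) = 1 *\<^sub>C B (C u)" "C' (B u) = 1 *\<^sub>C B (C' u)"
    "B' (C u) = 1 *\<^sub>C C (B' u)" "B' (C' u) = 1 *\<^sub>C C' (B' u)" for u
    by (simp_all add: BC C'B B'C C'B')
  then show "\<forall>X\<in>{C, C', F, F'}. \<exists>c. \<forall>u\<in>K. X (B u) = c *\<^sub>C B (X u)"
    "\<forall>X\<in>{C, C', F, F'}. \<exists>c. \<forall>u\<in>K. B' (X u) = c *\<^sub>C X (B' u)"
    using F_B F'_B B'_F B'_F' by blast+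
qed

lemma C_relations_K:
  "\<forall>X\<in>{F, F'}. \<exists>c. \<forall>u\<in>K. X (C u) = c *\<^sub>C C (X u)"
  "\<forall>X\<in>{F, F'}. \<exists>c. \<forall>u\<in>K. C' (X u) = c *\<^sub>C X (C' u)"
  using F_C F'_C C'_F C'_F' by blast+

lemmas blF = adjoint_pair_bounded_clinear[OF adjF]

text \<open>The unitary \<open>B\<close> becomes the phase \<open>\<phi>1\<close> and drops out of
  the family. A unitary \<open>C\<close> then gives series 3, a vacuum vector of \<open>C\<close>
  gives series 4b.\<close>

lemma classification_B_unitary:
  assumes BB': "\<And>v. v \<in> K \<Longrightarrow> B (B' v) = v" "\<And>v. v \<in> K \<Longrightarrow> B' (B v) = v" and K0: "K \<noteq> {0}"
  shows "(\<exists>\<phi>1\<in>{0..<2 * pi}. \<exists>\<phi>2\<in>{0..<2 * pi}. \<exists>e. rho_pair_basis \<phi>1 \<phi>2 e) \<or>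
    (\<exists>\<phi>\<in>{0..<2 * pi}. \<exists>e. rho2_basis \<phi> e)"
proof -
  have F0: "F v = 0" "F' v = 0" if "v \<in> K" for v
  proof -
    have "v - B (B' v) - C (C' v) + C (B (B' (C' v))) = 0" if "v \<in> K" for v
      using that BB'(1) K_invariant by simp
    from F_zero_if_defect_zero[OF order_refl K_invariant(6) this \<open>v \<in> K\<close>] show "F v = 0" "F' v = 0"
      by blast+
  qed
  \<comment> \<open>The relations of \<open>B\<close> with \<open>F\<close> and \<open>F'\<close>
    carry the factor \<open>Q\<close>; they become commutations because \<open>F\<close> and
    \<open>F'\<close> vanish on \<open>K\<close>.\<close>
  have comm: "B (X v) = X (B v) \<and> B' (X v) = X (B' v)" if "X \<in> {B, B', C, C', F, F'}" "v \<in> K" for X v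
    using that F0 K_invariant[OF that(2)] BB' by (auto simp: BC C'B B'C C'B' lins)
  obtain \<phi>1 where \<phi>1: "\<phi>1 \<in> {0..<2 * pi}" and B: "\<And>v. v \<in> K \<Longrightarrow> B v = cis \<phi>1 *\<^sub>C v"
    "\<And>v. v \<in> K \<Longrightarrow> B' v = cis (- \<phi>1) *\<^sub>C v"
    using schur_unitary[OF generates_K adj(2) K_invariant(1,2) BB'(2)] comm by blast
  have genC: "generates \<Phi>D {C, C', F, F'} K"
  proof (rule generates_change_family[OF generates_K])
    show "bounded_clinear X" if "X \<in> {C, C', F, F'}" for X
      using that bl blF by auto
    show "X v \<in> K" if "X \<in> {C, C', F, F'}" "v \<in> K" for X v
      using that K_invariant[OF that(2)] by auto
    fix G X g
    assume G: "csubspace G" "G \<subseteq> K" and inv: "\<And>X g. X \<in> {C, C', F, F'} \<Longrightarrow> g \<in> G \<Longrightarrow> X g \<in> G"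
      and X: "X \<in> {B, B', C, C', F, F'}" and g: "g \<in> G"
    have "B g \<in> G" "B' g \<in> G"
      using G g by (auto simp: B subset_iff intro: csubspaceD)
    then show "X g \<in> G"
      using X inv[OF _ g] by auto
  qed
  interpret C: q_oscillator q C C' K
    by (rule oscillator_C) (auto simp: closed_csubspace_K K_invariant)
  show ?thesis
  proof (cases rule: C.vacuum_or_unitary[OF genC C_relations_K, case_names unitary vacuum])
    case unitary
    have comm: "C (X v) = X (C v) \<and> C' (X v) = X (C' v)" if "X \<in> {C, C', F, F'}" "v \<in> K" for X v
      using that F0 K_invariant[OF that(2)] unitary by (auto simp: lins)
    obtain \<phi>2 where \<phi>2: "\<phi>2 \<in> {0..<2 * pi}" and C: "\<And>v. v \<in> K \<Longrightarrow> C v = cis \<phi>2 *\<^sub>C v"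
      "\<And>v. v \<in> K \<Longrightarrow> C' v = cis (- \<phi>2) *\<^sub>C v"
      using schur_unitary[OF genC adj(3) K_invariant(3,4) unitary(2)] comm by blast
    obtain w where "w \<in> K" "w \<noteq> 0"
      using K0 csubspaceD(1)[OF csubspace_K] by blast
    then obtain v where v: "v \<in> K" "cinner v v = 1"
      using ex_unit_vector[OF csubspace_K] by blast
    have "\<exists>c. X v = c *\<^sub>C v" if "X \<in> {C, C', F, F'}" for X
    proof -
      have "F v = 0 *\<^sub>C v" "F' v = 0 *\<^sub>C v"
        using F0 v(1) by simp_all
      then show ?thesis
        using that C[OF v(1)] by blast
    qed
    then show ?thesis
      using basis_rho_pair[OF genC _ F0(1)[OF v(1)] B(1)[OF v(1)] C(1)[OF v(1)] v] \<phi>1 \<phi>2 by blast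
  next
    case (vacuum w)
    then obtain v where v: "v \<in> KC" "cinner v v = 1"
      using ex_unit_vector[OF generates_csubspace[OF vacuum(4)], of w] by blast
    have vK: "v \<in> K"
      using v(1) by simp
    have "\<exists>c. X v = c *\<^sub>C v" if "X \<in> {F, F'}" for X
    proof -
      have "F v = 0 *\<^sub>C v" "F' v = 0 *\<^sub>C v"
        using F0 vK by simp_all
      then show ?thesis
        using that by blast
    qed
    then show ?thesis
      using basis_rho2[OF vacuum(4) _ F0(1)[OF vK] B(1)[OF vK] v] \<phi>1 by blast
  qed
qed

text \<open>On \<open>KB\<close> a unitary \<open>C\<close> gives series 4a. Otherwise
  \<open>F\<close> acts on the common vacuum space of \<open>B\<close> and \<open>C\<close>: a
  unitary \<open>F\<close> gives series 5, a vacuum vector series 6.\<close>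

lemma classification_B_vacuum:
  assumes gen: "generates (osc_words q B \<Phi>D) {C, C', F, F'} KB" and KB0: "KB \<noteq> {0}"
  shows "(\<exists>\<phi>\<in>{0..<2 * pi}. \<exists>e. rho1_basis \<phi> e) \<or> (\<exists>\<phi>\<in>{0..<2 * pi}. \<exists>e. rho_hat_basis \<phi> e) \<or>
    (\<exists>e. rho_basis e)"
proof -
  have KB_inv: "C v \<in> KB" "C' v \<in> KB" "F v \<in> KB" "F' v \<in> KB" if "v \<in> KB" for v
    using generates_invariant[OF gen _ that] by blast+
  interpret C: q_oscillator q C C' KB
    by (rule oscillator_C) (use KB_inv closed_csubspace_KB in auto)
  have commC: "\<forall>X\<in>{F, F'}. \<exists>c. \<forall>u\<in>KB. X (C u) = c *\<^sub>C C (X u)"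
    "\<forall>X\<in>{F, F'}. \<exists>c. \<forall>u\<in>KB. C' (X u) = c *\<^sub>C X (C' u)"
    using C_relations_K by blast+
  show ?thesis
  proof (cases rule: C.vacuum_or_unitary[OF gen commC, case_names unitary vacuum])
    case unitary
    have F0: "F v = 0" "F' v = 0" if "v \<in> KB" for v
    proof -
      \<comment> \<open>Both \<open>v\<close> and \<open>C' v\<close> are killed by
        \<open>B'\<close>, so the defect reduces to \<open>1 - C C'\<close>, which is zero
        here.\<close>
      have "v - B (B' v) - C (C' v) + C (B (B' (C' v))) = 0" if "v \<in> KB" for v
        using that unitary(1)[OF that] by (simp add: C'B'[symmetric] lins)
      from F_zero_if_defect_zero[OF _ KB_inv(4) this \<open>v \<in> KB\<close>] show "F v = 0" "F' v = 0"
        by blast+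
    qed
    have comm: "C (X v) = X (C v) \<and> C' (X v) = X (C' v)" if "X \<in> {C, C', F, F'}" "v \<in> KB" for X v
      using that(1) F0[OF that(2)] F0[OF KB_inv(1)[OF that(2)]] F0[OF KB_inv(2)[OF that(2)]]
        unitary[OF that(2)] by (auto simp: lins)
    obtain \<phi> where \<phi>: "\<phi> \<in> {0..<2 * pi}" and C: "\<And>v. v \<in> KB \<Longrightarrow> C v = cis \<phi> *\<^sub>C v"
      "\<And>v. v \<in> KB \<Longrightarrow> C' v = cis (- \<phi>) *\<^sub>C v"
      using schur_unitary[OF gen adj(3) KB_inv(1,2) unitary(2)] comm by blast
    obtain w where "w \<in> KB" "w \<noteq> 0"
      using KB0 csubspaceD(1)[OF C.csub] by blast
    then obtain v where v: "v \<in> KB" "cinner v v = 1"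
      using ex_unit_vector[OF C.csub] by blast
    have "\<exists>c. X v = c *\<^sub>C v" if "X \<in> {C, C', F, F'}" for X
    proof -
      have "F v = 0 *\<^sub>C v" "F' v = 0 *\<^sub>C v"
        using F0[OF v(1)] by simp_all
      then show ?thesis
        using that C[OF v(1)] by blast
    qed
    then show ?thesis
      using basis_rho1[OF gen _ F0(1)[OF v(1)] C(1)[OF v(1)] v] \<phi> by blast
  next
    case (vacuum w)
    note genF = vacuum(4)
    have KBC_inv: "F v \<in> KBC" "F' v \<in> KBC" if "v \<in> KBC" for v
      using generates_invariant[OF genF _ that] by blast+
    interpret F: q_oscillator q F F' KBC
      by (rule oscillator_F)
    \<comment> \<open>Only \<open>F\<close> and \<open>F'\<close> are left, so the commutation
      premises of the dichotomy hold vacuously.\<close>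
    have no_ops: "\<forall>X\<in>{}. P X" for P :: "('h \<Rightarrow> 'h) \<Rightarrow> bool"
      by simp
    show ?thesis
    proof (cases rule: F.vacuum_or_unitary[OF genF no_ops no_ops, case_names unitary vacuum])
      case unitary
      have comm: "F (X v) = X (F v) \<and> F' (X v) = X (F' v)" if "X \<in> {F, F'}" "v \<in> KBC" for X v
        using that(1) unitary[OF that(2)] by auto
      obtain \<phi> where \<phi>: "\<phi> \<in> {0..<2 * pi}" and F: "\<And>v. v \<in> KBC \<Longrightarrow> F v = cis \<phi> *\<^sub>C v"
        "\<And>v. v \<in> KBC \<Longrightarrow> F' v = cis (- \<phi>) *\<^sub>C v"
        using schur_unitary[OF genF adjF KBC_inv unitary(2)] comm by blast
      have "w \<in> KBC"
        using vacuum(1,2) by simp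
      then obtain v where v: "v \<in> KBC" "cinner v v = 1"
        using ex_unit_vector[OF F.csub _ vacuum(3)] by blast
      then show ?thesis
        using basis_rho_hat[OF genF F v] \<phi> by blast
    next
      case (vacuum u)
      then have "u \<in> {v \<in> KBC. F' v = 0}"
        by simp
      then obtain v where v: "v \<in> {v \<in> KBC. F' v = 0}" "cinner v v = 1"
        using ex_unit_vector[OF generates_csubspace[OF vacuum(4)] _ vacuum(3)] by blast
      then show ?thesis
        using basis_rho[OF vacuum(4), of v] by simp
    qed
  qed
qed

lemma classification_D_vacuum:
  assumes "D' w = 0" "w \<noteq> 0"
  shows "(\<exists>\<phi>1\<in>{0..<2 * pi}. \<exists>\<phi>2\<in>{0..<2 * pi}. \<exists>e. rho_pair_basis \<phi>1 \<phi>2 e) \<or>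
    (\<exists>\<phi>\<in>{0..<2 * pi}. \<exists>e. rho1_basis \<phi> e) \<or> (\<exists>\<phi>\<in>{0..<2 * pi}. \<exists>e. rho2_basis \<phi> e) \<or>
    (\<exists>\<phi>\<in>{0..<2 * pi}. \<exists>e. rho_hat_basis \<phi> e) \<or> (\<exists>e. rho_basis e)"
proof -
  interpret B: q_oscillator q B B' K
    by (rule oscillator_B) (auto simp: closed_csubspace_K K_invariant)
  show ?thesis
  proof (cases rule: B.vacuum_or_unitary[OF generates_K B_relations_K, case_names unitary vacuum])
    case unitary
    have "K \<noteq> {0}"
      using assms by (auto simp: K_def)
    from classification_B_unitary[OF unitary this] show ?thesis
      by blast
  next
    case (vacuum v)
    then have "KB \<noteq> {0}"
      by blast
    from classification_B_vacuum[OF vacuum(4) this] show ?thesis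
      by blast
  qed
qed

text \<open>The condition \<open>cinner x v *\<^sub>C v = x\<close> says that the space is the line
  of \<open>v\<close>.\<close>

definition xi_vector :: "real \<Rightarrow> real \<Rightarrow> 'h \<Rightarrow> bool"
  where "xi_vector \<phi>1 \<phi>2 v \<longleftrightarrow> cinner v v = 1 \<and> (\<forall>x. cinner x v *\<^sub>C v = x) \<and>
    (\<forall>x. A x = (inverse (complex_of_real q) * cis \<phi>1) *\<^sub>C x \<and> B x = 0 \<and> C x = 0 \<and> D x = cis \<phi>2 *\<^sub>C x)"

definition pi_basis :: "real \<Rightarrow> (nat \<Rightarrow> 'h) \<Rightarrow> bool"
  where "pi_basis \<phi> e \<longleftrightarrow> orthonormal e \<and> total_family e \<and>
    (\<forall>k. A (e k) = complex_of_real (inverse q * sqrt (1 - q ^ (2 * (k + 1)))) *\<^sub>C e (k + 1) \<and>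
      D (e k) = cis \<phi> *\<^sub>C e k) \<and> (\<forall>x. B x = 0 \<and> C x = 0)"

text \<open>Once \<open>D D' = 1\<close>, the constant terms of \<open>B'B\<close> and
  \<open>C'C\<close> cancel and \<open>B\<close>, \<open>C\<close> vanish. With them goes the
  inhomogeneous term of \<open>AD\<close>, so \<open>D\<close> commutes with everything.\<close>

lemma classification_no_D_vacuum:
  assumes "\<And>v. D' v = 0 \<Longrightarrow> v = 0"
  shows "(\<exists>\<phi>1\<in>{0..<2 * pi}. \<exists>\<phi>2\<in>{0..<2 * pi}. \<exists>v. xi_vector \<phi>1 \<phi>2 v) \<or>
    (\<exists>\<phi>\<in>{0..<2 * pi}. \<exists>e. pi_basis \<phi> e)"
proof -
  interpret D: q_oscillator q D D' UNIV
    by (rule oscillator_D)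
  have DD': "D (D' v) = v" "D' (D v) = v" for v
    using D.unitary_if_no_vacuum[of v] assms by simp_all
  have "B' (B v) = complex_of_real (q\<^sup>2) *\<^sub>C B (B' v)" "C' (C v) = complex_of_real (q\<^sup>2) *\<^sub>C C (C' v)" for v
    by (simp_all add: B'B C'C DD' Q_def)
  then have BC0: "B v = 0" "B' v = 0" "C v = 0" "C' v = 0" for v
    using oscillator_null[OF q adj(2), of UNIV v] oscillator_null[OF q adj(3), of UNIV v] by simp_all
  have comm: "\<forall>X\<in>{A, A', B, B', C, C', D, D'}. \<forall>v. D (X v) = X (D v) \<and> D' (X v) = X (D' v)"
    by (auto simp: BC0 lins AD A'D D'A D'A' DD')
  obtain \<phi>2 where \<phi>2: "\<phi>2 \<in> {0..<2 * pi}" and D: "\<And>v. D v = cis \<phi>2 *\<^sub>C v" "\<And>v. D' v = cis (- \<phi>2) *\<^sub>C v"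
    using schur_unitary_UNIV[OF generates_initial adj(4) DD'(2) comm] by blast
  \<comment> \<open>With \<open>B = C = 0\<close> and \<open>D D' = 1\<close> the constant in
    \<open>A'A\<close> is \<open>inverse (Q\<^sup>2) * (1 - Q\<^sup>2)\<^sup>2 + (1 - Q\<^sup>2) =
    inverse (Q\<^sup>2) * (1 - Q\<^sup>2)\<close>. Scaling by \<open>Q\<close> normalises
    it.\<close>
  define T where "T = (\<lambda>v. Q *\<^sub>C A v)"
  define T' where "T' = (\<lambda>v. Q *\<^sub>C A' v)"
  have adjT: "adjoint_pair T T'"
    using adjoint_pair_lin_comb[OF adj(1) adj(1), of Q 0] by (simp add: T_def T'_def Q)
  have A_T: "A v = inverse Q *\<^sub>C T v" "A' v = inverse Q *\<^sub>C T' v" for v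
    using Q(1) by (simp_all add: T_def T'_def scaleC_scaleC)
  have gen: "generates {\<lambda>v. v} {T, T'} UNIV"
  proof (rule generates_change_family[OF generates_initial])
    show "bounded_clinear X" if "X \<in> {T, T'}" for X
      using that adjoint_pair_bounded_clinear[OF adjT] by auto
    fix G X g
    assume G: "csubspace G" and inv: "\<And>X g. X \<in> {T, T'} \<Longrightarrow> g \<in> G \<Longrightarrow> X g \<in> G"
      and X: "X \<in> {A, A', B, B', C, C', D, D'}" and g: "g \<in> G"
    have "T g \<in> G" "T' g \<in> G"
      using inv g by auto
    then show "X g \<in> G"
      using X g by (auto simp: A_T BC0 D csubspaceD[OF G])
  qed auto
  interpret T: q_oscillator q T T' UNIV
  proof
    show "T' (T v) = complex_of_real (q\<^sup>2) *\<^sub>C T (T' v) + complex_of_real (1 - q\<^sup>2) *\<^sub>C v" for v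
    proof (rule cvec_eqI)
      fix z
      show "cinner (T' (T v)) z
          = cinner (complex_of_real (q\<^sup>2) *\<^sub>C T (T' v) + complex_of_real (1 - q\<^sup>2) *\<^sub>C v) z"
        using Q unfolding T_def T'_def lins A'A BC0 DD'
        by (simp add: cinner_simps Q_def[symmetric] of_real_power field_simps power2_eq_square)
    qed
  qed (use q adjT in \<open>auto simp: closed_csubspace_UNIV\<close>)
  obtain w :: 'h where w: "w \<noteq> 0"
    using nontrivial by blast
  have no_ops: "\<forall>X\<in>{}. P X" for P :: "('h \<Rightarrow> 'h) \<Rightarrow> bool"
    by simp
  show ?thesis
  proof (cases rule: T.vacuum_or_unitary[OF gen no_ops no_ops, case_names unitary vacuum])
    case unitary
    have T'T: "T' (T v) = v" for v
      using unitary(2) by simp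
    have comm: "\<forall>X\<in>{T, T'}. \<forall>v. T (X v) = X (T v) \<and> T' (X v) = X (T' v)"
      using unitary by auto
    obtain \<phi>1 where \<phi>1: "\<phi>1 \<in> {0..<2 * pi}" and T: "\<And>v. T v = cis \<phi>1 *\<^sub>C v" "\<And>v. T' v = cis (- \<phi>1) *\<^sub>C v"
      using schur_unitary_UNIV[OF gen adjT T'T comm] by blast
    obtain v :: 'h where v: "cinner v v = 1" "v \<noteq> 0"
      using ex_unit_vector[OF T.csub UNIV_I w] by blast
    \<comment> \<open>The vectors fixed by the projection to the line of \<open>v\<close> form a
      closed subspace containing the common eigenvector \<open>v\<close>, so the space is
      one-dimensional.\<close>
    have "{x. cinner x v *\<^sub>C v = x} = UNIV"
    proof (rule generates_total[OF gen UNIV_I v(2)])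
      show "\<exists>c. X v = c *\<^sub>C v" if "X \<in> {T, T'}" for X
        using that T by blast
      have "bounded_clinear (\<lambda>x. cinner x v *\<^sub>C v)"
      proof (rule bounded_clinearI[where K = "norm v * norm v"])
        show "norm (cinner x v *\<^sub>C v) \<le> norm v * norm v * norm x" for x
          using mult_right_mono[OF cmod_cinner_le[of x v], of "norm v"] by (simp add: norm_scaleC mult_ac)
      qed (simp_all add: cinner_simps scaleC_add_left scaleC_scaleC)
      from closed_csubspace_kernel[OF bounded_clinear_lin_comb[OF this bounded_clinear_ident, of 1 "- 1"]]
      show "closed_csubspace {x. cinner x v *\<^sub>C v = x}"
        by (simp add: scaleC_minus1)
      show "\<phi> v \<in> {x. cinner x v *\<^sub>C v = x}" if "\<phi> \<in> {\<lambda>v. v}" for \<phi> :: "'h \<Rightarrow> 'h"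
        using that v by simp
    qed
    then have "xi_vector \<phi>1 \<phi>2 v"
      using v by (auto simp: xi_vector_def A_T T BC0 D scaleC_scaleC Q_def)
    then show ?thesis
      using \<phi>1 \<phi>2 by blast
  next
    case (vacuum w)
    then have "w \<in> {v \<in> UNIV. T' v = 0}"
      by simp
    then obtain v where v: "T' v = 0" "cinner v v = 1" "v \<noteq> 0"
      using ex_unit_vector[OF generates_csubspace[OF vacuum(4)] _ vacuum(3)] by blast
    define e where "e k = osc q T k v" for k
    have "orthonormal e"
      using v by (simp add: orthonormal_def e_def T.osc_inner_vacuum)
    moreover have "total_family e"
      unfolding total_family_def
    proof (intro allI impI, elim conjE)
      fix Z :: "'h set" assume Z: "closed_csubspace Z" "\<forall>i. e i \<in> Z"
      show "Z = UNIV"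
        by (rule generates_total[OF vacuum(4) _ v(3) _ Z(1)])
          (use v Z(2) in \<open>auto simp: e_def elim!: osc_wordsE\<close>)
    qed
    moreover have "A (e k) = complex_of_real (inverse q * sqrt (1 - q ^ (2 * (k + 1)))) *\<^sub>C e (k + 1)" for k
      using osc_raise[OF q, of T k v] by (simp add: e_def A_T scaleC_scaleC Q_def del: osc.simps)
    ultimately have "pi_basis \<phi>2 e"
      by (simp add: pi_basis_def BC0 D)
    then show ?thesis
      using \<phi>2 by blast
  qed
qed

end

section \<open>Irreducible representations\<close>

locale pol_representation =
  fixes q :: real and \<pi> :: "expr set \<Rightarrow> 'h :: chilbert_space \<Rightarrow> 'h"
  assumes rep: "star_representation (Pol q) \<pi>"
begin

section \<open>Expressions as operators\<close>

definition P :: "expr \<Rightarrow> 'h \<Rightarrow> 'h"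
  where "P x = \<pi> (pol_class q x)"

lemma mem_carrier: "pol_class q x \<in> carrier (Pol q)"
  by (simp add: Pol_carrier)

lemma P_bounded: "bounded_clinear (P x)"
  using rep mem_carrier unfolding star_representation_def P_def by blast

lemma P_add: "P (x + y) v = P x v + P y v"
proof -
  have "\<pi> (pol_class q x \<oplus>\<^bsub>Pol q\<^esub> pol_class q y) v = \<pi> (pol_class q x) v + \<pi> (pol_class q y) v"
    using rep mem_carrier unfolding star_representation_def by blast
  then show ?thesis
    by (simp add: P_def Pol_add)
qed

lemma P_mult: "P (x * y) v = P x (P y v)"
proof -
  have "\<pi> (pol_class q x \<otimes>\<^bsub>Pol q\<^esub> pol_class q y) v = \<pi> (pol_class q x) (\<pi> (pol_class q y) v)"
    using rep mem_carrier unfolding star_representation_def by blast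
  then show ?thesis
    by (simp add: P_def Pol_mult)
qed

lemma P_scale: "P (c *\<^sub>C x) v = c *\<^sub>C P x v"
proof -
  have "\<pi> (c \<odot>\<^bsub>Pol q\<^esub> pol_class q x) v = c *\<^sub>C \<pi> (pol_class q x) v"
    using rep mem_carrier unfolding star_representation_def by blast
  then show ?thesis
    by (simp add: P_def Pol_smult)
qed

lemma P_one: "P 1 v = v"
proof -
  have "\<pi> \<one>\<^bsub>Pol q\<^esub> v = v"
    using rep unfolding star_representation_def by blast
  then show ?thesis
    by (simp add: P_def Pol_one)
qed

lemma P_minus: "P (x - y) v = P x v - P y v"
  by (simp add: minus_expr_def P_add P_scale scaleC_minus1)

lemma adjoint_pair_P: "adjoint_pair (P x) (P (x\<^sup>\<star>))"
proof -
  have "cinner (\<pi> (invol (Pol q) (pol_class q x)) u) v = cinner u (\<pi> (pol_class q x) v)" for u v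
    using rep mem_carrier unfolding star_representation_def by blast
  then have "adjoint_pair (P (x\<^sup>\<star>)) (P x)"
    by (simp add: adjoint_pair_def P_bounded) (simp add: P_def Pol_invol)
  then show ?thesis
    by (rule adjoint_pair_sym)
qed

lemma P_cong: "pol_eq q x y \<Longrightarrow> P x = P y"
  by (simp add: P_def pol_class_eq_iff[symmetric])

lemma P_zero: "P 0 v = 0"
  using P_cong[OF pol_eq.add_inverse, of 0] P_add[of "(- 1) *\<^sub>C 0" 0 v]
  by (simp add: P_scale scaleC_minus1)

lemmas P_simps = P_add P_mult P_scale P_one P_minus P_zero

lemma P_star: "P (0\<^sup>\<star>) v = 0" "P (1\<^sup>\<star>) v = v" "P ((x + y)\<^sup>\<star>) v = P (x\<^sup>\<star>) v + P (y\<^sup>\<star>) v"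
    "P ((x * y)\<^sup>\<star>) v = P (y\<^sup>\<star>) (P (x\<^sup>\<star>) v)" "P ((c *\<^sub>C x)\<^sup>\<star>) v = cnj c *\<^sub>C P (x\<^sup>\<star>) v" "P (x\<^sup>\<star>\<^sup>\<star>) v = P x v"
proof -
  note left = adjoint_pair_left[OF adjoint_pair_sym[OF adjoint_pair_P]]
  show "P (0\<^sup>\<star>) v = 0" "P (1\<^sup>\<star>) v = v" "P ((x + y)\<^sup>\<star>) v = P (x\<^sup>\<star>) v + P (y\<^sup>\<star>) v"
    "P ((x * y)\<^sup>\<star>) v = P (y\<^sup>\<star>) (P (x\<^sup>\<star>) v)" "P ((c *\<^sub>C x)\<^sup>\<star>) v = cnj c *\<^sub>C P (x\<^sup>\<star>) v"
    by (rule cvec_eqI; simp add: left P_simps cinner_simps)+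
  show "P (x\<^sup>\<star>\<^sup>\<star>) v = P x v"
    by (simp add: P_cong[OF pol_eq.star_star])
qed

text \<open>The claims for an expression and for its star are proved together, because the case
  \<open>Star\<close> interchanges them.\<close>

lemma invariant_if_generators:
  assumes Z: "csubspace Z" and gen: "\<And>g v. v \<in> Z \<Longrightarrow> P (Gen g) v \<in> Z \<and> P ((Gen g)\<^sup>\<star>) v \<in> Z"
  shows "v \<in> Z \<Longrightarrow> P x v \<in> Z \<and> P (x\<^sup>\<star>) v \<in> Z"
proof (induction x arbitrary: v)
  case (Gen g)
  then show ?case
    by (rule gen)
next
  case Zero
  then show ?case
    using P_zero[of v] P_star(1)[of v] by (simp add: zero_expr_def csubspaceD(1)[OF Z])
next
  case One
  then show ?case
    using P_one[of v] P_star(2)[of v] by (simp add: one_expr_def)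
next
  case (Add x y)
  then show ?case
    by (simp add: plus_expr_def[symmetric] P_add P_star csubspaceD[OF Z])
next
  case (Mult x y)
  then show ?case
    by (simp add: times_expr_def[symmetric] P_mult P_star)
next
  case (Scale c x)
  then show ?case
    by (simp add: scaleC_expr_def[symmetric] P_scale P_star csubspaceD[OF Z])
next
  case (Star x)
  then show ?case
    by (simp add: P_star)
qed

lemma P_relation: "(x, y) \<in> pol_relations q \<Longrightarrow> P x v = P y v"
  using P_cong[OF pol_eq.rel] by simp

end

lemma quantum_matrix_ops_irreducible:
  assumes q: "0 < q" "q < 1" and irr: "irreducible_representation (Pol q) \<pi>"
  shows "quantum_matrix_ops q
    (\<pi> (pol_gen q Z11)) (\<pi> (pol_class q ((Gen Z11)\<^sup>\<star>))) (\<pi> (pol_gen q Z21)) (\<pi> (pol_class q ((Gen Z21)\<^sup>\<star>)))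
    (\<pi> (pol_gen q Z12)) (\<pi> (pol_class q ((Gen Z12)\<^sup>\<star>))) (\<pi> (pol_gen q Z22)) (\<pi> (pol_class q ((Gen Z22)\<^sup>\<star>)))"
proof -
  interpret pol_representation q \<pi>
    using irr by unfold_locales (simp add: irreducible_representation_def)
  note rel = P_relation[unfolded pol_relations_def Let_def]
  show ?thesis
    unfolding pol_gen_def P_def[symmetric]
  proof
    fix v
    let ?A = "Gen Z11" and ?B = "Gen Z21" and ?C = "Gen Z12" and ?D = "Gen Z22" and ?Q = "complex_of_real q"
    show "P ?A (P ?B v) = ?Q *\<^sub>C P ?B (P ?A v)"
      using rel[of "?A * ?B" "?Q *\<^sub>C (?B * ?A)" v] by (simp add: P_simps)
    show "P ?B (P ?C v) = P ?C (P ?B v)"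
      using rel[of "?B * ?C" "?C * ?B" v] by (simp add: P_simps)
    show "P ?A (P ?C v) = ?Q *\<^sub>C P ?C (P ?A v)"
      using rel[of "?A * ?C" "?Q *\<^sub>C (?C * ?A)" v] by (simp add: P_simps)
    show "P ?B (P ?D v) = ?Q *\<^sub>C P ?D (P ?B v)"
      using rel[of "?B * ?D" "?Q *\<^sub>C (?D * ?B)" v] by (simp add: P_simps)
    show "P ?A (P ?D v) = P ?D (P ?A v) + (?Q - inverse ?Q) *\<^sub>C P ?C (P ?B v)"
      using rel[of "?A * ?D - ?D * ?A" "(?Q - inverse ?Q) *\<^sub>C (?C * ?B)" v]
      by (simp add: P_simps diff_eq_eq add.commute)
    show "P ?C (P ?D v) = ?Q *\<^sub>C P ?D (P ?C v)"
      using rel[of "?C * ?D" "?Q *\<^sub>C (?D * ?C)" v] by (simp add: P_simps)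
    show "P (?A\<^sup>\<star>) (P ?A v) = ?Q\<^sup>2 *\<^sub>C P ?A (P (?A\<^sup>\<star>) v)
        - (1 - ?Q\<^sup>2) *\<^sub>C (P ?B (P (?B\<^sup>\<star>) v) + P ?C (P (?C\<^sup>\<star>) v))
        + (inverse (?Q\<^sup>2) * (1 - ?Q\<^sup>2)\<^sup>2) *\<^sub>C P ?D (P (?D\<^sup>\<star>) v) + (1 - ?Q\<^sup>2) *\<^sub>C v"
      using rel[of "?A\<^sup>\<star> * ?A" "?Q\<^sup>2 *\<^sub>C (?A * ?A\<^sup>\<star>) - (1 - ?Q\<^sup>2) *\<^sub>C (?B * ?B\<^sup>\<star> + ?C * ?C\<^sup>\<star>)
        + (inverse (?Q\<^sup>2) * (1 - ?Q\<^sup>2)\<^sup>2) *\<^sub>C (?D * ?D\<^sup>\<star>) + (1 - ?Q\<^sup>2) *\<^sub>C 1" v] by (simp add: P_simps)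
    show "P (?B\<^sup>\<star>) (P ?B v) = ?Q\<^sup>2 *\<^sub>C P ?B (P (?B\<^sup>\<star>) v) - (1 - ?Q\<^sup>2) *\<^sub>C P ?D (P (?D\<^sup>\<star>) v) + (1 - ?Q\<^sup>2) *\<^sub>C v"
      using rel[of "?B\<^sup>\<star> * ?B" "?Q\<^sup>2 *\<^sub>C (?B * ?B\<^sup>\<star>) - (1 - ?Q\<^sup>2) *\<^sub>C (?D * ?D\<^sup>\<star>) + (1 - ?Q\<^sup>2) *\<^sub>C 1" v]
      by (simp add: P_simps)
    show "P (?C\<^sup>\<star>) (P ?C v) = ?Q\<^sup>2 *\<^sub>C P ?C (P (?C\<^sup>\<star>) v) - (1 - ?Q\<^sup>2) *\<^sub>C P ?D (P (?D\<^sup>\<star>) v) + (1 - ?Q\<^sup>2) *\<^sub>C v"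
      using rel[of "?C\<^sup>\<star> * ?C" "?Q\<^sup>2 *\<^sub>C (?C * ?C\<^sup>\<star>) - (1 - ?Q\<^sup>2) *\<^sub>C (?D * ?D\<^sup>\<star>) + (1 - ?Q\<^sup>2) *\<^sub>C 1" v]
      by (simp add: P_simps)
    show "P (?D\<^sup>\<star>) (P ?D v) = ?Q\<^sup>2 *\<^sub>C P ?D (P (?D\<^sup>\<star>) v) + (1 - ?Q\<^sup>2) *\<^sub>C v"
      using rel[of "?D\<^sup>\<star> * ?D" "?Q\<^sup>2 *\<^sub>C (?D * ?D\<^sup>\<star>) + (1 - ?Q\<^sup>2) *\<^sub>C 1" v] by (simp add: P_simps)
    show "P (?A\<^sup>\<star>) (P ?B v) = ?Q *\<^sub>C P ?B (P (?A\<^sup>\<star>) v) + (?Q - inverse ?Q) *\<^sub>C P ?D (P (?C\<^sup>\<star>) v)"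
      using rel[of "?A\<^sup>\<star> * ?B - ?Q *\<^sub>C (?B * ?A\<^sup>\<star>)" "(?Q - inverse ?Q) *\<^sub>C (?D * ?C\<^sup>\<star>)" v]
      by (simp add: P_simps diff_eq_eq add.commute)
    show "P (?D\<^sup>\<star>) (P ?B v) = ?Q *\<^sub>C P ?B (P (?D\<^sup>\<star>) v)"
      using rel[of "?D\<^sup>\<star> * ?B" "?Q *\<^sub>C (?B * ?D\<^sup>\<star>)" v] by (simp add: P_simps)
    show "P (?A\<^sup>\<star>) (P ?C v) = ?Q *\<^sub>C P ?C (P (?A\<^sup>\<star>) v) + (?Q - inverse ?Q) *\<^sub>C P ?D (P (?B\<^sup>\<star>) v)"
      using rel[of "?A\<^sup>\<star> * ?C - ?Q *\<^sub>C (?C * ?A\<^sup>\<star>)" "(?Q - inverse ?Q) *\<^sub>C (?D * ?B\<^sup>\<star>)" v]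
      by (simp add: P_simps diff_eq_eq add.commute)
    show "P (?D\<^sup>\<star>) (P ?C v) = ?Q *\<^sub>C P ?C (P (?D\<^sup>\<star>) v)"
      using rel[of "?D\<^sup>\<star> * ?C" "?Q *\<^sub>C (?C * ?D\<^sup>\<star>)" v] by (simp add: P_simps)
    show "P (?A\<^sup>\<star>) (P ?D v) = P ?D (P (?A\<^sup>\<star>) v)"
      using rel[of "?A\<^sup>\<star> * ?D" "?D * ?A\<^sup>\<star>" v] by (simp add: P_simps)
    show "P (?B\<^sup>\<star>) (P ?C v) = P ?C (P (?B\<^sup>\<star>) v)"
      using rel[of "?B\<^sup>\<star> * ?C" "?C * ?B\<^sup>\<star>" v] by (simp add: P_simps)
  next
    fix Z :: "'a set"
    assume Z: "closed_csubspace Z"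
      and inv: "\<And>X v. X \<in> {P (Gen Z11), P ((Gen Z11)\<^sup>\<star>), P (Gen Z21), P ((Gen Z21)\<^sup>\<star>),
        P (Gen Z12), P ((Gen Z12)\<^sup>\<star>), P (Gen Z22), P ((Gen Z22)\<^sup>\<star>)} \<Longrightarrow> v \<in> Z \<Longrightarrow> X v \<in> Z"
    have "P (Gen g) v \<in> Z \<and> P ((Gen g)\<^sup>\<star>) v \<in> Z" if "v \<in> Z" for g v
      using that by (cases g) (auto intro: inv)
    then have "P x v \<in> Z" if "v \<in> Z" for x v
      using invariant_if_generators[of Z v x] Z that by (simp add: closed_csubspace_iff)
    then have "\<forall>a\<in>carrier (Pol q). \<pi> a ` Z \<subseteq> Z"
      by (auto simp: Pol_carrier P_def)
    then show "Z = {0} \<or> Z = UNIV"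
      using irr Z unfolding irreducible_representation_def by blast
  next
    show "\<exists>x :: 'a. x \<noteq> 0"
      using rep unfolding star_representation_def by blast
  qed (simp_all add: q adjoint_pair_P)
qed

text \<open>The last clause is there for \<open>is_pi\<close>, which asks two generators to vanish
  at every vector and not only on the basis.\<close>

lemma transport_to_ell2:
  fixes e :: "'i \<Rightarrow> 'h :: chilbert_space" and \<pi> :: "'a \<Rightarrow> 'h \<Rightarrow> 'h"
  assumes rep: "star_representation \<A> \<pi>" and e: "orthonormal e" "total_family e"
  obtains \<sigma> U where "star_representation \<A> \<sigma>" "unitarily_equivalent \<A> \<pi> \<sigma>"
    "bounded_clinear U" "\<And>a i. \<sigma> a (ket i) = U (\<pi> a (e i))" "\<And>i. U (e i) = ket i"
    "\<And>a y. (\<And>x. \<pi> a x = 0) \<Longrightarrow> \<sigma> a y = 0"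
proof -
  obtain U :: "'h \<Rightarrow> 'i ell2" where U: "unitary_map U" "\<And>i. U (e i) = ket i"
    using ex_unitary_map[OF e] by blast
  obtain \<sigma> where \<sigma>: "star_representation \<A> \<sigma>" "unitarily_equivalent \<A> \<pi> \<sigma>" "\<And>a x. \<sigma> a (U x) = U (\<pi> a x)"
    using star_representation_transfer[OF rep U(1)] by blast
  show ?thesis
  proof (rule that[OF \<sigma>(1,2)])
    show b: "bounded_clinear U"
      using U(1) by (simp add: unitary_map_def)
    show "\<sigma> a (ket i) = U (\<pi> a (e i))" for a i
      using \<sigma>(3)[of a "e i"] by (simp add: U(2))
    show "\<sigma> a y = 0" if "\<And>x. \<pi> a x = 0" for a y
    proof -
      obtain x where "y = U x"
        using U(1) unfolding unitary_map_def by (metis surjD)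
      then show ?thesis
        by (simp add: \<sigma>(3) that bounded_clinear_zero[OF b])
    qed
  qed (rule U(2))
qed

theorem theorem1:
  fixes q :: real and \<pi> :: "expr set \<Rightarrow> 'h :: chilbert_space \<Rightarrow> 'h"
  assumes "0 < q" and "q < 1"
    and "irreducible_representation (Pol q) \<pi>"
  shows
    "(\<exists>\<phi>1\<in>{0..<2 * pi}. \<exists>\<phi>2\<in>{0..<2 * pi}. \<exists>\<sigma>. is_xi q \<phi>1 \<phi>2 \<sigma> \<and> unitarily_equivalent (Pol q) \<pi> \<sigma>) \<or>
     (\<exists>\<phi>\<in>{0..<2 * pi}. \<exists>\<sigma>. is_pi q \<phi> \<sigma> \<and> unitarily_equivalent (Pol q) \<pi> \<sigma>) \<or>
     (\<exists>\<phi>1\<in>{0..<2 * pi}. \<exists>\<phi>2\<in>{0..<2 * pi}. \<exists>\<sigma>. is_rho_pair q \<phi>1 \<phi>2 \<sigma> \<and> unitarily_equivalent (Pol q) \<pi> \<sigma>) \<or>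
     (\<exists>\<phi>\<in>{0..<2 * pi}. \<exists>\<sigma>. is_rho1 q \<phi> \<sigma> \<and> unitarily_equivalent (Pol q) \<pi> \<sigma>) \<or>
     (\<exists>\<phi>\<in>{0..<2 * pi}. \<exists>\<sigma>. is_rho2 q \<phi> \<sigma> \<and> unitarily_equivalent (Pol q) \<pi> \<sigma>) \<or>
     (\<exists>\<phi>\<in>{0..<2 * pi}. \<exists>\<sigma>. is_rho_hat q \<phi> \<sigma> \<and> unitarily_equivalent (Pol q) \<pi> \<sigma>) \<or>
     (\<exists>\<sigma>. is_rho q \<sigma> \<and> unitarily_equivalent (Pol q) \<pi> \<sigma>)"
proof -
  have rep: "star_representation (Pol q) \<pi>"
    using assms(3) by (simp add: irreducible_representation_def)
  interpret quantum_matrix_ops q "\<pi> (pol_gen q Z11)" "\<pi> (pol_class q ((Gen Z11)\<^sup>\<star>))"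
    "\<pi> (pol_gen q Z21)" "\<pi> (pol_class q ((Gen Z21)\<^sup>\<star>))" "\<pi> (pol_gen q Z12)" "\<pi> (pol_class q ((Gen Z12)\<^sup>\<star>))"
    "\<pi> (pol_gen q Z22)" "\<pi> (pol_class q ((Gen Z22)\<^sup>\<star>))" "complex_of_real q"
    by (rule quantum_matrix_ops_irreducible[OF assms])
  have xi: "\<exists>\<sigma>. is_xi q \<phi>1 \<phi>2 \<sigma> \<and> unitarily_equivalent (Pol q) \<pi> \<sigma>" if "xi_vector \<phi>1 \<phi>2 v" for \<phi>1 \<phi>2 v
  proof -
    have v: "cinner v v = 1" "\<And>x. cinner x v *\<^sub>C v = x"
      using that by (simp_all add: xi_vector_def)
    \<comment> \<open>On a one-dimensional space the coordinate with respect to the unit vector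
      \<open>v\<close> is a unitary map to \<open>complex\<close>, with inverse
      \<open>c \<mapsto> c *\<^sub>C v\<close>.\<close>
    define U where "U = (\<lambda>x. cinner x v)"
    have Ub: "bounded_clinear U"
      using cmod_cinner_le[of _ v] by (intro bounded_clinearI[where K = "norm v"])
        (simp_all add: U_def cinner_simps scaleC_complex_def mult.commute)
    have "cinner (U x) (U y) = cinner x y" for x y
    proof -
      have "cinner x y = cinner (cinner x v *\<^sub>C v) (cinner y v *\<^sub>C v)"
        by (simp add: v)
      then show ?thesis
        by (simp only: cinner_simps v(1)) (simp add: U_def cinner_complex_def)
    qed
    moreover have surj: "U (c *\<^sub>C v) = c" for c
      by (simp add: U_def cinner_simps v)
    then have "surj U"
      by (rule surjI)
    ultimately have "unitary_map U"
      using Ub by (simp add: unitary_map_def)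
    then obtain \<sigma> where \<sigma>: "star_representation (Pol q) \<sigma>" "unitarily_equivalent (Pol q) \<pi> \<sigma>"
      "\<And>a x. \<sigma> a (U x) = U (\<pi> a x)"
      using star_representation_transfer[OF rep] by blast
    have "\<sigma> a x = U (\<pi> a (x *\<^sub>C v))" for a x
      using \<sigma>(3)[of a "x *\<^sub>C v"] by (simp add: surj)
    then have "is_xi q \<phi>1 \<phi>2 \<sigma>"
      using that \<sigma>(1) by (simp add: is_xi_def xi_vector_def bounded_clinear_simps[OF Ub] U_def
          scaleC_complex_def cinner_simps)
    then show ?thesis
      using \<sigma>(2) by blast
  qed
  have pi: "\<exists>\<sigma>. is_pi q \<phi> \<sigma> \<and> unitarily_equivalent (Pol q) \<pi> \<sigma>" if "pi_basis \<phi> e" for \<phi> e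
  proof -
    have e: "orthonormal e" "total_family e"
      using that by (simp_all add: pi_basis_def)
    obtain \<sigma> U where \<sigma>: "star_representation (Pol q) \<sigma>" "unitarily_equivalent (Pol q) \<pi> \<sigma>"
      and U: "bounded_clinear U" "\<And>a i. \<sigma> a (ket i) = U (\<pi> a (e i))" "\<And>i. U (e i) = ket i"
      and z: "\<And>a y. (\<And>x. \<pi> a x = 0) \<Longrightarrow> \<sigma> a y = 0"
      using transport_to_ell2[OF rep e] by metis
    have "is_pi q \<phi> \<sigma>"
      using that \<sigma>(1) unfolding is_pi_def pi_basis_def U(2) by (simp add: bounded_clinear_simps[OF U(1)] U(3) z)
    then show ?thesis
      using \<sigma>(2) by blast
  qed
  have rho_pair: "\<exists>\<sigma>. is_rho_pair q \<phi>1 \<phi>2 \<sigma> \<and> unitarily_equivalent (Pol q) \<pi> \<sigma>"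
    if "rho_pair_basis \<phi>1 \<phi>2 e" for \<phi>1 \<phi>2 e
  proof -
    have e: "orthonormal e" "total_family e"
      using that by (simp_all add: rho_pair_basis_def)
    obtain \<sigma> U where \<sigma>: "star_representation (Pol q) \<sigma>" "unitarily_equivalent (Pol q) \<pi> \<sigma>"
      and U: "bounded_clinear U" "\<And>a i. \<sigma> a (ket i) = U (\<pi> a (e i))" "\<And>i. U (e i) = ket i"
      using transport_to_ell2[OF rep e] by metis
    have "is_rho_pair q \<phi>1 \<phi>2 \<sigma>"
      using that \<sigma>(1) unfolding is_rho_pair_def rho_pair_basis_def U(2)
      by (simp add: bounded_clinear_simps[OF U(1)] U(3))
    then show ?thesis
      using \<sigma>(2) by blast
  qed
  have rho1: "\<exists>\<sigma>. is_rho1 q \<phi> \<sigma> \<and> unitarily_equivalent (Pol q) \<pi> \<sigma>" if "rho1_basis \<phi> e" for \<phi> e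
  proof -
    have e: "orthonormal e" "total_family e"
      using that by (simp_all add: rho1_basis_def)
    obtain \<sigma> U where \<sigma>: "star_representation (Pol q) \<sigma>" "unitarily_equivalent (Pol q) \<pi> \<sigma>"
      and U: "bounded_clinear U" "\<And>a i. \<sigma> a (ket i) = U (\<pi> a (e i))" "\<And>i. U (e i) = ket i"
      using transport_to_ell2[OF rep e] by metis
    have "is_rho1 q \<phi> \<sigma>"
      using that \<sigma>(1) unfolding is_rho1_def rho1_basis_def U(2)
      by (simp add: bounded_clinear_simps[OF U(1)] U(3))
    then show ?thesis
      using \<sigma>(2) by blast
  qed
  have rho2: "\<exists>\<sigma>. is_rho2 q \<phi> \<sigma> \<and> unitarily_equivalent (Pol q) \<pi> \<sigma>" if "rho2_basis \<phi> e" for \<phi> e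
  proof -
    have e: "orthonormal e" "total_family e"
      using that by (simp_all add: rho2_basis_def)
    obtain \<sigma> U where \<sigma>: "star_representation (Pol q) \<sigma>" "unitarily_equivalent (Pol q) \<pi> \<sigma>"
      and U: "bounded_clinear U" "\<And>a i. \<sigma> a (ket i) = U (\<pi> a (e i))" "\<And>i. U (e i) = ket i"
      using transport_to_ell2[OF rep e] by metis
    have "is_rho2 q \<phi> \<sigma>"
      using that \<sigma>(1) unfolding is_rho2_def rho2_basis_def U(2)
      by (simp add: bounded_clinear_simps[OF U(1)] U(3))
    then show ?thesis
      using \<sigma>(2) by blast
  qed
  have rho_hat: "\<exists>\<sigma>. is_rho_hat q \<phi> \<sigma> \<and> unitarily_equivalent (Pol q) \<pi> \<sigma>" if "rho_hat_basis \<phi> e" for \<phi> e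
  proof -
    have e: "orthonormal e" "total_family e"
      using that by (simp_all add: rho_hat_basis_def)
    obtain \<sigma> U where \<sigma>: "star_representation (Pol q) \<sigma>" "unitarily_equivalent (Pol q) \<pi> \<sigma>"
      and U: "bounded_clinear U" "\<And>a i. \<sigma> a (ket i) = U (\<pi> a (e i))" "\<And>i. U (e i) = ket i"
      using transport_to_ell2[OF rep e] by metis
    have "is_rho_hat q \<phi> \<sigma>"
      using that \<sigma>(1) unfolding is_rho_hat_def rho_hat_basis_def U(2)
      by (simp add: bounded_clinear_simps[OF U(1)] U(3))
    then show ?thesis
      using \<sigma>(2) by blast
  qed
  have rho: "\<exists>\<sigma>. is_rho q \<sigma> \<and> unitarily_equivalent (Pol q) \<pi> \<sigma>" if "rho_basis e" for e
  proof -
    have e: "orthonormal e" "total_family e"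
      using that by (simp_all add: rho_basis_def)
    obtain \<sigma> U where \<sigma>: "star_representation (Pol q) \<sigma>" "unitarily_equivalent (Pol q) \<pi> \<sigma>"
      and U: "bounded_clinear U" "\<And>a i. \<sigma> a (ket i) = U (\<pi> a (e i))" "\<And>i. U (e i) = ket i"
      using transport_to_ell2[OF rep e] by metis
    have "is_rho q \<sigma>"
      using that \<sigma>(1) unfolding is_rho_def rho_basis_def U(2)
      by (simp add: bounded_clinear_simps[OF U(1)] U(3))
    then show ?thesis
      using \<sigma>(2) by blast
  qed
  show ?thesis
  proof (cases "\<forall>v. \<pi> (pol_class q ((Gen Z22)\<^sup>\<star>)) v = 0 \<longrightarrow> v = 0")
    case True
    then show ?thesis
      using classification_no_D_vacuum xi pi by metis
  next
    case False
    then obtain w where "\<pi> (pol_class q ((Gen Z22)\<^sup>\<star>)) w = 0" "w \<noteq> 0"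
      by blast
    from classification_D_vacuum[OF this] show ?thesis
      using rho_pair rho1 rho2 rho_hat rho by meson
  qed
qed

end
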